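(* Let $m\ge1$, $p\ge 0$. Every $m$-plane $P^m\subset\mathbb{R}^{m+p}$ (not necessarily passing through the origin), regarded as a $\xi$-submanifold via the inclusion map, is $W$-stable.
   Context: For a smooth immersion $x:M^m\to\mathbb{R}^{m+p}$: $\langle\cdot,\cdot\rangle$ is the Euclidean inner product, $dV$ the induced volume element, $H$ the mean curvature vector (trace of the second fundamental form), $D^\perp$ the normal connection, and $x^\perp$ the normal component of the position vector. $x$ is a $\xi$-submanifold if $H+x^\perp=\xi$ for a normal field $\xi$ with $D^\perp\xi=0$. An $m$-plane is an affine $m$-dimensional subspace; it is a $\xi$-submanifold with $\xi$ the constant vector given by the orthogonal projection of the origin onto the plane. For a $\xi$-submanifold $x$ put $f=\tfrac12|x-\xi|^2$, and for an immersion $y:M\to\mathbb{R}^{m+p}$ put $V_\xi(y)=\int_M e^{-\frac12|y-\xi|^2}dV_y$ with $\xi:M\to\mathbb{R}^{m+p}$ kept fixed. A variation of $x$ is a smooth map $F:M\times(-\varepsilon,\varepsilon)\to\mathbb{R}^{m+p}$ such that each $x_t=F(\cdot,t)$ is an immersion and $x_0=x$; its variation field is $\eta=\partial F/\partial t|_{t=0}$. It is compact if there is a relatively compact open $B\subset M$ containing the support of $\partial F/\partial t(\cdot,t)$ for every $t$; normal if $\eta$ is normal along $x$; $SN$ if it is normal and $\partial^2F/\partial t^2|_{t=0}=0$. An $SN$-variation is $VP$ if $\int_M\langle\eta,N\rangle e^{-f}dV=0$ for every normal field $N$ with $D^\perp N\equiv0$. A $\xi$-submanifold $x$ is $W$-stable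 if $V_\xi(x)<+\infty$ and $\frac{d^2}{dt^2}|_{t=0}V_\xi(x_t)\ge0$ for every compact $VP$-variation. *)

theory Defs
  imports "HOL-Analysis.Analysis"
begin

section \<open>Smooth maps and manifolds\<close>

text \<open>On open subsets of finite-dimensional spaces (the only use below) this is the usual
  notion of a \<open>C^k\<close> map.\<close>

primrec Ck_on ::
  "nat \<Rightarrow> ('a::real_normed_vector \<Rightarrow> 'b::real_normed_vector) \<Rightarrow> 'a set \<Rightarrow> bool" where
  "Ck_on 0 f S \<longleftrightarrow> continuous_on S f"
| "Ck_on (Suc k) f S \<longleftrightarrow>
     (\<forall>x\<in>S. f differentiable (at x)) \<and>
     (\<forall>v. Ck_on k (\<lambda>x. frechet_derivative f (at x) v) S)"

definition smooth_on ::
  "('a::real_normed_vector \<Rightarrow> 'b::real_normed_vector) \<Rightarrow> 'a set \<Rightarrow> bool" where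
  "smooth_on f S \<longleftrightarrow> (\<forall>k. Ck_on k f S)"

text \<open>A chart is a domain together with a coordinate map, whose values outside the domain are
  irrelevant; the dimension of the manifold is \<open>CARD('m)\<close>.\<close>

type_synonym ('a, 'm) chart = "'a set \<times> ('a \<Rightarrow> real^'m)"

definition in_chart :: "('a, 'm::finite) chart \<Rightarrow> ('a \<Rightarrow> 'b) \<Rightarrow> real^'m \<Rightarrow> 'b" where
  "in_chart c h = h \<circ> inv_into (fst c) (snd c)"

definition smooth_manifold :: "'a topology \<Rightarrow> ('a, 'm::finite) chart set \<Rightarrow> bool" where
  "smooth_manifold M A \<longleftrightarrow>
     Hausdorff_space M \<and> second_countable M \<and> (\<Union>c\<in>A. fst c) = topspace M \<and>
     (\<forall>(U, \<phi>)\<in>A. openin M U \<and> open (\<phi> ` U) \<and>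
        homeomorphic_map (subtopology M U) (top_of_set (\<phi> ` U)) \<phi>) \<and>
     (\<forall>(U, \<phi>)\<in>A. \<forall>(V, \<psi>)\<in>A. smooth_on (in_chart (U, \<phi>) \<psi>) (\<phi> ` (U \<inter> V)))"

definition smooth_map ::
  "('a, 'm::finite) chart set \<Rightarrow> ('a \<Rightarrow> 'b::real_normed_vector) \<Rightarrow> bool" where
  "smooth_map A h \<longleftrightarrow> (\<forall>(U, \<phi>)\<in>A. smooth_on (in_chart (U, \<phi>) h) (\<phi> ` U))"

definition pder ::
  "('a, 'm::finite) chart \<Rightarrow> 'm \<Rightarrow> ('a \<Rightarrow> 'b::real_normed_vector) \<Rightarrow> 'a \<Rightarrow> 'b" where
  "pder c i h q = frechet_derivative (in_chart c h) (at (snd c q)) (axis i 1)"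

section \<open>Immersions into Euclidean space\<close>

definition immersion ::
  "'a topology \<Rightarrow> ('a, 'm::finite) chart set \<Rightarrow> ('a \<Rightarrow> real^'n) \<Rightarrow> bool" where
  "immersion M A x \<longleftrightarrow>
     smooth_manifold M A \<and> smooth_map A x \<and>
     (\<forall>c\<in>A. \<forall>q\<in>fst c. inj (frechet_derivative (in_chart c x) (at (snd c q))))"

text \<open>The image of the tangent space at \<open>q\<close> under the differential of \<open>x\<close>, as a linear subspace of
  the ambient space.\<close>

definition tangent_space ::
  "('a, 'm::finite) chart \<Rightarrow> ('a \<Rightarrow> real^'n) \<Rightarrow> 'a \<Rightarrow> (real^'n) set" where
  "tangent_space c x q = range (frechet_derivative (in_chart c x) (at (snd c q)))"

text \<open>For a linear subspace, \<open>closest_point\<close> is the orthogonal projection.\<close>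

definition normal_part ::
  "('a, 'm::finite) chart \<Rightarrow> ('a \<Rightarrow> real^'n) \<Rightarrow> 'a \<Rightarrow> real^'n \<Rightarrow> real^'n" where
  "normal_part c x q v = v - closest_point (tangent_space c x q) v"

definition gram ::
  "('a, 'm::finite) chart \<Rightarrow> ('a \<Rightarrow> real^'n) \<Rightarrow> 'a \<Rightarrow> real^'m^'m" where
  "gram c x q = (\<chi> i j. pder c i x q \<bullet> pder c j x q)"

text \<open>The second fundamental form on the coordinate fields: the normal part of the flat ambient
  derivative of one coordinate field of the immersion along another.\<close>

definition second_fundamental_form ::
  "('a, 'm::finite) chart \<Rightarrow> ('a \<Rightarrow> real^'n) \<Rightarrow> 'a \<Rightarrow> 'm \<Rightarrow> 'm \<Rightarrow> real^'n" where
  "second_fundamental_form c x q i j = normal_part c x q (pder c i (pder c j x) q)"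

text \<open>The trace with respect to the induced metric (without a factor \<open>1/m\<close>).\<close>

definition mean_curvature ::
  "('a, 'm::finite) chart \<Rightarrow> ('a \<Rightarrow> real^'n) \<Rightarrow> 'a \<Rightarrow> real^'n" where
  "mean_curvature c x q =
     (\<Sum>i\<in>UNIV. \<Sum>j\<in>UNIV. matrix_inv (gram c x q) $ i $ j *\<^sub>R second_fundamental_form c x q i j)"

definition normal_along ::
  "('a, 'm::finite) chart set \<Rightarrow> ('a \<Rightarrow> real^'n) \<Rightarrow> ('a \<Rightarrow> real^'n) \<Rightarrow> bool" where
  "normal_along A x N \<longleftrightarrow>
     smooth_map A N \<and> (\<forall>c\<in>A. \<forall>q\<in>fst c. \<forall>v\<in>tangent_space c x q. N q \<bullet> v = 0)"

definition normal_connection ::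
  "('a, 'm::finite) chart \<Rightarrow> ('a \<Rightarrow> real^'n) \<Rightarrow> 'm \<Rightarrow> ('a \<Rightarrow> real^'n) \<Rightarrow> 'a \<Rightarrow> real^'n" where
  "normal_connection c x i N q = normal_part c x q (pder c i N q)"

definition parallel_normal ::
  "('a, 'm::finite) chart set \<Rightarrow> ('a \<Rightarrow> real^'n) \<Rightarrow> ('a \<Rightarrow> real^'n) \<Rightarrow> bool" where
  "parallel_normal A x N \<longleftrightarrow>
     normal_along A x N \<and> (\<forall>c\<in>A. \<forall>q\<in>fst c. \<forall>i. normal_connection c x i N q = 0)"

definition borel_sets_of :: "'a topology \<Rightarrow> 'a set set" where
  "borel_sets_of M = sigma_sets (topspace M) {U. openin M U}"

text \<open>The induced Riemannian measure: the Borel measure on the manifold which in every chart has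
  density \<open>sqrt (det g)\<close> with respect to Lebesgue measure. It is unique because countably many
  chart domains cover the manifold, and it exists by the change of variables formula.\<close>

definition volume_measure ::
  "'a topology \<Rightarrow> ('a, 'm::finite) chart set \<Rightarrow> ('a \<Rightarrow> real^'n) \<Rightarrow> 'a measure" where
  "volume_measure M A y =
     (THE \<mu>. space \<mu> = topspace M \<and> sets \<mu> = borel_sets_of M \<and>
        (\<forall>c\<in>A. \<forall>B\<in>borel_sets_of M. B \<subseteq> fst c \<longrightarrow>
           emeasure \<mu> B =
             (\<integral>\<^sup>+u\<in>snd c ` B. ennreal (sqrt (det (in_chart c (gram c y) u))) \<partial>lborel)))"

section \<open>Stability of \<open>\<xi>\<close>-submanifolds\<close>

definition xi_submanifold ::
  "'a topology \<Rightarrow> ('a, 'm::finite) chart set \<Rightarrow> ('a \<Rightarrow> real^'n) \<Rightarrow> ('a \<Rightarrow> real^'n) \<Rightarrow> bool" where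
  "xi_submanifold M A x \<xi> \<longleftrightarrow>
     immersion M A x \<and> parallel_normal A x \<xi> \<and>
     (\<forall>c\<in>A. \<forall>q\<in>fst c. mean_curvature c x q + normal_part c x q (x q) = \<xi> q)"

definition weighted_volume ::
  "'a topology \<Rightarrow> ('a, 'm::finite) chart set \<Rightarrow> ('a \<Rightarrow> real^'n) \<Rightarrow> ('a \<Rightarrow> real^'n) \<Rightarrow> ennreal" where
  "weighted_volume M A \<xi> y =
     (\<integral>\<^sup>+q. ennreal (exp (- (1/2) * (norm (y q - \<xi> q))\<^sup>2)) \<partial>volume_measure M A y)"

definition variation ::
  "'a topology \<Rightarrow> ('a, 'm::finite) chart set \<Rightarrow> ('a \<Rightarrow> real^'n) \<Rightarrow> real \<Rightarrow>
     ('a \<Rightarrow> real \<Rightarrow> real^'n) \<Rightarrow> bool" where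
  "variation M A x \<epsilon> F \<longleftrightarrow>
     \<epsilon> > 0 \<and>
     (\<forall>c\<in>A. smooth_on (\<lambda>(u, t). in_chart c (\<lambda>q. F q t) u) ((snd c ` fst c) \<times> {-\<epsilon><..<\<epsilon>})) \<and>
     (\<forall>t\<in>{-\<epsilon><..<\<epsilon>}. immersion M A (\<lambda>q. F q t)) \<and>
     (\<forall>q\<in>topspace M. F q 0 = x q)"

definition velocity :: "('a \<Rightarrow> real \<Rightarrow> real^'n) \<Rightarrow> real \<Rightarrow> 'a \<Rightarrow> real^'n" where
  "velocity F t q = vector_derivative (F q) (at t)"

definition variation_field :: "('a \<Rightarrow> real \<Rightarrow> real^'n) \<Rightarrow> 'a \<Rightarrow> real^'n" where
  "variation_field F = velocity F 0"

definition compact_variation ::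
  "'a topology \<Rightarrow> real \<Rightarrow> ('a \<Rightarrow> real \<Rightarrow> real^'n) \<Rightarrow> bool" where
  "compact_variation M \<epsilon> F \<longleftrightarrow>
     (\<exists>B. openin M B \<and> compactin M (M closure_of B) \<and>
        (\<forall>t\<in>{-\<epsilon><..<\<epsilon>}. M closure_of {q \<in> topspace M. velocity F t q \<noteq> 0} \<subseteq> B))"

definition SN_variation ::
  "'a topology \<Rightarrow> ('a, 'm::finite) chart set \<Rightarrow> ('a \<Rightarrow> real^'n) \<Rightarrow>
     ('a \<Rightarrow> real \<Rightarrow> real^'n) \<Rightarrow> bool" where
  "SN_variation M A x F \<longleftrightarrow>
     normal_along A x (variation_field F) \<and>
     (\<forall>q\<in>topspace M. vector_derivative (\<lambda>t. velocity F t q) (at 0) = 0)"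

definition VP_variation ::
  "'a topology \<Rightarrow> ('a, 'm::finite) chart set \<Rightarrow> ('a \<Rightarrow> real^'n) \<Rightarrow> ('a \<Rightarrow> real^'n) \<Rightarrow>
     ('a \<Rightarrow> real \<Rightarrow> real^'n) \<Rightarrow> bool" where
  "VP_variation M A x \<xi> F \<longleftrightarrow>
     SN_variation M A x F \<and>
     (\<forall>N. parallel_normal A x N \<longrightarrow>
        (\<integral>q. (variation_field F q \<bullet> N q) * exp (- (1/2) * (norm (x q - \<xi> q))\<^sup>2)
           \<partial>volume_measure M A x) = 0)"

text \<open>The second derivative at \<open>0\<close> exists and is nonnegative.\<close>

definition second_derivative_nonneg_at_0 :: "(real \<Rightarrow> real) \<Rightarrow> bool" where
  "second_derivative_nonneg_at_0 v \<longleftrightarrow>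
     (\<exists>v' d. (\<forall>\<^sub>F t in nhds 0. (v has_real_derivative v' t) (at t)) \<and>
        (v' has_real_derivative d) (at 0) \<and> d \<ge> 0)"

text \<open>Along a compact variation of an immersion of finite weighted volume, the weighted volume
  stays finite, so \<open>enn2real\<close> loses nothing.\<close>

definition W_stable ::
  "'a topology \<Rightarrow> ('a, 'm::finite) chart set \<Rightarrow> ('a \<Rightarrow> real^'n) \<Rightarrow> ('a \<Rightarrow> real^'n) \<Rightarrow> bool" where
  "W_stable M A x \<xi> \<longleftrightarrow>
     xi_submanifold M A x \<xi> \<and>
     weighted_volume M A \<xi> x < \<infinity> \<and>
     (\<forall>\<epsilon> F. variation M A x \<epsilon> F \<and> compact_variation M \<epsilon> F \<and> VP_variation M A x \<xi> F \<longrightarrow>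
        second_derivative_nonneg_at_0 (\<lambda>t. enn2real (weighted_volume M A \<xi> (\<lambda>q. F q t))))"

section \<open>Planes\<close>

text \<open>The standard smooth structure of an affine subspace \<open>P\<close> of dimension \<open>CARD('m)\<close>, given by
  all affine coordinate systems on \<open>P\<close>.\<close>

definition plane_atlas :: "(real^'n) set \<Rightarrow> (real^'n, 'm::finite) chart set" where
  "plane_atlas P =
     {(P, \<lambda>q. L q + b) | L b. linear L \<and> bij_betw (\<lambda>q. L q + b) P UNIV}"

end

(*
  In an isometric affine coordinate q = a + E u of the plane the weight e^{-f} is the Gaussian
  e^{-|u|^2/2}. For an SN-variation with field n the first derivatives at t = 0 of the metric and of
  |x_t - a|^2 vanish, so the second derivative of the weighted volume is the integral of
  (|grad n|^2 - |n|^2) e^{-|u|^2/2}. The mean of n is itself a normal vector, hence a parallel normal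
  field, and the VP condition tested against it shows that n has mean zero. The Gaussian Poincare
  inequality, whose sharp constant is 1, then gives nonnegativity.
*)
theory Submission
  imports Defs "HOL-Probability.Probability"
begin

section \<open>The Gaussian Poincare inequality\<close>

text \<open>\<open>W_stable\<close> also claims that the second derivative exists. Time derivatives
  are therefore carried along as jointly continuous functions. Nothing moves outside a fixed compact
  set, so only an integral over a box is differentiated; the remaining Gaussian mass is constant.
  The plane has H = 0 and xi is the foot \<open>a\<close> of the perpendicular from the origin, so x
  - xi is tangent and a normal n leaves the weight stationary. The tangent space is constant, so the
  derivatives of n are normal too and the metric is stationary. The vanishing acceleration removes
  the remaining second-order terms once space and time derivatives are exchanged. The gradient term
  and |n|^2 both enter with coefficient one, so a Poincare constant above 1 would not do. Linear
  functions are extremal for it: on the line, comparing g with x leaves a perfect square, and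
  tensorisation of the variance carries the same constant to every dimension. The volume is a
  definite description over all affine charts; it is identified once, as a push-forward from
  isometric coordinates.\<close>

lemma (in prob_space) integral_power2_le:
  fixes f :: "'a \<Rightarrow> real"
  assumes "integrable M f" "integrable M (\<lambda>x. (f x)\<^sup>2)"
  shows "(\<integral>x. f x \<partial>M)\<^sup>2 \<le> (\<integral>x. (f x)\<^sup>2 \<partial>M)"
  using variance_eq[OF assms] variance_positive[of f] by linarith

lemma power2_le_power2:
  assumes "\<bar>y\<bar> \<le> (C :: real)"
  shows "y\<^sup>2 \<le> C\<^sup>2" "\<bar>y\<^sup>2\<bar> \<le> C\<^sup>2"
  using power_mono[OF assms, of 2] by simp_all

section \<open>Variance on product probability spaces\<close>

lemma (in prob_space) integrable_abs_bounded:
  fixes f :: "'a \<Rightarrow> real"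
  assumes "f \<in> borel_measurable M" "\<And>x. x \<in> space M \<Longrightarrow> \<bar>f x\<bar> \<le> B"
  shows "integrable M f"
  by (rule integrable_const_bound[of _ B]) (use assms in auto)

lemma (in prob_space) integral_abs_bounded:
  fixes f :: "'a \<Rightarrow> real"
  assumes "f \<in> borel_measurable M" "\<And>x. x \<in> space M \<Longrightarrow> \<bar>f x\<bar> \<le> B"
  shows "\<bar>\<integral>x. f x \<partial>M\<bar> \<le> B"
proof -
  have "\<bar>\<integral>x. f x \<partial>M\<bar> \<le> (\<integral>x. \<bar>f x\<bar> \<partial>M)" by
      (rule integral_abs_bound)
  also have "\<dots> \<le> (\<integral>x. B \<partial>M)"
    by (rule integral_mono) (use assms integrable_abs_bounded[OF assms] in auto)
  finally show ?thesis by (simp add: prob_space)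
qed

text \<open>Convexity of the variance. Subtracting from every slice its own mean \<open>a y\<close>
  turns the variances on the right into integrals of \<open>(G z y)\<^sup>2\<close>, while averaging
  \<open>G\<close> over \<open>y\<close> gives the centred mean \<open>k z - m\<close>. Jensen in
  \<open>y\<close> compares the squares and Fubini exchanges the order. The uniform bound
  \<open>B\<close> supplies all integrability.\<close>

lemma (in pair_prob_space) variance_integral_le:
  fixes H :: "'a \<Rightarrow> 'b \<Rightarrow> real"
  assumes [measurable]: "case_prod H \<in> borel_measurable (M1 \<Otimes>\<^sub>M M2)"
    and B: "\<And>z y. z \<in> space M1 \<Longrightarrow> y \<in> space M2 \<Longrightarrow> \<bar>H z
        y\<bar> \<le> B"
  shows "(\<integral>z. (\<integral>y. H z y \<partial>M2)\<^sup>2 \<partial>M1) - (\<integral>z.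
      (\<integral>y. H z y \<partial>M2) \<partial>M1)\<^sup>2
    \<le> (\<integral>y. (\<integral>z. (H z y)\<^sup>2 \<partial>M1) - (\<integral>z. H z y
        \<partial>M1)\<^sup>2 \<partial>M2)"
proof -
  define a where "a y = (\<integral>z. H z y \<partial>M1)" for y
  define k where "k z = (\<integral>y. H z y \<partial>M2)" for z
  define m where "m = (\<integral>z. k z \<partial>M1)"
  define G where "G z y = H z y - a y" for z y
  define K where "K = 2 * B"
  have [measurable]: "a \<in> borel_measurable M2" "k \<in> borel_measurable M1"
    unfolding a_def k_def by measurable
  have Gm[measurable]: "case_prod G \<in> borel_measurable (M1 \<Otimes>\<^sub>M M2)" unfolding G_def by measurable
  have Hb1: "(\<lambda>z. H z y) \<in> borel_measurable M1" if "y \<in> space M2" for y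
    using that by measurable
  have Hb2: "(\<lambda>y. H z y) \<in> borel_measurable M2" if "z \<in> space M1" for z
    using that by measurable
  have ab: "\<bar>a y\<bar> \<le> B" if "y \<in> space M2" for y
    unfolding a_def using that by (intro M1.integral_abs_bounded Hb1 B)
  have kb: "\<bar>k z\<bar> \<le> B" if "z \<in> space M1" for z
    unfolding k_def using that by (intro M2.integral_abs_bounded Hb2 B)
  have Gb: "\<bar>G z y\<bar> \<le> K" if "z \<in> space M1" "y \<in> space M2" for z y
    using ab[of y] B[of z y] that by (auto simp: G_def K_def)
  have ia: "integrable M2 a" by (rule M2.integrable_abs_bounded[where B=B]) (use ab in auto)
  have ik: "integrable M1 k" by (rule M1.integrable_abs_bounded[where B=B]) (use kb in auto)
  have ik2: "integrable M1 (\<lambda>z. (k z)\<^sup>2)"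
    by (rule M1.integrable_abs_bounded[where B="B\<^sup>2"]) (use kb power2_le_power2 in auto)
  have ma: "m = (\<integral>y. a y \<partial>M2)" unfolding m_def k_def a_def
    by (rule Fubini_integral[symmetric], rule integrable_abs_bounded[where B=B]) (auto simp: space_pair_measure B)
  have inner: "(\<integral>z. (H z y)\<^sup>2 \<partial>M1) - (a y)\<^sup>2 = (\<integral>z. (G z
      y)\<^sup>2 \<partial>M1)" if y: "y \<in> space M2" for y
  proof -
    have "integrable M1 (\<lambda>z. H z y)"
      by (rule M1.integrable_abs_bounded[where B=B]) (use Hb1 B y in auto)
    moreover have "integrable M1 (\<lambda>z. (H z y)\<^sup>2)"
      by (rule M1.integrable_abs_bounded[where B="B\<^sup>2"]) (use Hb1 B y power2_le_power2 in auto)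
    ultimately show ?thesis
      using M1.variance_eq[of "\<lambda>z. H z y"] by (simp add: G_def a_def)
  qed
  have mean: "(\<integral>y. G z y \<partial>M2) = k z - m" if z: "z \<in> space M1" for z
  proof -
    have "integrable M2 (\<lambda>y. H z y)"
      by (rule M2.integrable_abs_bounded[where B=B]) (use Hb2 B z in auto)
    then show ?thesis using ia by (simp add: G_def k_def ma)
  qed
  have iG2: "integrable (M1 \<Otimes>\<^sub>M M2) (\<lambda>(z,y). (G z y)\<^sup>2)"
    by (rule integrable_abs_bounded[where B="K\<^sup>2"])
       (auto simp: space_pair_measure split_beta intro!: power2_le_power2 Gb)
  have "(\<integral>z. (k z)\<^sup>2 \<partial>M1) - m\<^sup>2 = (\<integral>z. (k z - m)\<^sup>2 \<partial>M1)"
    using M1.variance_eq[OF ik ik2] by (simp add: m_def)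
  also have "\<dots> = (\<integral>z. (\<integral>y. G z y \<partial>M2)\<^sup>2 \<partial>M1)"
    by (rule Bochner_Integration.integral_cong) (auto simp: mean)
  also have "\<dots> \<le> (\<integral>z. (\<integral>y. (G z y)\<^sup>2 \<partial>M2) \<partial>M1)"
  proof (rule integral_mono)
    show "integrable M1 (\<lambda>z. (\<integral>y. G z y \<partial>M2)\<^sup>2)"
      by (rule M1.integrable_abs_bounded[where B="K\<^sup>2"])
         (auto intro!: power2_le_power2 M2.integral_abs_bounded Gb)
    show "integrable M1 (\<lambda>z. (\<integral>y. (G z y)\<^sup>2 \<partial>M2))"
      using integrable_fst'[OF iG2] by simp
    show "(\<integral>y. G z y \<partial>M2)\<^sup>2 \<le> (\<integral>y. (G z y)\<^sup>2 \<partial>M2)" if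
        z: "z \<in> space M1" for z
      by (rule M2.integral_power2_le;
          rule M2.integrable_abs_bounded[where B=K] M2.integrable_abs_bounded[where B="K\<^sup>2"])
         (use z in \<open>auto intro!: power2_le_power2 Gb\<close>)
  qed
  also have "\<dots> = (\<integral>y. (\<integral>z. (G z y)\<^sup>2 \<partial>M1) \<partial>M2)"
    by (rule Fubini_integral[symmetric]) (rule iG2)
  also have "\<dots> = (\<integral>y. (\<integral>z. (H z y)\<^sup>2 \<partial>M1) - (a y)\<^sup>2 \<partial>M2)"
    by (rule Bochner_Integration.integral_cong) (auto simp: inner)
  finally show ?thesis by (simp add: m_def k_def a_def)
qed

text \<open>By induction on the index set: averaging over one coordinate does not increase the mean of the
  variance in another one.\<close>

lemma (in product_prob_space) variance_PiM_le:
  fixes h :: "('i \<Rightarrow> 'a) \<Rightarrow> real" and q :: "'i \<Rightarrow> ('i \<Rightarrow> 'a)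
      \<Rightarrow> real"
  assumes "finite J"
    and "h \<in> borel_measurable (Pi\<^sub>M J M)" "\<And>w. w \<in> space (Pi\<^sub>M J M)
        \<Longrightarrow> \<bar>h w\<bar> \<le> B"
    and "\<And>j. j \<in> J \<Longrightarrow> q j \<in> borel_measurable (Pi\<^sub>M J M)"
    and "\<And>j w. j \<in> J \<Longrightarrow> w \<in> space (Pi\<^sub>M J M) \<Longrightarrow> \<bar>q j
        w\<bar> \<le> C"
    and "\<And>j w. j \<in> J \<Longrightarrow> w \<in> space (Pi\<^sub>M J M) \<Longrightarrow>
      (\<integral>x. (h (w(j := x)))\<^sup>2 \<partial>M j) - (\<integral>x. h (w(j := x)) \<partial>M
          j)\<^sup>2 \<le> (\<integral>x. q j (w(j := x)) \<partial>M j)"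
  shows "(\<integral>w. (h w)\<^sup>2 \<partial>Pi\<^sub>M J M) - (\<integral>w. h w \<partial>Pi\<^sub>M J
      M)\<^sup>2 \<le> (\<Sum>j\<in>J. \<integral>w. q j w \<partial>Pi\<^sub>M J M)"
  using assms
proof (induction J arbitrary: h q rule: finite_induct)
  case empty
  then show ?case by (simp add: PiM_empty lebesgue_integral_count_space_finite)
next
  case (insert i J)
  note [measurable] = insert.prems(1)
  have qm[measurable]: "q j \<in> borel_measurable (Pi\<^sub>M (insert i J) M)" if "j \<in> insert i J" for j
    using insert.prems(3) that .
  interpret PJ: prob_space "Pi\<^sub>M J M" by (rule prob_space_PiM) (rule M.prob_space_axioms)
  interpret PI: prob_space "Pi\<^sub>M (insert i J) M" by (rule prob_space_PiM) (rule M.prob_space_axioms)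
  define E where "E f w = (\<integral>y. f (w(i := y)) \<partial>M i)" for f :: "('i \<Rightarrow> 'a)
      \<Rightarrow> real" and w
  have upd[measurable]: "(\<lambda>(w,y). w(i := y)) \<in> Pi\<^sub>M J M \<Otimes>\<^sub>M M i
      \<rightarrow>\<^sub>M Pi\<^sub>M (insert i J) M"
    by (rule measurable_add_dim)
  have upds: "w(i := y) \<in> space (Pi\<^sub>M (insert i J) M)" if "w \<in> space (Pi\<^sub>M J M)" "y
      \<in> space (M i)" for w y
    using measurable_space[OF upd, of "(w,y)"] that by (simp add: space_pair_measure)
  have Em: "E f \<in> borel_measurable (Pi\<^sub>M J M)" if [measurable]: "f \<in> borel_measurable
      (Pi\<^sub>M (insert i J) M)" for f
    unfolding E_def by measurable
  have fm: "(\<lambda>y. f (w(i := y))) \<in> borel_measurable (M i)"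
    if [measurable]: "f \<in> borel_measurable (Pi\<^sub>M (insert i J) M)" and w: "w \<in> space
        (Pi\<^sub>M J M)" for f :: "_ \<Rightarrow> real" and w
    using measurable_compose[OF measurable_compose[OF measurable_Pair1'[OF w] upd] that(1)] by simp
  have Eb: "\<bar>E f w\<bar> \<le> D" if "f \<in> borel_measurable (Pi\<^sub>M (insert i J) M)"
    "\<And>w. w \<in> space (Pi\<^sub>M (insert i J) M) \<Longrightarrow> \<bar>f w\<bar> \<le> D" "w \<in>
        space (Pi\<^sub>M J M)" for f w D
    unfolding E_def using that upds by (intro M.integral_abs_bounded fm) auto
  have EI: "(\<integral>w. f w \<partial>Pi\<^sub>M (insert i J) M) = (\<integral>w. E f w \<partial>Pi\<^sub>M J M)"
    if "f \<in> borel_measurable (Pi\<^sub>M (insert i J) M)"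
    "\<And>w. w \<in> space (Pi\<^sub>M (insert i J) M) \<Longrightarrow> \<bar>f w\<bar> \<le> D" for f D
    unfolding E_def using insert.hyps
    by (rule product_integral_insert) (rule PI.integrable_abs_bounded[OF that])
  have Eint: "integrable (Pi\<^sub>M J M) (E f)"
    if "f \<in> borel_measurable (Pi\<^sub>M (insert i J) M)"
    "\<And>w. w \<in> space (Pi\<^sub>M (insert i J) M) \<Longrightarrow> \<bar>f w\<bar> \<le> D" for f D
    by (rule PJ.integrable_abs_bounded[where B=D]) (use Em Eb that in auto)
  note hb = insert.prems(2) and qb = insert.prems(4)
  \<comment> \<open>The induction hypothesis is applied to the averages \<open>E h\<close> and
    \<open>E (q j)\<close>. Their one-coordinate inequality is that of \<open>h\<close> averaged
    over coordinate \<open>i\<close>, with convexity of the variance on the left and Fubini on the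
    right.\<close>
  have IH: "(\<integral>w. (E h w)\<^sup>2 \<partial>Pi\<^sub>M J M) - (\<integral>w. E h w
      \<partial>Pi\<^sub>M J M)\<^sup>2 \<le> (\<Sum>j\<in>J. \<integral>w. E (q j) w \<partial>Pi\<^sub>M J M)"
  proof (rule insert.IH)
    fix j w assume j: "j \<in> J" and w: "w \<in> space (Pi\<^sub>M J M)"
    then have ij: "i \<noteq> j" using insert.hyps by auto
    interpret MM: pair_prob_space "M j" "M i" ..
    have updj: "(\<lambda>z. w(j := z)) \<in> M j \<rightarrow>\<^sub>M Pi\<^sub>M J M"
      using measurable_fun_upd[of J J j "\<lambda>_. w" "M j" M "\<lambda>z. z"] w j measurable_const[OF w]
      by auto
    have updji: "(\<lambda>(z, y). w(j := z, i := y)) \<in> M j \<Otimes>\<^sub>M M i \<rightarrow>\<^sub>M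
        Pi\<^sub>M (insert i J) M"
    proof -
      have "(\<lambda>p. (w(j := fst p), snd p)) \<in> M j \<Otimes>\<^sub>M M i \<rightarrow>\<^sub>M
          Pi\<^sub>M J M \<Otimes>\<^sub>M M i"
        using updj by measurable
      from measurable_compose[OF this upd] show ?thesis by (simp add: split_beta)
    qed
    have m2: "(\<lambda>(z, y). f (w(j := z, i := y))) \<in> borel_measurable (M j \<Otimes>\<^sub>M M i)"
      if "f \<in> borel_measurable (Pi\<^sub>M (insert i J) M)" for f :: "_ \<Rightarrow> real"
      using measurable_compose[OF updji that] by (simp add: split_beta)
    have wj: "w(j := z) \<in> space (Pi\<^sub>M J M)" if "z \<in> space (M j)" for z
      using measurable_space[OF updj that] .
    have tw: "w(j := z, i := y) = w(i := y, j := z)" for z y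
      using ij by (simp add: fun_upd_twist)
    have "(\<integral>z. (E h (w(j := z)))\<^sup>2 \<partial>M j) - (\<integral>z. E h (w(j := z))
        \<partial>M j)\<^sup>2
      \<le> (\<integral>y. (\<integral>z. (h (w(j := z, i := y)))\<^sup>2 \<partial>M j) - (\<integral>z. h
          (w(j := z, i := y)) \<partial>M j)\<^sup>2 \<partial>M i)"
      unfolding E_def
      by (rule MM.variance_integral_le[where B=B]) (use m2[of h] in \<open>auto intro!: hb upds wj
          insert.prems\<close>)
    also have "\<dots> \<le> (\<integral>y. (\<integral>z. q j (w(j := z, i := y)) \<partial>M j) \<partial>M i)"
    proof (rule integral_mono)
      have a: "integrable (M i) (\<lambda>y. (\<integral>z. (h (w(j := z, i := y)))\<^sup>2 \<partial>M j))"
        by (rule MM.integrable_snd, rule MM.integrable_abs_bounded[where B="B\<^sup>2"])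
           (use m2[of "\<lambda>w. (h w)\<^sup>2"] in \<open>auto intro!: power2_le_power2 hb upds wj simp:
               space_pair_measure\<close>)
      show "integrable (M i) (\<lambda>y. (\<integral>z. q j (w(j := z, i := y)) \<partial>M j))"
        by (rule MM.integrable_snd, rule MM.integrable_abs_bounded[where B=C])
           (use m2[of "q j"] qm j in \<open>auto intro!: qb upds wj simp: space_pair_measure\<close>)
      have [measurable]: "(\<lambda>(z, y). h (w(j := z, i := y))) \<in> borel_measurable (M j \<Otimes>\<^sub>M M i)"
        by (rule m2) measurable
      have b: "integrable (M i) (\<lambda>y. (\<integral>z. h (w(j := z, i := y)) \<partial>M j)\<^sup>2)"
        by (rule M.integrable_abs_bounded[where B="B\<^sup>2"])
           (auto intro!: power2_le_power2 M.integral_abs_bounded hb upds wj)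
      show "integrable (M i) (\<lambda>y. (\<integral>z. (h (w(j := z, i := y)))\<^sup>2 \<partial>M j) -
          (\<integral>z. h (w(j := z, i := y)) \<partial>M j)\<^sup>2)"
        using a b by simp
      show "(\<integral>z. (h (w(j := z, i := y)))\<^sup>2 \<partial>M j) - (\<integral>z. h (w(j := z, i
          := y)) \<partial>M j)\<^sup>2
         \<le> (\<integral>z. q j (w(j := z, i := y)) \<partial>M j)" if "y \<in> space (M i)" for y
        unfolding tw using j by (intro insert.prems upds w that) auto
    qed
    also have "\<dots> = (\<integral>z. E (q j) (w(j := z)) \<partial>M j)" unfolding E_def
      by (rule MM.Fubini_integral, rule MM.integrable_abs_bounded[where B=C])
         (use m2[of "q j"] qm j in \<open>auto intro!: qb upds wj simp: space_pair_measure\<close>)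
    finally show "(\<integral>z. (E h (w(j := z)))\<^sup>2 \<partial>M j) - (\<integral>z. E h (w(j := z))
        \<partial>M j)\<^sup>2
      \<le> (\<integral>z. E (q j) (w(j := z)) \<partial>M j)" .
  qed (use insert.prems in \<open>auto intro!: Em Eb\<close>)
  have pt: "E (\<lambda>w. (h w)\<^sup>2) w \<le> (E h w)\<^sup>2 + E (q i) w" if w: "w \<in> space
      (Pi\<^sub>M J M)" for w
  proof -
    \<comment> \<open>A point of \<open>Pi\<^sub>M J M\<close> is \<open>undefined\<close> at
      \<open>i\<close>, so the hypothesis on the larger product does not apply to \<open>w\<close>
      itself. An arbitrary \<open>y\<close> is inserted and at once overwritten.\<close>
    obtain y where y: "y \<in> space (M i)" using M.not_empty by blast
    have "(\<integral>x. (h (w(i := y, i := x)))\<^sup>2 \<partial>M i) - (\<integral>x. h (w(i := y, i :=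
        x)) \<partial>M i)\<^sup>2
       \<le> (\<integral>x. q i (w(i := y, i := x)) \<partial>M i)"
      by (intro insert.prems upds w y) auto
    then show ?thesis by (simp add: E_def)
  qed
  have iE2: "integrable (Pi\<^sub>M J M) (\<lambda>w. (E h w)\<^sup>2)"
    by (rule PJ.integrable_abs_bounded[where B="B\<^sup>2"]) (use Em insert.prems in \<open>auto intro!:
        power2_le_power2 Eb\<close>)
  have iEq: "integrable (Pi\<^sub>M J M) (E (q i))"
    by (rule Eint[OF qm qb]) auto
  have iEh2: "integrable (Pi\<^sub>M J M) (E (\<lambda>w. (h w)\<^sup>2))"
    by (rule Eint[OF _ power2_le_power2(2)[OF hb]]) auto
  have "(\<integral>w. (h w)\<^sup>2 \<partial>Pi\<^sub>M (insert i J) M) = (\<integral>w. E (\<lambda>w.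
      (h w)\<^sup>2) w \<partial>Pi\<^sub>M J M)"
    by (rule EI[OF _ power2_le_power2(2)[OF hb]]) auto
  also have "\<dots> \<le> (\<integral>w. (E h w)\<^sup>2 + E (q i) w \<partial>Pi\<^sub>M J M)"
    by (rule integral_mono) (use pt iE2 iEq iEh2 in auto)
  also have "\<dots> = (\<integral>w. (E h w)\<^sup>2 \<partial>Pi\<^sub>M J M) + (\<integral>w. E (q i) w
      \<partial>Pi\<^sub>M J M)"
    using iE2 iEq by simp
  also have "(\<integral>w. E (q i) w \<partial>Pi\<^sub>M J M) = (\<integral>w. q i w \<partial>Pi\<^sub>M
      (insert i J) M)"
    by (rule EI[OF qm qb, symmetric]) auto
  finally have 1: "(\<integral>w. (h w)\<^sup>2 \<partial>Pi\<^sub>M (insert i J) M) \<le>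
      (\<integral>w. (E h w)\<^sup>2 \<partial>Pi\<^sub>M J M) + (\<integral>w. q i w \<partial>Pi\<^sub>M
          (insert i J) M)" .
  have 2: "(\<integral>w. h w \<partial>Pi\<^sub>M (insert i J) M) = (\<integral>w. E h w \<partial>Pi\<^sub>M J M)"
    by (rule EI[OF _ hb]) auto
  have 3: "(\<integral>w. q j w \<partial>Pi\<^sub>M (insert i J) M) = (\<integral>w. E (q j) w
      \<partial>Pi\<^sub>M J M)" if "j \<in> J" for j
    by (rule EI[OF qm qb]) (use that in auto)
  have 4: "(\<Sum>j\<in>insert i J. \<integral>w. q j w \<partial>Pi\<^sub>M (insert i J) M) =
    (\<integral>w. q i w \<partial>Pi\<^sub>M (insert i J) M) + (\<Sum>j\<in>J. \<integral>w. E (q j) w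
        \<partial>Pi\<^sub>M J M)"
    using insert.hyps 3 by simp
  show ?case unfolding 2 4 using 1 IH by linarith
qed

section \<open>The Poincare inequality for the Gaussian on the line\<close>

abbreviation gauss :: "real measure" where "gauss \<equiv> density lborel (\<lambda>x. ennreal
    (std_normal_density x))"

lemma gauss_integral:
  fixes f :: "real \<Rightarrow> real"
  assumes [measurable]: "f \<in> borel_measurable borel"
  shows "(\<integral>x. f x \<partial>gauss) = (\<integral>x. std_normal_density x * f x \<partial>lborel)"
  by (subst integral_density) auto

lemma prob_space_gauss: "prob_space gauss"
  using prob_space_normal_density[of 1 0] by simp

lemma integrable_gauss:
  fixes f :: "real \<Rightarrow> real"
  assumes [measurable]: "f \<in> borel_measurable borel" and "\<And>x. \<bar>f x\<bar> \<le> B"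
  shows "integrable gauss f"
proof -
  interpret prob_space gauss by (rule prob_space_gauss)
  show ?thesis by (rule integrable_const_bound[of _ B]) (use assms in auto)
qed

lemma std_normal_density_deriv:
  "(std_normal_density has_real_derivative - x * std_normal_density x) (at x)"
  unfolding std_normal_density_def
  by (auto intro!: derivative_eq_intros simp: field_simps)

text \<open>The integrand minus the derivative of \<open>Q = g\<^sup>2 \<phi> / x\<close> is \<open>(g' - g / x)\<^sup>2 \<phi>\<close>, where \<open>\<phi>\<close> is the
  density, and the boundary terms \<open>Q R\<close> and \<open>- Q (- R)\<close> are nonnegative. Since \<open>Q\<close> tends to \<open>0\<close> at the
  origin, the value \<open>Q 0 = 0\<close> given by division by zero makes \<open>Q\<close> continuous.\<close>

lemma hardy_gauss_interval:
  fixes g :: "real \<Rightarrow> real"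
  assumes g: "\<And>x. (g has_real_derivative g' x) (at x)" and g0: "g 0 = 0"
    and cont: "continuous_on UNIV g'" and R: "0 \<le> R"
  shows "0 \<le> integral {-R..R} (\<lambda>x. std_normal_density x * ((g' x)\<^sup>2 - (g x)\<^sup>2))"
proof -
  define Q where "Q x = std_normal_density x * (g x)\<^sup>2 / x" for x
  \<comment> \<open>Off the origin \<open>q\<close> is the derivative of \<open>Q\<close>. The value
    at the single point 0 does not affect the integral; 0 is chosen because the pointwise bound
    below must hold there as well.\<close>
  define q where "q x = (if x = 0 then 0 else
      std_normal_density x * (2 * g x * g' x / x - (g x)\<^sup>2 / x\<^sup>2 - (g x)\<^sup>2))" for x
  have contg: "continuous_on UNIV g"
    using g by (meson DERIV_isCont continuous_at_imp_continuous_on)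
  have Q': "(Q has_real_derivative q x) (at x)" if "x \<noteq> 0" for x
    unfolding Q_def using that
    by (auto intro!: derivative_eq_intros std_normal_density_deriv g
        simp: q_def field_simps power2_eq_square)
  have lim0: "((\<lambda>x. g x / x) \<longlongrightarrow> g' 0) (at 0)"
    using g[of 0] by (simp add: DERIV_def g0)
  have "((\<lambda>x. std_normal_density x * (g x / x) * g x) \<longlongrightarrow> std_normal_density 0 *
      g' 0 * g 0) (at 0)"
    by (intro tendsto_mult lim0)
       (use std_normal_density_deriv g in \<open>auto intro!: isContD DERIV_isCont\<close>)
  moreover have "Q = (\<lambda>x. std_normal_density x * (g x / x) * g x)"
    by (simp add: Q_def power2_eq_square fun_eq_iff)
  ultimately have "isCont Q 0"
    by (simp add: isCont_def g0)
  then have contQ: "continuous_on {-R..R} Q"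
    by (metis Q' DERIV_isCont continuous_at_imp_continuous_on)
  have "(q has_integral (Q R - Q (-R))) {-R..R}"
    by (rule fundamental_theorem_of_calculus_interior_strong[where S="{0}"])
       (use R contQ Q' in \<open>auto simp: has_real_derivative_iff_has_vector_derivative\<close>)
  moreover have "((\<lambda>x. std_normal_density x * ((g' x)\<^sup>2 - (g x)\<^sup>2)) has_integral
      integral {-R..R} (\<lambda>x. std_normal_density x * ((g' x)\<^sup>2 - (g x)\<^sup>2))) {-R..R}"
    by (intro integrable_integral integrable_continuous_real continuous_intros
          continuous_on_subset[OF cont] continuous_on_subset[OF contg])
       (auto simp: std_normal_density_def intro!: continuous_intros)
  moreover have "q x \<le> std_normal_density x * ((g' x)\<^sup>2 - (g x)\<^sup>2)" for x
  proof (cases "x = 0")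
    case False
    have "0 \<le> (g' x - g x / x)\<^sup>2" by simp
    also have "\<dots> = (g' x)\<^sup>2 - (2 * g x * g' x / x - (g x)\<^sup>2 / x\<^sup>2)"
      using False by (simp add: power2_eq_square field_simps)
    finally show ?thesis using False
      by (auto simp: q_def intro!: mult_left_mono)
  qed (simp add: q_def g0)
  ultimately have "Q R - Q (-R) \<le> integral {-R..R} (\<lambda>x. std_normal_density x * ((g' x)\<^sup>2
      - (g x)\<^sup>2))"
    by (rule has_integral_le)
  moreover have "Q R \<ge> 0" "Q (-R) \<le> 0" using R by (auto simp: Q_def divide_nonneg_nonneg divide_nonneg_nonpos)
  ultimately show ?thesis by linarith
qed

text \<open>The second moment about any point is at least the variance. Centring at
  \<open>h 0\<close> instead of at the mean gives a function vanishing at the origin, as the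
  estimate on intervals requires, and errs in the harmless direction. Dominated convergence then
  lets the intervals exhaust the line.\<close>

lemma gauss_variance_le:
  fixes h :: "real \<Rightarrow> real"
  assumes h: "\<And>x. (h has_real_derivative h' x) (at x)"
    and cont: "continuous_on UNIV h'" and B: "\<And>x. \<bar>h x\<bar> \<le> B" and B': "\<And>x. \<bar>h'
        x\<bar> \<le> B'"
  shows "(\<integral>x. (h x)\<^sup>2 \<partial>gauss) - (\<integral>x. h x \<partial>gauss)\<^sup>2 \<le>
      (\<integral>x. (h' x)\<^sup>2 \<partial>gauss)"
proof -
  interpret prob_space gauss by (rule prob_space_gauss)
  have conth: "continuous_on UNIV h"
    using h by (meson DERIV_isCont continuous_at_imp_continuous_on)
  note [measurable] = borel_measurable_continuous_onI[OF conth] borel_measurable_continuous_onI[OF cont]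
  define g where "g x = h x - h 0" for x
  have [measurable]: "g \<in> borel_measurable borel" unfolding g_def by measurable
  have gb: "\<bar>g x\<bar> \<le> 2 * B" for x using B[of x] B[of 0] by (auto simp: g_def)
  have I1: "integrable gauss (\<lambda>x. (g x)\<^sup>2)" by (rule integrable_gauss[OF _
      power2_le_power2(2)[OF gb]]) measurable
  have I2: "integrable gauss (\<lambda>x. (h' x)\<^sup>2)" by (rule integrable_gauss[OF _
      power2_le_power2(2)[OF B']]) measurable
  have I3: "integrable gauss (\<lambda>x. (h x)\<^sup>2)" by (rule integrable_gauss[OF _
      power2_le_power2(2)[OF B]]) measurable
  have I4: "integrable gauss h" by (rule integrable_gauss) (auto intro!: B)
  have "(\<integral>x. (g x)\<^sup>2 \<partial>gauss) = (\<integral>x. (h x)\<^sup>2 - 2 * h 0 * h x + (h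
      0)\<^sup>2 \<partial>gauss)"
    by (simp add: g_def power2_eq_square algebra_simps)
  also have "\<dots> = (\<integral>x. (h x)\<^sup>2 \<partial>gauss) - 2 * h 0 * (\<integral>x. h x
      \<partial>gauss) + (h 0)\<^sup>2"
    using I3 I4 prob_space by simp
  also have "\<dots> \<ge> (\<integral>x. (h x)\<^sup>2 \<partial>gauss) - (\<integral>x. h x
      \<partial>gauss)\<^sup>2"
  proof -
    have "0 \<le> ((\<integral>x. h x \<partial>gauss) - h 0)\<^sup>2" by simp
    then show ?thesis by (simp add: power2_eq_square algebra_simps)
  qed
  finally have 1: "(\<integral>x. (h x)\<^sup>2 \<partial>gauss) - (\<integral>x. h x
      \<partial>gauss)\<^sup>2 \<le> (\<integral>x. (g x)\<^sup>2 \<partial>gauss)" .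
  define F where "F x = std_normal_density x * ((h' x)\<^sup>2 - (g x)\<^sup>2)" for x
  have [measurable]: "F \<in> borel_measurable borel" unfolding F_def by measurable
  have "integrable gauss (\<lambda>x. (h' x)\<^sup>2 - (g x)\<^sup>2)" using I1 I2 by simp
  then have FI: "integrable lborel F"
    by (subst (asm) integrable_density) (auto simp: F_def[abs_def])
  have "(\<lambda>n. \<integral>x. F x * indicator {-real n..real n} x \<partial>lborel)
      \<longlonglongrightarrow> (\<integral>x. F x \<partial>lborel)"
  proof (rule integral_dominated_convergence[where w="\<lambda>x. \<bar>F x\<bar>"])
    show "AE x in lborel. (\<lambda>n. F x * indicator {-real n..real n} x) \<longlonglongrightarrow> F x"
    proof (rule AE_I2, rule tendsto_eventually)
      fix x
      obtain N where "\<bar>x\<bar> \<le> real N" using real_arch_simple by blast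
      then have "F x * indicator {-real n..real n} x = F x" if "n \<ge> N" for n
        using that by (auto simp: indicator_def)
      then show "\<forall>\<^sub>F n in sequentially. F x * indicator {-real n..real n} x = F x"
        unfolding eventually_sequentially by blast
    qed
  qed (use FI in \<open>auto simp: indicator_def\<close>)
  then have "0 \<le> (\<integral>x. F x \<partial>lborel)"
  proof (rule LIMSEQ_le_const, intro exI allI impI)
    fix n
    show "0 \<le> (\<integral>x. F x * indicator {-real n..real n} x \<partial>lborel)"
    proof -
      have "(\<integral>x. F x * indicator {-real n..real n} x \<partial>lborel) = integral {-real n..real n} F"
        using set_borel_integral_eq_integral(2)[of "{-real n..real n}" F]
          integrable_mult_indicator[OF _ FI, of "{-real n..real n}"]
        by (simp add: set_lebesgue_integral_def set_integrable_def mult.commute)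
      also have "\<dots> \<ge> 0" unfolding F_def
        by (rule hardy_gauss_interval) (use h cont in \<open>auto simp: g_def intro!: derivative_eq_intros\<close>)
      finally show ?thesis .
    qed
  qed
  also have "(\<integral>x. F x \<partial>lborel) = (\<integral>x. (h' x)\<^sup>2 - (g x)\<^sup>2 \<partial>gauss)"
    unfolding F_def by (rule gauss_integral[symmetric]) measurable
  also have "\<dots> = (\<integral>x. (h' x)\<^sup>2 \<partial>gauss) - (\<integral>x. (g x)\<^sup>2 \<partial>gauss)"
    using I1 I2 by simp
  finally show ?thesis using 1 by linarith
qed

section \<open>The Gaussian measure on a Euclidean space\<close>

text \<open>A product measure is determined by its values on boxes. There the density and the
  indicator of the box both factor over the coordinates, so the integral splits into one-dimensional
  ones.\<close>

lemma PiM_density: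
  fixes f :: "'i \<Rightarrow> 'a \<Rightarrow> ennreal"
  assumes I: "finite I" and M: "\<And>i. sigma_finite_measure (M i)"
    and D: "\<And>i. sigma_finite_measure (density (M i) (f i))"
    and f[measurable]: "\<And>i. f i \<in> borel_measurable (M i)"
  shows "density (Pi\<^sub>M I M) (\<lambda>w. \<Prod>i\<in>I. f i (w i)) = Pi\<^sub>M I (\<lambda>i.
      density (M i) (f i))"
proof -
  interpret M: product_sigma_finite M using M by (simp add: product_sigma_finite_def)
  interpret D: product_sigma_finite "\<lambda>i. density (M i) (f i)"
    using D by (simp add: product_sigma_finite_def)
  have fm[measurable]: "(\<lambda>w. \<Prod>i\<in>I. f i (w i)) \<in> borel_measurable (Pi\<^sub>M I M)" by measurable
  show ?thesis
  proof (rule D.PiM_eqI[OF I])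
    show "sets (density (Pi\<^sub>M I M) (\<lambda>w. \<Prod>i\<in>I. f i (w i))) = sets (Pi\<^sub>M I
        (\<lambda>i. density (M i) (f i)))"
      by (auto intro!: sets_PiM_cong)
    fix A assume A: "\<And>i. i \<in> I \<Longrightarrow> A i \<in> sets (density (M i) (f i))"
    then have A'[measurable]: "i \<in> I \<Longrightarrow> A i \<in> sets (M i)" for i by simp
    have "emeasure (density (Pi\<^sub>M I M) (\<lambda>w. \<Prod>i\<in>I. f i (w i))) (Pi\<^sub>E I A) =
       (\<integral>\<^sup>+w. (\<Prod>i\<in>I. f i (w i)) * indicator (Pi\<^sub>E I A) w \<partial>Pi\<^sub>M I M)"
      by (rule emeasure_density) (use I A' in \<open>auto intro!: sets_PiM_I_finite\<close>)
    also have "\<dots> = (\<integral>\<^sup>+w. (\<Prod>i\<in>I. f i (w i) * indicator (A i) (w i))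
        \<partial>Pi\<^sub>M I M)"
    proof (rule nn_integral_cong)
      fix w assume "w \<in> space (Pi\<^sub>M I M)"
      then have w: "w \<in> extensional I" by (auto simp: space_PiM PiE_def)
      have "indicator (Pi\<^sub>E I A) w = (\<Prod>i\<in>I. indicator (A i) (w i) :: ennreal)"
        using I w by (auto simp: indicator_def PiE_iff prod_zero_iff split: if_splits)
      then show "(\<Prod>i\<in>I. f i (w i)) * indicator (Pi\<^sub>E I A) w = (\<Prod>i\<in>I. f i (w i) *
          indicator (A i) (w i))"
        by (simp add: prod.distrib)
    qed
    also have "\<dots> = (\<Prod>i\<in>I. \<integral>\<^sup>+x. f i x * indicator (A i) x \<partial>M i)"
      by (rule M.product_nn_integral_prod[OF I]) measurable
    also have "\<dots> = (\<Prod>i\<in>I. emeasure (density (M i) (f i)) (A i))"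
      by (intro prod.cong refl emeasure_density[symmetric]) auto
    finally show "emeasure (density (Pi\<^sub>M I M) (\<lambda>w. \<Prod>i\<in>I. f i (w i))) (Pi\<^sub>E I A) =
       (\<Prod>i\<in>I. emeasure (density (M i) (f i)) (A i))" .
  qed
qed

text \<open>The standard Gaussian density, kept as a product so that it fits
  \<open>PiM_density\<close>; \<open>gauss_density_eq\<close> recovers the radial form, which is the
  weight e^{-f} up to a normalising constant.\<close>

definition gauss_density :: "'a::euclidean_space \<Rightarrow> real" where
  "gauss_density u = (\<Prod>b\<in>Basis. std_normal_density (u \<bullet> b))"

lemma gauss_density_eq:
  "gauss_density (u::'a::euclidean_space) = (1 / sqrt (2 * pi)) ^ DIM('a) * exp (- (norm u)\<^sup>2 / 2)"
proof -
  have "(norm u)\<^sup>2 = (\<Sum>b\<in>Basis. (u \<bullet> b)\<^sup>2)"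
    unfolding power2_norm_eq_inner euclidean_inner[of u u] by (simp add: power2_eq_square)
  then show ?thesis
    by (simp add: gauss_density_def std_normal_density_def prod.distrib prod_dividef
        sum_negf sum_divide_distrib power_divide flip: exp_sum)
qed

lemma gauss_density_nonneg[simp]: "0 \<le> gauss_density u"
  by (simp add: gauss_density_def prod_nonneg)

lemma gauss_density_measurable[measurable]: "gauss_density \<in> borel_measurable borel"
  unfolding gauss_density_def by measurable

abbreviation gaussn :: "'a::euclidean_space measure" where
  "gaussn \<equiv> density lborel (\<lambda>u. ennreal (gauss_density u))"

text \<open>\<open>lborel\<close> is itself the image of a product of one-dimensional Lebesgue
  measures under the coordinate map, so the density can be pulled back through that map and
  distributed over the factors.\<close>

lemma gaussn_eq:
  "(gaussn :: 'a::euclidean_space measure) = distr (\<Pi>\<^sub>M b\<in>Basis. gauss) borel (\<lambda>f.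
      \<Sum>b\<in>Basis. f b *\<^sub>R b)"
proof -
  interpret G: prob_space gauss by (rule prob_space_gauss)
  have T[measurable]: "(\<lambda>f. \<Sum>b\<in>Basis. f b *\<^sub>R b) \<in> (\<Pi>\<^sub>M b\<in>Basis.
      lborel) \<rightarrow>\<^sub>M (borel :: 'a measure)"
    by measurable
  have "(gaussn :: 'a measure) = density (distr (\<Pi>\<^sub>M b\<in>Basis. lborel) borel (\<lambda>f.
      \<Sum>b\<in>Basis. f b *\<^sub>R b))
      (\<lambda>u. ennreal (gauss_density u))"
    by (simp add: lborel_eq[symmetric])
  also have "\<dots> = distr (density (\<Pi>\<^sub>M b\<in>Basis. lborel) (\<lambda>w. ennreal
      (gauss_density (\<Sum>b\<in>Basis. w b *\<^sub>R b :: 'a)))) borel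
     (\<lambda>f. \<Sum>b\<in>Basis. f b *\<^sub>R b)"
    by (rule density_distr) measurable
  also have "(\<lambda>w. ennreal (gauss_density (\<Sum>b\<in>Basis. w b *\<^sub>R b :: 'a))) =
      (\<lambda>w. \<Prod>b\<in>Basis. ennreal (std_normal_density (w b)))"
    by (simp add: gauss_density_def inner_sum_left inner_Basis if_distrib cong: if_cong)
       (simp add: prod_ennreal)
  also have "density (\<Pi>\<^sub>M b\<in>(Basis::'a set). lborel) (\<lambda>w. \<Prod>b\<in>Basis. ennreal
      (std_normal_density (w b)))
     = (\<Pi>\<^sub>M b\<in>Basis. gauss)"
    by (rule PiM_density) (auto intro: G.sigma_finite_measure_axioms lborel.sigma_finite_measure_axioms)
  finally show ?thesis .
qed

lemma prob_space_gaussn: "prob_space (gaussn :: 'a::euclidean_space measure)"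
  unfolding gaussn_eq
proof (rule prob_space.prob_space_distr)
  show "prob_space (\<Pi>\<^sub>M b\<in>(Basis::'a set). gauss)"
    by (rule prob_space_PiM) (rule prob_space_gauss)
  show "(\<lambda>f. \<Sum>b\<in>Basis. f b *\<^sub>R b) \<in> (\<Pi>\<^sub>M b\<in>Basis. gauss)
      \<rightarrow>\<^sub>M (borel :: 'a measure)"
    by (intro borel_measurable_sum borel_measurable_scaleR measurable_const measurable_compose[OF
        measurable_component_singleton])
       auto
qed

text \<open>\<open>variance_PiM_le\<close>, with the square of \<open>D b\<close> in the role of
  \<open>q b\<close>, reduces the claim to lines parallel to the axes. There the one-dimensional
  inequality applies, so its constant 1 persists in every dimension.\<close>

lemma gaussian_poincare:
  fixes h :: "'a::euclidean_space \<Rightarrow> real" and D :: "'a \<Rightarrow> 'a \<Rightarrow> real"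
  assumes h: "\<And>b u. b \<in> Basis \<Longrightarrow> ((\<lambda>s. h (u + s *\<^sub>R b))
      has_real_derivative D b u) (at 0)"
    and conth: "continuous_on UNIV h" and contD: "\<And>b. b \<in> Basis \<Longrightarrow> continuous_on UNIV (D b)"
    and B: "\<And>u. \<bar>h u\<bar> \<le> B" and C: "\<And>b u. b \<in> Basis \<Longrightarrow> \<bar>D b
        u\<bar> \<le> C"
  shows "(\<integral>u. (h u)\<^sup>2 \<partial>gaussn) - (\<integral>u. h u \<partial>gaussn)\<^sup>2
      \<le> (\<Sum>b\<in>Basis. \<integral>u. (D b u)\<^sup>2 \<partial>gaussn)"
proof -
  interpret G: prob_space gauss by (rule prob_space_gauss)
  interpret P: product_prob_space "\<lambda>b::'a. gauss" Basis ..
  define T :: "('a \<Rightarrow> real) \<Rightarrow> 'a" where "T f = (\<Sum>b\<in>Basis. f b *\<^sub>R b)" for f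
  have T[measurable]: "T \<in> (\<Pi>\<^sub>M b\<in>Basis. gauss) \<rightarrow>\<^sub>M borel" unfolding T_def
    by (intro borel_measurable_sum borel_measurable_scaleR measurable_const measurable_compose[OF
        measurable_component_singleton])
       auto
  have [measurable]: "h \<in> borel_measurable borel" by (rule borel_measurable_continuous_onI[OF conth])
  have Dm[measurable]: "D b \<in> borel_measurable borel" if "b \<in> Basis" for b
    by (rule borel_measurable_continuous_onI[OF contD[OF that]])
  have tr: "(\<integral>u. f u \<partial>gaussn) = (\<integral>w. f (T w) \<partial>(\<Pi>\<^sub>M
      b\<in>Basis. gauss))"
    if [measurable]: "f \<in> borel_measurable borel" for f :: "'a \<Rightarrow> real"
    unfolding gaussn_eq T_def[symmetric] by (rule integral_distr) measurable
  have "(\<integral>w. (h (T w))\<^sup>2 \<partial>(\<Pi>\<^sub>M b\<in>Basis. gauss)) - (\<integral>w. h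
      (T w) \<partial>(\<Pi>\<^sub>M b\<in>Basis. gauss))\<^sup>2
     \<le> (\<Sum>b\<in>Basis. \<integral>w. (D b (T w))\<^sup>2 \<partial>(\<Pi>\<^sub>M b\<in>Basis. gauss))"
  proof (rule P.variance_PiM_le[where B=B and C="C\<^sup>2"])
    fix b :: 'a and w assume b: "b \<in> Basis"
    define v where "v = T (w(b := 0))"
    have Tupd: "T (w(b := x)) = v + x *\<^sub>R b" for x
    proof -
      have "T (w(b := x)) = (\<Sum>c\<in>Basis. (w(b := 0)) c *\<^sub>R c + (if c = b then x *\<^sub>R c else 0))"
        unfolding T_def by (rule sum.cong) auto
      then show ?thesis using b by (simp add: T_def v_def sum.distrib)
    qed
    \<comment> \<open>The hypothesis differentiates at parameter 0 only, but at every base point;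
      shifting the base point along the line yields the derivative at every
      \<open>x\<close>.\<close>
    have "((\<lambda>s. h (v + s *\<^sub>R b)) has_real_derivative D b (v + x *\<^sub>R b)) (at x)" for x
    proof -
      have "((\<lambda>s. h (v + x *\<^sub>R b + s *\<^sub>R b)) has_real_derivative D b (v + x *\<^sub>R
          b)) (at (x - x))"
        using h[OF b, of "v + x *\<^sub>R b"] by simp
      then have "((\<lambda>s. h (v + x *\<^sub>R b + (s - x) *\<^sub>R b)) has_real_derivative D b (v + x
          *\<^sub>R b) * 1) (at x)"
        by (rule DERIV_chain2) (auto intro!: derivative_eq_intros)
      then show ?thesis by (simp add: algebra_simps)
    qed
    moreover have "continuous_on UNIV (\<lambda>x. D b (v + x *\<^sub>R b))"
      by (intro continuous_on_compose2[OF contD[OF b]] continuous_intros) auto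
    ultimately show "(\<integral>x. (h (T (w(b := x))))\<^sup>2 \<partial>gauss) - (\<integral>x. h (T (w(b
        := x))) \<partial>gauss)\<^sup>2
       \<le> (\<integral>x. (D b (T (w(b := x))))\<^sup>2 \<partial>gauss)"
      unfolding Tupd by (rule gauss_variance_le) (use B C b in auto)
  qed (auto intro!: B C power2_le_power2)
  moreover have "(\<Sum>b\<in>Basis. \<integral>u. (D b u)\<^sup>2 \<partial>gaussn) = (\<Sum>b\<in>Basis.
      \<integral>w. (D b (T w))\<^sup>2 \<partial>(\<Pi>\<^sub>M b\<in>(Basis::'a set). gauss))"
    by (intro sum.cong refl tr) measurable
  moreover have "(\<integral>u. (h u)\<^sup>2 \<partial>gaussn) = (\<integral>w. (h (T w))\<^sup>2
      \<partial>(\<Pi>\<^sub>M b\<in>(Basis::'a set). gauss))"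
    by (rule tr) measurable
  moreover have "(\<integral>u. h u \<partial>gaussn) = (\<integral>w. h (T w) \<partial>(\<Pi>\<^sub>M
      b\<in>(Basis::'a set). gauss))"
    by (rule tr) measurable
  ultimately show ?thesis by simp
qed

section \<open>Functions that are twice differentiable in time\<close>

text \<open>The derivatives are arguments because their values at time 0 must be followed through
  products, determinants and roots. Differentiability is in time only, while continuity is joint:
  this is the form that differentiation under the integral sign consumes.\<close>

definition C2_jet :: "('a::topological_space \<times> real) set \<Rightarrow> ('a \<times> real
    \<Rightarrow> 'b::real_normed_vector) \<Rightarrow>
    ('a \<times> real \<Rightarrow> 'b) \<Rightarrow> ('a \<times> real \<Rightarrow> 'b) \<Rightarrow> bool" where
  "C2_jet S f f1 f2 \<longleftrightarrow> continuous_on S f \<and> continuous_on S f1 \<and> continuous_on S f2 \<and>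
     (\<forall>u t. (u, t) \<in> S \<longrightarrow> ((\<lambda>s. f (u, s)) has_vector_derivative f1 (u,
         t)) (at t) \<and>
        ((\<lambda>s. f1 (u, s)) has_vector_derivative f2 (u, t)) (at t))"

lemma C2_jet_const: "C2_jet S (\<lambda>z. c) (\<lambda>z. 0) (\<lambda>z. 0)"
  by (simp add: C2_jet_def)

lemma C2_jet_diff_const:
  assumes "C2_jet S f f1 f2"
  shows "C2_jet S (\<lambda>z. f z - c) f1 f2"
  using assms by (auto simp: C2_jet_def intro!: continuous_intros derivative_eq_intros)

lemma C2_jet_sum:
  assumes "\<And>i. i \<in> I \<Longrightarrow> C2_jet S (f i) (f1 i) (f2 i)"
  shows "C2_jet S (\<lambda>z. \<Sum>i\<in>I. f i z) (\<lambda>z. \<Sum>i\<in>I. f1 i z) (\<lambda>z.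
      \<Sum>i\<in>I. f2 i z)"
  using assms by (auto simp: C2_jet_def intro!: continuous_intros has_vector_derivative_sum)

lemma C2_jet_inner:
  assumes "C2_jet S f f1 f2" "C2_jet S g g1 g2"
  shows "C2_jet S (\<lambda>z. f z \<bullet> g z) (\<lambda>z. f z \<bullet> g1 z + f1 z \<bullet> g z)
    (\<lambda>z. f z \<bullet> g2 z + 2 * (f1 z \<bullet> g1 z) + f2 z \<bullet> g z)"
  unfolding C2_jet_def
proof (intro conjI allI impI)
  fix u t assume z: "(u, t) \<in> S"
  note d = bounded_bilinear.has_vector_derivative[OF bounded_bilinear_inner]
  have 1: "((\<lambda>s. f (u, s)) has_vector_derivative f1 (u, t)) (at t)"
    "((\<lambda>s. f1 (u, s)) has_vector_derivative f2 (u, t)) (at t)"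
    "((\<lambda>s. g (u, s)) has_vector_derivative g1 (u, t)) (at t)"
    "((\<lambda>s. g1 (u, s)) has_vector_derivative g2 (u, t)) (at t)"
    using assms z by (auto simp: C2_jet_def)
  show "((\<lambda>s. f (u, s) \<bullet> g (u, s)) has_vector_derivative
      f (u, t) \<bullet> g1 (u, t) + f1 (u, t) \<bullet> g (u, t)) (at t)"
    by (rule d[OF 1(1,3)])
  show "((\<lambda>s. f (u, s) \<bullet> g1 (u, s) + f1 (u, s) \<bullet> g (u, s)) has_vector_derivative
      f (u, t) \<bullet> g2 (u, t) + 2 * (f1 (u, t) \<bullet> g1 (u, t)) + f2 (u, t) \<bullet> g (u, t)) (at t)"
    using has_vector_derivative_add[OF d[OF 1(1,4)] d[OF 1(2,3)]] by (simp add: algebra_simps)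
qed (use assms in \<open>auto simp: C2_jet_def intro!: continuous_intros\<close>)

lemma C2_jet_mult:
  fixes f g :: "'a::topological_space \<times> real \<Rightarrow> real"
  assumes "C2_jet S f f1 f2" "C2_jet S g g1 g2"
  shows "C2_jet S (\<lambda>z. f z * g z) (\<lambda>z. f z * g1 z + f1 z * g z)
    (\<lambda>z. f z * g2 z + 2 * (f1 z * g1 z) + f2 z * g z)"
  using C2_jet_inner[OF assms] by simp

lemma C2_jet_compose:
  fixes f :: "'a::topological_space \<times> real \<Rightarrow> real"
  assumes f: "C2_jet S f f1 f2" and T: "f ` S \<subseteq> T"
    and p: "\<And>x. x \<in> T \<Longrightarrow> (p has_real_derivative p1 x) (at x)"
    "\<And>x. x \<in> T \<Longrightarrow> (p1 has_real_derivative p2 x) (at x)"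
    and cont: "continuous_on T p2"
  shows "C2_jet S (\<lambda>z. p (f z)) (\<lambda>z. p1 (f z) * f1 z) (\<lambda>z. p2 (f z) * (f1
      z)\<^sup>2 + p1 (f z) * f2 z)"
  unfolding C2_jet_def
proof (intro conjI allI impI)
  have c: "continuous_on T p" "continuous_on T p1"
    using p by (meson DERIV_isCont continuous_at_imp_continuous_on)+
  have cf: "continuous_on S f" "continuous_on S f1" "continuous_on S f2" using f by (auto simp: C2_jet_def)
  show "continuous_on S (\<lambda>z. p (f z))" "continuous_on S (\<lambda>z. p1 (f z) * f1 z)"
    "continuous_on S (\<lambda>z. p2 (f z) * (f1 z)\<^sup>2 + p1 (f z) * f2 z)"
    by (intro continuous_intros cf continuous_on_compose2[OF c(1) cf(1) T]
        continuous_on_compose2[OF c(2) cf(1) T] continuous_on_compose2[OF cont cf(1) T])+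
  fix u t assume z: "(u, t) \<in> S"
  then have fT: "f (u, t) \<in> T" using T by auto
  have 1: "((\<lambda>s. f (u, s)) has_real_derivative f1 (u, t)) (at t)"
    "((\<lambda>s. f1 (u, s)) has_real_derivative f2 (u, t)) (at t)"
    using f z by (auto simp: C2_jet_def has_real_derivative_iff_has_vector_derivative)
  show "((\<lambda>s. p (f (u, s))) has_vector_derivative p1 (f (u, t)) * f1 (u, t)) (at t)"
    unfolding has_real_derivative_iff_has_vector_derivative[symmetric]
    by (rule DERIV_chain2[OF p(1)[OF fT] 1(1)])
  have "((\<lambda>s. p1 (f (u, s)) * f1 (u, s)) has_real_derivative
     p2 (f (u, t)) * f1 (u, t) * f1 (u, t) + f2 (u, t) * p1 (f (u, t))) (at t)"
    by (rule DERIV_mult[OF DERIV_chain2[OF p(2)[OF fT] 1(1)] 1(2)])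
  then show "((\<lambda>s. p1 (f (u, s)) * f1 (u, s)) has_vector_derivative
     p2 (f (u, t)) * (f1 (u, t))\<^sup>2 + p1 (f (u, t)) * f2 (u, t)) (at t)"
    unfolding has_real_derivative_iff_has_vector_derivative[symmetric]
    by (simp add: power2_eq_square mult_ac)
qed

text \<open>The second derivative is needed only where all first derivatives vanish, which removes the
  mixed terms.\<close>

lemma C2_jet_prod:
  fixes f :: "'i \<Rightarrow> 'a::topological_space \<times> real \<Rightarrow> real"
  assumes "finite I" "\<And>i. i \<in> I \<Longrightarrow> C2_jet S (f i) (a i) (b i)"
  shows "\<exists>d1 d2. C2_jet S (\<lambda>z. \<Prod>i\<in>I. f i z) d1 d2 \<and>
    (\<forall>z. (\<forall>i\<in>I. a i z = 0) \<longrightarrow> d1 z = 0 \<and> d2 z = (\<Sum>k\<in>I. b k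
        z * (\<Prod>i\<in>I - {k}. f i z)))"
  using assms
proof (induction I rule: finite_induct)
  case empty
  show ?case by (rule exI[of _ "\<lambda>z. 0"], rule exI[of _ "\<lambda>z. 0"]) (simp add: C2_jet_const)
next
  case (insert j I)
  then obtain d1 d2 where d: "C2_jet S (\<lambda>z. \<Prod>i\<in>I. f i z) d1 d2"
    and v: "\<And>z. (\<forall>i\<in>I. a i z = 0) \<Longrightarrow> d1 z = 0 \<and> d2 z = (\<Sum>k\<in>I.
        b k z * (\<Prod>i\<in>I - {k}. f i z))"
    by auto
  have "C2_jet S (f j) (a j) (b j)" using insert.prems by auto
  from C2_jet_mult[OF this d]
  have J: "C2_jet S (\<lambda>z. \<Prod>i\<in>insert j I. f i z) (\<lambda>z. f j z * d1 z + a j z *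
      (\<Prod>i\<in>I. f i z))
     (\<lambda>z. f j z * d2 z + 2 * (a j z * d1 z) + b j z * (\<Prod>i\<in>I. f i z))"
    using insert.hyps by simp
  have V: "f j z * d1 z + a j z * (\<Prod>i\<in>I. f i z) = 0 \<and>
     f j z * d2 z + 2 * (a j z * d1 z) + b j z * (\<Prod>i\<in>I. f i z) =
     (\<Sum>k\<in>insert j I. b k z * (\<Prod>i\<in>insert j I - {k}. f i z))"
    if z: "\<forall>i\<in>insert j I. a i z = 0" for z
  proof -
    have "(\<Sum>k\<in>I. b k z * (\<Prod>i\<in>insert j I - {k}. f i z)) = (\<Sum>k\<in>I. f j z * (b k z
        * (\<Prod>i\<in>I - {k}. f i z)))"
    proof (rule sum.cong[OF refl])
      fix k assume "k \<in> I"
      then have "insert j I - {k} = insert j (I - {k})" "j \<notin> I - {k}" using insert.hyps by auto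
      then show "b k z * (\<Prod>i\<in>insert j I - {k}. f i z) = f j z * (b k z * (\<Prod>i\<in>I - {k}. f i z))"
        using insert.hyps by simp
    qed
    moreover have "insert j I - {j} = I" using insert.hyps by auto
    ultimately show ?thesis using z v[of z] insert.hyps by (simp add: sum_distrib_left)
  qed
  show ?case by (rule exI, rule exI, rule conjI, rule J) (use V in blast)
qed

text \<open>A permutation other than the identity moves at least two indices, so removing one factor
  from its product still leaves an off-diagonal entry of \<open>mat 1\<close>, which is zero. Only
  the identity permutation contributes, and it gives the trace. The intended \<open>g\<close> is the
  induced metric in isometric coordinates, stationary at time 0.\<close>

lemma C2_jet_det:
  fixes g :: "'a::topological_space \<times> real \<Rightarrow> real^'m^'m"
  assumes j: "\<And>i j. C2_jet S (\<lambda>z. g z $ i $ j) (a i j) (b i j)"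
  shows "\<exists>d1 d2. C2_jet S (\<lambda>z. det (g z)) d1 d2 \<and>
    (\<forall>z. g z = mat 1 \<and> (\<forall>i j. a i j z = 0) \<longrightarrow> d1 z = 0 \<and> d2 z =
        (\<Sum>k\<in>UNIV. b k k z))"
proof -
  define Q where "Q p d1 d2 \<longleftrightarrow> C2_jet S (\<lambda>z. \<Prod>i\<in>UNIV. g z $ i $ p i) d1 d2 \<and>
    (\<forall>z. (\<forall>i\<in>UNIV. a i (p i) z = 0) \<longrightarrow> d1 z = 0 \<and>
      d2 z = (\<Sum>k\<in>UNIV. b k (p k) z * (\<Prod>i\<in>UNIV - {k}. g z $ i $ p i)))" for p :: "'m
          \<Rightarrow> 'm" and d1 d2
  have "\<exists>d1 d2. Q p d1 d2" for p unfolding Q_def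
    by (rule C2_jet_prod[where f="\<lambda>i z. g z $ i $ p i" and a="\<lambda>i. a i (p i)" and
        b="\<lambda>i. b i (p i)"])
       (auto intro: j)
  then obtain d1 d2 where Q: "\<And>p. Q p (d1 p) (d2 p)" by metis
  have d: "C2_jet S (\<lambda>z. \<Prod>i\<in>UNIV. g z $ i $ p i) (d1 p) (d2 p)" for p
    using Q[of p] by (simp add: Q_def)
  have v: "d1 p z = 0 \<and> d2 p z = (\<Sum>k\<in>UNIV. b k (p k) z * (\<Prod>i\<in>UNIV - {k}. g z $ i $ p i))"
    if "\<forall>i\<in>UNIV. a i (p i) z = 0" for p z
    using Q[of p, unfolded Q_def, THEN conjunct2, rule_format, of z] that by blast
  let ?P = "{p::'m \<Rightarrow> 'm. p permutes UNIV}"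
  have J: "C2_jet S (\<lambda>z. det (g z)) (\<lambda>z. \<Sum>p\<in>?P. of_int (sign p) * d1 p z)
      (\<lambda>z. \<Sum>p\<in>?P. of_int (sign p) * d2 p z)"
    unfolding det_def
  proof (rule C2_jet_sum)
    fix p :: "'m \<Rightarrow> 'm"
    show "C2_jet S (\<lambda>z. of_int (sign p) * (\<Prod>i\<in>UNIV. g z $ i $ p i))
      (\<lambda>z. of_int (sign p) * d1 p z) (\<lambda>z. of_int (sign p) * d2 p z)"
      using C2_jet_mult[OF C2_jet_const[of S "of_int (sign p) :: real"] d[of p]] by simp
  qed
  have V: "(\<Sum>p\<in>?P. of_int (sign p) * d1 p z) = 0 \<and> (\<Sum>p\<in>?P. of_int (sign p) * d2 p z)
      = (\<Sum>k\<in>UNIV. b k k z)"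
    if z: "g z = mat 1" "\<forall>i j. a i j z = 0" for z
  proof -
    have 1: "d2 p z = 0" if p: "p \<in> ?P" "p \<noteq> id" for p
    proof -
      have P0: "(\<Prod>i\<in>UNIV - {k}. g z $ i $ p i) = 0" for k
      proof -
        \<comment> \<open>If \<open>i\<close> is moved, then by injectivity so is
          \<open>p i\<close>; at least one of these two indices differs from \<open>k\<close> and
          supplies the zero factor.\<close>
        obtain i where i: "p i \<noteq> i" using p(2) by (auto simp: fun_eq_iff)
        then have "p (p i) \<noteq> p i" using permutes_inj[of p UNIV] p(1) by (auto dest: injD)
        with i obtain l where "l \<noteq> k" "p l \<noteq> l" by metis
        then have "l \<in> UNIV - {k}" "g z $ l $ p l = 0" using z(1) by (auto simp: mat_def)
        then show ?thesis by (metis finite prod_zero)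
      qed
      have "d2 p z = (\<Sum>k\<in>UNIV. b k (p k) z * (\<Prod>i\<in>UNIV - {k}. g z $ i $ p i))"
        using v[of p z] z(2) by blast
      then show ?thesis unfolding P0 by simp
    qed
    have 2: "d2 id z = (\<Sum>k\<in>UNIV. b k k z)"
      using v[of id z] z by (simp add: mat_def)
    have "(\<Sum>p\<in>?P. of_int (sign p) * d2 p z) = (\<Sum>p\<in>{id}. of_int (sign p) * d2 p z)"
      by (rule sum.mono_neutral_right) (use 1 permutes_id[of UNIV] in auto)
    then show ?thesis using 2 v z by simp
  qed
  show ?thesis by (rule exI, rule exI, rule conjI, rule J) (use V in blast)
qed

text \<open>Compactness of the box is what lets joint continuity of the time derivative justify the
  Leibniz rule; no dominating function has to be found. The rule is used once for \<open>f\<close>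
  and once for \<open>f1\<close>.\<close>

lemma C2_jet_integral:
  fixes f :: "'a::euclidean_space \<times> real \<Rightarrow> real"
  assumes j: "C2_jet (UNIV \<times> J) f f1 f2" and J: "open J" "convex J" "t \<in> J"
  shows "((\<lambda>s. integral (cbox l r) (\<lambda>u. f (u, s))) has_real_derivative
      integral (cbox l r) (\<lambda>u. f1 (u, t))) (at t)"
    and "((\<lambda>s. integral (cbox l r) (\<lambda>u. f1 (u, s))) has_real_derivative
      integral (cbox l r) (\<lambda>u. f2 (u, t))) (at t)"
proof -
  have *: "((\<lambda>s. integral (cbox l r) (\<lambda>u. f (u, s))) has_real_derivative
      integral (cbox l r) (\<lambda>u. f' (u, t))) (at t)"
    if c: "continuous_on (UNIV \<times> J) f" "continuous_on (UNIV \<times> J) f'"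
      and d: "\<And>u t. t \<in> J \<Longrightarrow> ((\<lambda>s. f (u, s)) has_real_derivative f' (u, t)) (at t)"
    for f f' :: "'a \<times> real \<Rightarrow> real"
  proof -
    have "((\<lambda>s. integral (cbox l r) (\<lambda>u. f (u, s))) has_real_derivative
      integral (cbox l r) (\<lambda>u. f' (u, t))) (at t within J)"
    proof (rule leibniz_rule_field_derivative)
      show "(\<lambda>u. f (u, s)) integrable_on cbox l r" if "s \<in> J" for s
        by (intro integrable_continuous continuous_on_compose2[OF c(1)] continuous_intros) (use that in auto)
      show "continuous_on (J \<times> cbox l r) (\<lambda>(s, u). f' (u, s))"
        unfolding split_beta by (intro continuous_on_compose2[OF c(2)] continuous_intros) auto
      show "((\<lambda>s. f (u, s)) has_real_derivative f' (u, s)) (at s within J)" if "s \<in> J" for s u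
        using d[OF that] by (rule has_field_derivative_at_within)
    qed (use J in auto)
    then show ?thesis by (simp add: at_within_open[OF J(3,1)])
  qed
  show "((\<lambda>s. integral (cbox l r) (\<lambda>u. f (u, s))) has_real_derivative
      integral (cbox l r) (\<lambda>u. f1 (u, t))) (at t)"
    by (rule *) (use j in \<open>auto simp: C2_jet_def has_real_derivative_iff_has_vector_derivative\<close>)
  show "((\<lambda>s. integral (cbox l r) (\<lambda>u. f1 (u, s))) has_real_derivative
      integral (cbox l r) (\<lambda>u. f2 (u, t))) (at t)"
    by (rule *) (use j in \<open>auto simp: C2_jet_def has_real_derivative_iff_has_vector_derivative\<close>)
qed

section \<open>Directional derivatives of smooth maps and their symmetry\<close>

lemma smooth_on_continuous: "smooth_on f S \<Longrightarrow> continuous_on S f"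
  unfolding smooth_on_def by (drule spec[of _ 0]) simp

lemma smooth_on_differentiable: "smooth_on f S \<Longrightarrow> z \<in> S \<Longrightarrow> f differentiable (at z)"
  unfolding smooth_on_def by (drule spec[of _ "Suc 0"]) simp

lemma smooth_on_frechet: "smooth_on f S \<Longrightarrow> smooth_on (\<lambda>z. frechet_derivative f (at z) v) S"
  unfolding smooth_on_def by (rule allI, drule_tac x="Suc k" in spec) simp

lemma smooth_on_line_derivative:
  assumes "smooth_on f S" "z + s *\<^sub>R v \<in> S"
  shows "((\<lambda>s. f (z + s *\<^sub>R v)) has_vector_derivative frechet_derivative f (at (z + s
      *\<^sub>R v)) v) (at s)"
proof -
  have f: "(f has_derivative frechet_derivative f (at (z + s *\<^sub>R v))) (at (z + s *\<^sub>R v))"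
    using smooth_on_differentiable[OF assms] by (simp add: frechet_derivative_works)
  have "((\<lambda>s. z + s *\<^sub>R v) has_derivative (\<lambda>h. h *\<^sub>R v)) (at s)"
    by (auto intro!: derivative_eq_intros)
  from has_derivative_compose[OF this f] linear_cmul[OF has_derivative_linear[OF f]]
  show ?thesis by (simp add: has_vector_derivative_def o_def)
qed

text \<open>Write \<open>f (z + s v + t w) = f (z + s v) + \<integral>\<^sub>0\<^sup>t D\<^sub>w f (z + s v + \<tau> w) d\<tau>\<close>, differentiate under the
  integral in \<open>s\<close>, then in \<open>t\<close>.\<close>

lemma smooth_on_frechet_symmetric:
  fixes f :: "'a::real_normed_vector \<Rightarrow> 'b::banach"
  assumes f: "smooth_on f S" and S: "open S" "z \<in> S"
  shows "frechet_derivative (\<lambda>z. frechet_derivative f (at z) v) (at z) w =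
    frechet_derivative (\<lambda>z. frechet_derivative f (at z) w) (at z) v"
proof -
  define D where "D v z = frechet_derivative f (at z) v" for v z
  define DD where "DD v w z = frechet_derivative (D v) (at z) w" for v w z
  have sD: "smooth_on (D v) S" for v unfolding D_def by (rule smooth_on_frechet[OF f])
  have sDD: "smooth_on (DD v w) S" for v w unfolding DD_def by (rule smooth_on_frechet[OF sD])
  obtain e where e: "e > 0" "ball z e \<subseteq> S" using S openE by blast
  \<comment> \<open>For \<bar>s\<bar>, \<bar>t\<bar> at most \<open>r\<close> the displacement has
    norm at most \<open>e / 2\<close>. The added 1 keeps the denominator positive when both
    directions vanish.\<close>
  define r where "r = e / (2 * (norm v + norm w + 1))"
  have r: "r > 0" unfolding r_def using e by (auto intro!: divide_pos_pos add_nonneg_pos)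
  have inS: "z + s *\<^sub>R v + t *\<^sub>R w \<in> S" if "\<bar>s\<bar> \<le> r" "\<bar>t\<bar> \<le> r" for s t
  proof -
    have "norm (s *\<^sub>R v + t *\<^sub>R w) \<le> \<bar>s\<bar> * norm v + \<bar>t\<bar> * norm w"
      by (metis norm_triangle_ineq norm_scaleR)
    also have "\<dots> \<le> r * norm v + r * norm w"
      using that by (intro add_mono mult_right_mono) auto
    also have "\<dots> = r * (norm v + norm w)" by (simp add: algebra_simps)
    also have "\<dots> \<le> r * (norm v + norm w + 1)" using r by (simp add: algebra_simps)
    also have "\<dots> = e / 2"
    proof -
      define N where "N = norm v + norm w + 1"
      have "N \<noteq> 0" unfolding N_def using norm_ge_zero[of v] norm_ge_zero[of w] by linarith
      then show ?thesis by (simp add: r_def flip: N_def)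
    qed
    finally have "norm (s *\<^sub>R v + t *\<^sub>R w) < e" using e by linarith
    moreover have "dist z (z + s *\<^sub>R v + t *\<^sub>R w) = norm (s *\<^sub>R v + t *\<^sub>R w)"
      by (metis add.assoc add_diff_cancel_left' dist_commute dist_norm)
    ultimately have "z + s *\<^sub>R v + t *\<^sub>R w \<in> ball z e" by simp
    then show ?thesis using e(2) by (rule subsetD[rotated])
  qed
  have dt: "((\<lambda>t. g (z + s *\<^sub>R v + t *\<^sub>R w)) has_vector_derivative frechet_derivative g
      (at (z + s *\<^sub>R v + t *\<^sub>R w)) w) (at t)"
    if "smooth_on g S" "\<bar>s\<bar> \<le> r" "\<bar>t\<bar> \<le> r" for g :: "'a \<Rightarrow> 'b" and s t
    by (rule smooth_on_line_derivative[OF that(1)]) (rule inS[OF that(2,3)])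
  have ds: "((\<lambda>s. g (z + s *\<^sub>R v + t *\<^sub>R w)) has_vector_derivative frechet_derivative g
      (at (z + s *\<^sub>R v + t *\<^sub>R w)) v) (at s)"
    if "smooth_on g S" "\<bar>s\<bar> \<le> r" "\<bar>t\<bar> \<le> r" for g :: "'a \<Rightarrow> 'b" and s t
  proof -
    have eqv: "z + t *\<^sub>R w + s *\<^sub>R v = z + s *\<^sub>R v + t *\<^sub>R w" for s by simp
    show ?thesis
      using smooth_on_line_derivative[OF that(1), of "z + t *\<^sub>R w" s v] inS[OF that(2,3)]
      unfolding eqv by blast
  qed
  have cont2: "continuous_on T (\<lambda>(s, t). g (z + s *\<^sub>R v + t *\<^sub>R w))" if "smooth_on g S"
      "T \<subseteq> {-r..r} \<times> {-r..r}"
    for g :: "'a \<Rightarrow> 'b" and T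
  proof -
    have "z + fst p *\<^sub>R v + snd p *\<^sub>R w \<in> S" if "p \<in> T" for p
    proof (rule inS)
      show "\<bar>fst p\<bar> \<le> r" "\<bar>snd p\<bar> \<le> r" using subsetD[OF \<open>T \<subseteq>
          _\<close> that] by (auto simp: mem_Times_iff)
    qed
    then have "continuous_on T (\<lambda>p. g (z + fst p *\<^sub>R v + snd p *\<^sub>R w))"
      by (intro continuous_on_compose2[OF smooth_on_continuous[OF that(1)]] continuous_intros) blast
    then show ?thesis by (simp add: case_prod_unfold)
  qed
  have z0: "z + 0 *\<^sub>R v = z" and t0: "y + 0 *\<^sub>R w = y" for y by simp_all
  have at0: "at 0 within {-r<..<r} = at 0" using r by (intro at_within_open) auto
  have eq: "D v (z + t *\<^sub>R w) = D v z + integral {0..t} (\<lambda>x. DD w v (z + x *\<^sub>R w))" if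
      t: "t \<in> {0..r}" for t
  proof -
    have I: "f (z + s *\<^sub>R v + t *\<^sub>R w) = f (z + s *\<^sub>R v) + integral (cbox 0 t)
        (\<lambda>x. D w (z + s *\<^sub>R v + x *\<^sub>R w))"
      if s: "\<bar>s\<bar> \<le> r" for s
    proof -
      have "((\<lambda>x. D w (z + s *\<^sub>R v + x *\<^sub>R w)) has_integral
        (f (z + s *\<^sub>R v + t *\<^sub>R w) - f (z + s *\<^sub>R v + 0 *\<^sub>R w))) {0..t}"
      proof (rule fundamental_theorem_of_calculus)
        fix x assume "x \<in> {0..t}"
        then have "\<bar>x\<bar> \<le> r" using t by auto
        then show "((\<lambda>t. f (z + s *\<^sub>R v + t *\<^sub>R w)) has_vector_derivative D w (z + s
            *\<^sub>R v + x *\<^sub>R w)) (at x within {0..t})"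
          unfolding D_def by (rule has_vector_derivative_at_within[OF dt[OF f s]])
      qed (use t in simp)
      then show ?thesis by (simp add: integral_unique)
    qed
    have "((\<lambda>s. integral (cbox 0 t) (\<lambda>x. D w (z + s *\<^sub>R v + x *\<^sub>R w)))
        has_vector_derivative
       integral (cbox 0 t) (\<lambda>x. DD w v (z + 0 *\<^sub>R v + x *\<^sub>R w))) (at 0 within {-r<..<r})"
    proof (rule leibniz_rule_vector_derivative)
      fix s x assume "s \<in> {-r<..<r}" "x \<in> cbox 0 t"
      then have sx: "\<bar>s\<bar> \<le> r" "\<bar>x\<bar> \<le> r" using t by auto
      show "((\<lambda>s. D w (z + s *\<^sub>R v + x *\<^sub>R w)) has_vector_derivative DD w v (z + s
          *\<^sub>R v + x *\<^sub>R w))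
         (at s within {-r<..<r})"
        unfolding DD_def by (rule has_vector_derivative_at_within[OF ds[OF sD sx]])
    next
      fix s assume s: "s \<in> {-r<..<r}"
      have "continuous_on (cbox 0 t) (\<lambda>x. D w (z + s *\<^sub>R v + x *\<^sub>R w))"
        by (rule continuous_on_compose2[OF smooth_on_continuous[OF sD]], intro continuous_intros)
           (use s t in \<open>auto simp del: scaleR_scaleR intro!: inS\<close>)
      then show "(\<lambda>x. D w (z + s *\<^sub>R v + x *\<^sub>R w)) integrable_on cbox 0 t"
        by (rule integrable_continuous)
    next
      show "continuous_on ({-r<..<r} \<times> cbox 0 t) (\<lambda>(s, x). DD w v (z + s *\<^sub>R v + x *\<^sub>R w))"
        by (rule cont2[OF sDD]) (use t in auto)
    qed (use r in auto)
    then have "((\<lambda>s. integral (cbox 0 t) (\<lambda>x. D w (z + s *\<^sub>R v + x *\<^sub>R w)))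
        has_vector_derivative
       integral {0..t} (\<lambda>x. DD w v (z + x *\<^sub>R w))) (at 0)"
      unfolding at0 z0 interval_cbox[symmetric] .
    moreover have "((\<lambda>s. f (z + s *\<^sub>R v)) has_vector_derivative D v z) (at 0)"
      using ds[OF f, of 0 0] r unfolding z0 t0 D_def by simp
    ultimately have "((\<lambda>s. f (z + s *\<^sub>R v) + integral (cbox 0 t) (\<lambda>x. D w (z + s
        *\<^sub>R v + x *\<^sub>R w))) has_vector_derivative
       D v z + integral {0..t} (\<lambda>x. DD w v (z + x *\<^sub>R w))) (at 0)"
      by (rule has_vector_derivative_add[rotated])
    then have "((\<lambda>s. f (z + s *\<^sub>R v + t *\<^sub>R w)) has_vector_derivative
       D v z + integral {0..t} (\<lambda>x. DD w v (z + x *\<^sub>R w))) (at 0)"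
    proof (rule has_vector_derivative_transform_within_open)
      fix s assume "s \<in> {-r<..<r}"
      then have "\<bar>s\<bar> \<le> r" by auto
      from I[OF this] show "f (z + s *\<^sub>R v) + integral (cbox 0 t) (\<lambda>x. D w (z + s *\<^sub>R v
          + x *\<^sub>R w)) = f (z + s *\<^sub>R v + t *\<^sub>R w)" ..
    qed (use r in simp_all)
    moreover have "((\<lambda>s. f (z + s *\<^sub>R v + t *\<^sub>R w)) has_vector_derivative D v (z + t
        *\<^sub>R w)) (at 0)"
      using ds[OF f, of 0 t] r t unfolding z0 D_def by simp
    ultimately show ?thesis by (metis vector_derivative_at)
  qed
  \<comment> \<open>The representation \<open>eq\<close> is available for nonnegative
    \<open>t\<close> only. A one-sided derivative at 0 is enough, since vector derivatives within
    \<open>{0..r}\<close> are still unique.\<close>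
  have "((\<lambda>t. integral {0..t} (\<lambda>x. DD w v (z + x *\<^sub>R w))) has_vector_derivative DD w
      v (z + 0 *\<^sub>R w)) (at 0 within {0..r})"
  proof (rule integral_has_vector_derivative)
    have "z + x *\<^sub>R w \<in> S" if "x \<in> {0..r}" for x
      using inS[of 0 x] that r by simp
    then show "continuous_on {0..r} (\<lambda>x. DD w v (z + x *\<^sub>R w))"
      by (intro continuous_on_compose2[OF smooth_on_continuous[OF sDD]] continuous_intros) blast
  qed (use r in simp)
  then have "((\<lambda>t. D v z + integral {0..t} (\<lambda>x. DD w v (z + x *\<^sub>R w)))
      has_vector_derivative DD w v z) (at 0 within {0..r})"
    unfolding t0 by (auto intro!: derivative_eq_intros)
  then have "((\<lambda>t. D v (z + t *\<^sub>R w)) has_vector_derivative DD w v z) (at 0 within {0..r})"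
    by (rule has_vector_derivative_transform[rotated 2]) (use r in \<open>simp_all add: eq del: scaleR_scaleR\<close>)
  moreover have "((\<lambda>t. D v (z + t *\<^sub>R w)) has_vector_derivative DD v w z) (at 0 within {0..r})"
    using dt[OF sD, of 0 0 v] r unfolding z0 t0 DD_def by (simp add: has_vector_derivative_at_within)
  ultimately have "DD w v z = DD v w z"
    by (rule vector_derivative_unique_within[rotated]) (use r in \<open>auto simp: trivial_limit_within\<close>)
  then show ?thesis by (simp add: DD_def D_def[abs_def])
qed

section \<open>Linear changes of variables\<close>

lemma det_shear:
  fixes m n :: "'n::finite"
  assumes "m \<noteq> n"
  shows "det (matrix (\<lambda>x::real^'n. \<chi> i. if i = m then x$m + x$n else x$i)) = 1"
proof -
  have "matrix (\<lambda>x::real^'n. \<chi> i. if i = m then x$m + x$n else x$i) =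
    (\<chi> k. if k = m then row m (mat 1) + 1 *s row n (mat 1) else row k (mat 1))"
    by (auto simp: matrix_def vec_eq_iff row_def mat_def axis_def)
  then show ?thesis
    using det_row_operation[OF assms, where c=1 and A="mat 1 :: real^'n^'n"] by simp
qed

lemma det_swap:
  fixes m n :: "'n::finite"
  assumes "m \<noteq> n"
  shows "\<bar>det (matrix (\<lambda>x::real^'n. \<chi> i. x $ Transposition.transpose m n i))\<bar> = 1"
proof -
  have "matrix (\<lambda>x::real^'n. \<chi> i. x $ Transposition.transpose m n i) =
    (\<chi> i. (mat 1 :: real^'n^'n) $ Transposition.transpose m n i)"
    by (auto simp: matrix_def vec_eq_iff mat_def axis_def)
  then show ?thesis
    by (simp add: det_permute_rows permutes_swap_id sign_swap_id abs_mult assms)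
qed

lemma measure_swap_cbox:
  fixes a b :: "real^'n"
  shows "measure lebesgue ((\<lambda>x. \<chi> i. x $ Transposition.transpose m n i) ` cbox a b) = measure
      lebesgue (cbox a b)"
    (is "measure _ (?h ` _) = _")
proof -
  have hh: "?h (?h x) = x" for x :: "real^'n" by (simp add: vec_eq_iff)
  have mem: "?h x \<in> cbox (?h a) (?h b) \<longleftrightarrow> x \<in> cbox a b" for x
    by (simp add: mem_box_cart) (metis transpose_involutory)
  then have eq: "?h ` cbox a b = cbox (?h a) (?h b)"
  proof (intro set_eqI iffI)
    fix y assume "y \<in> cbox (?h a) (?h b)"
    then have "?h y \<in> cbox a b" using mem[of "?h y"] hh[of y] by simp
    then show "y \<in> ?h ` cbox a b" using hh[of y] by (intro image_eqI[of _ _ "?h y"]) simp_all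
  qed (use mem in blast)
  have "cbox a b = {} \<longleftrightarrow> cbox (?h a) (?h b) = {}"
    unfolding eq[symmetric] by simp
  moreover have "(\<Prod>i\<in>UNIV. b $ Transposition.transpose m n i - a $ Transposition.transpose m n i)
      = (\<Prod>i\<in>UNIV. b$i - a$i)"
    using prod.permute[of "Transposition.transpose m n" UNIV "\<lambda>i. b$i - a$i"]
    by (simp add: permutes_swap_id o_def)
  ultimately show ?thesis unfolding eq by (simp add: content_cbox_if_cart)
qed

lemma measure_shear_cbox:
  fixes a b :: "real^'n"
  assumes "m \<noteq> n"
  shows "measure lebesgue ((\<lambda>x. \<chi> i. if i = m then x$m + x$n else x$i) ` cbox a b) = measure
      lebesgue (cbox a b)"
    (is "measure _ (?h ` _) = _")
proof (cases "cbox a b = {}")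
  case False
  \<comment> \<open>Translating by \<open>v\<close> moves the lower bound of the box in coordinate
    \<open>n\<close> to 0, which meets the sign condition of \<open>measure_shear_interval\<close>.
    By additivity of the shear, the translation becomes another translation after it.\<close>
  define v where "v = axis n (a $ n)"
  have C: "cbox a b = (+) v ` cbox (a - v) (b - v)"
    by (metis cbox_translation diff_add_cancel add.commute)
  have lin: "?h (x + y) = ?h x + ?h y" for x y :: "real^'n" by (auto simp: vec_eq_iff)
  have "?h ` cbox a b = (+) (?h v) ` ?h ` cbox (a - v) (b - v)"
    unfolding C image_image lin ..
  then have "measure lebesgue (?h ` cbox a b) = measure lebesgue (?h ` cbox (a - v) (b - v))"
    by (simp only: measure_translation)
  also have "\<dots> = measure lebesgue (cbox (a - v) (b - v))"
  proof (rule measure_shear_interval[OF assms])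
    show "cbox (a - v) (b - v) \<noteq> {}" using False C by auto
    show "0 \<le> (a - v) $ n" by (simp add: v_def axis_def)
  qed
  also have "\<dots> = measure lebesgue (cbox a b)"
    unfolding C by (simp only: measure_translation)
  finally show ?thesis .
qed simp

text \<open>The library has this only for index types that are well-ordered.\<close>

lemma measure_linear_image_finite:
  fixes T :: "real^'n \<Rightarrow> real^'n"
  assumes "linear T" "inj T" "S \<in> lmeasurable"
  shows "measure lebesgue (T ` S) = \<bar>det (matrix T)\<bar> * measure lebesgue S"
proof -
  define Q where "Q f \<longleftrightarrow> (\<forall>S\<in>lmeasurable. f ` S \<in> lmeasurable \<and>
      measure lebesgue (f ` S) = \<bar>det (matrix f)\<bar> * measure lebesgue S)" for f :: "real^'n
          \<Rightarrow> real^'n"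
  have Q1: "Q f" if "\<bar>det (matrix f)\<bar> = 1"
    "\<And>S. S \<in> lmeasurable \<Longrightarrow> f ` S \<in> lmeasurable \<and> 1 * measure lebesgue S =
        measure lebesgue (f ` S)" for f
    unfolding Q_def that(1)
  proof
    fix S :: "(real^'n) set" assume "S \<in> lmeasurable"
    from that(2)[OF this]
    show "f ` S \<in> lmeasurable \<and> measure lebesgue (f ` S) = 1 * measure lebesgue S" by metis
  qed
  \<comment> \<open>Injectivity is carried through the induction, so that the elementary maps with a
    vanishing coordinate make the claim vacuous.\<close>
  have "inj T \<longrightarrow> Q T"
  proof (rule induct_linear_elementary[OF \<open>linear T\<close>])
    fix f g :: "real^'n \<Rightarrow> real^'n"
    assume lin: "linear f" "linear g" and f: "inj f \<longrightarrow> Q f" and g: "inj g \<longrightarrow> Q g"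
    show "inj (f \<circ> g) \<longrightarrow> Q (f \<circ> g)"
    proof
      assume fg: "inj (f \<circ> g)"
      then have "inj g" by (rule inj_on_imageI2)
      then have "surj g" using lin by (simp add: linear_injective_imp_surjective)
      then have "inj f" using fg by (metis comp_inj_on_iff \<open>inj g\<close>)
      with \<open>inj g\<close> f g show "Q (f \<circ> g)"
        unfolding Q_def by (simp only: image_comp[symmetric] matrix_compose[OF lin(2,1)] det_mul abs_mult) simp
    qed
  next
    fix f :: "real^'n \<Rightarrow> real^'n" and i
    assume "linear f" "\<And>x. f x $ i = 0"
    then have "\<not> inj f"
      by (metis (full_types) linear_injective_imp_surjective one_neq_zero surjE vec_component)
    then show "inj f \<longrightarrow> Q f" by simp
  next
    fix c :: "'n \<Rightarrow> real"
    show "inj (\<lambda>x::real^'n. \<chi> i. c i * x$i) \<longrightarrow> Q (\<lambda>x. \<chi> i. c i * x$i)"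
      by (simp add: Q_def measurable_stretch measure_stretch axis_def matrix_def det_diagonal)
  next
    fix m n :: 'n assume mn: "m \<noteq> n"
    have "linear (\<lambda>x::real^'n. \<chi> i. x $ Transposition.transpose m n i)"
      by (rule linearI) (simp_all add: vec_eq_iff)
    then have meas: "(\<lambda>x::real^'n. \<chi> i. x $ Transposition.transpose m n i) ` S \<in>
        lmeasurable \<and> 1 * measure lebesgue S = measure lebesgue ((\<lambda>x::real^'n. \<chi> i. x $
        Transposition.transpose m n i) ` S)"
      if "S \<in> lmeasurable" for S
      by (rule measure_linear_sufficient[OF _ that]) (simp only: measure_swap_cbox mult_1)
    show "inj (\<lambda>x::real^'n. \<chi> i. x $ Transposition.transpose m n i) \<longrightarrow> Q
        (\<lambda>x::real^'n. \<chi> i. x $ Transposition.transpose m n i)"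
      by (rule impI, rule Q1[OF det_swap[OF mn] meas])
  next
    fix m n :: 'n assume mn: "m \<noteq> n"
    have "linear (\<lambda>x::real^'n. \<chi> i. if i = m then x$m + x$n else x$i)"
      by (rule linearI) (auto simp: vec_eq_iff algebra_simps)
    then have meas: "(\<lambda>x::real^'n. \<chi> i. if i = m then x$m + x$n else x$i) ` S \<in>
        lmeasurable \<and> 1 * measure lebesgue S = measure lebesgue ((\<lambda>x::real^'n. \<chi> i. if i
        = m then x$m + x$n else x$i) ` S)"
      if "S \<in> lmeasurable" for S
      by (rule measure_linear_sufficient[OF _ that]) (simp only: measure_shear_cbox[OF mn] mult_1)
    show "inj (\<lambda>x::real^'n. \<chi> i. if i = m then x$m + x$n else x$i) \<longrightarrow> Q
        (\<lambda>x::real^'n. \<chi> i. if i = m then x$m + x$n else x$i)"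
      by (rule impI, rule Q1[OF _ meas]) (simp_all only: det_shear[OF mn] abs_one)
  qed
  then show ?thesis using assms by (simp add: Q_def)
qed

section \<open>Gram determinants and affine substitution\<close>

text \<open>Positivity of the form passes to every matrix on the segment from the identity to
  \<open>A\<close>, so none of them is singular; by the intermediate value theorem the determinant
  keeps the sign it has at the identity.\<close>

lemma det_pos_of_pos_definite:
  fixes A :: "real^'m^'m"
  assumes A: "\<And>v. v \<noteq> 0 \<Longrightarrow> v \<bullet> (A *v v) > 0"
  shows "det A > 0"
proof (rule ccontr)
  assume neg: "\<not> det A > 0"
  define B where "B s = (1 - s) *\<^sub>R mat 1 + s *\<^sub>R A" for s :: real
  have "continuous_on {0..1} (\<lambda>s. det (B s))"
    unfolding det_def B_def by (intro continuous_intros)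
  moreover have "det (B 1) \<le> 0" "det (B 0) \<ge> 0"
    using neg by (simp_all add: B_def)
  ultimately obtain s where s: "0 \<le> s" "s \<le> 1" "det (B s) = 0"
    using IVT2'[of "\<lambda>s. det (B s)" 1 0 0] by auto
  then obtain v where v: "v \<noteq> 0" "B s *v v = 0"
    using invertible_det_nz[of "B s"] invertible_left_inverse[of "B s"] matrix_left_invertible_ker[of "B s"] by auto
  have "0 = v \<bullet> (B s *v v)" using v by simp
  also have "\<dots> = (1 - s) * (v \<bullet> v) + s * (v \<bullet> (A *v v))"
    by (simp add: B_def matrix_vector_mult_add_rdistrib scaleR_matrix_vector_assoc[symmetric] inner_add_right)
  also have "\<dots> > 0"
  proof (cases "s = 0")
    case False
    then have "s * (v \<bullet> (A *v v)) > 0" using s A[OF v(1)] by simp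
    moreover have "(1 - s) * (v \<bullet> v) \<ge> 0" using s by simp
    ultimately show ?thesis by linarith
  qed (use v in simp)
  finally show False by simp
qed

text \<open>The quadratic form of the Gram matrix is \<open>L v \<bullet> L v\<close>. For an
  immersion this keeps the area density away from the point where the square root is not
  differentiable.\<close>

lemma det_gram_pos:
  fixes L :: "real^'m \<Rightarrow> 'a::real_inner"
  assumes L: "linear L" "inj L"
  shows "det (\<chi> i j. L (axis i 1) \<bullet> L (axis j 1)) > 0"
proof (rule det_pos_of_pos_definite)
  fix v :: "real^'m" assume v: "v \<noteq> 0"
  have Lv: "L v = (\<Sum>i\<in>UNIV. v $ i *\<^sub>R L (axis i 1))"
  proof -
    have "L v = L (\<Sum>i\<in>UNIV. v $ i *\<^sub>R axis i 1)"
      using basis_expansion[of v] by (simp add: scalar_mult_eq_scaleR)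
    then show ?thesis by (simp add: linear_sum[OF L(1)] linear_scale[OF L(1)])
  qed
  have "v \<bullet> ((\<chi> i j. L (axis i 1) \<bullet> L (axis j 1)) *v v) = L v \<bullet> L v"
    unfolding Lv
    by (simp add: inner_vec_def matrix_vector_mult_def inner_sum_left inner_sum_right sum_distrib_left mult_ac)
       (simp add: inner_commute)
  also have "\<dots> > 0"
    using v L linear_inj_iff_eq_0[OF L(1)] by auto
  finally show "v \<bullet> ((\<chi> i j. L (axis i 1) \<bullet> L (axis j 1)) *v v) > 0" .
qed

text \<open>Lebesgue measure is characterised on open boxes. The preimage \<open>S\<close> of a box
  is open, and it is bounded as the image of the box under the affine inverse, so the formula for
  linear images applies to it; translation invariance takes care of \<open>c\<close>.\<close>

lemma lborel_affine_map:
  fixes T :: "real^'m \<Rightarrow> real^'m"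
  assumes T: "linear T" "inj T"
  shows "lborel = density (distr lborel borel (\<lambda>u. T u + c)) (\<lambda>_. ennreal \<bar>det (matrix T)\<bar>)"
proof (rule lborel_eqI)
  let ?g = "\<lambda>u. T u + c"
  have cont: "continuous_on UNIV ?g"
    by (intro continuous_intros linear_continuous_on linear_conv_bounded_linear[THEN iffD1] T)
  then have [measurable]: "?g \<in> borel_measurable borel"
    by (rule borel_measurable_continuous_onI)
  show "sets (density (distr lborel borel ?g) (\<lambda>_. ennreal \<bar>det (matrix T)\<bar>)) = sets borel" by simp
  fix l u :: "real^'m" assume lu: "\<And>b. b \<in> Basis \<Longrightarrow> l \<bullet> b \<le> u \<bullet> b"
  define S where "S = ?g -` box l u"
  have surj: "surj T" using T by (simp add: linear_injective_imp_surjective)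
  have "\<exists>x. T x = y - c" for y using surj by (metis surjD)
  then have gS: "?g ` S = box l u"
    unfolding S_def by (auto simp: image_iff) (metis diff_add_cancel)
  have opS: "open S" unfolding S_def by (rule open_vimage[OF open_box cont])
  obtain T' where T': "linear T'" "T' \<circ> T = id"
    using linear_injective_left_inverse[OF T] by auto
  have "S = (\<lambda>y. T' (y - c)) ` box l u"
  proof -
    have "T' (?g x - c) = x" for x using T'(2) by (simp add: fun_eq_iff)
    then have "(\<lambda>y. T' (y - c)) ` (?g ` S) = S" by (simp add: image_image)
    then show ?thesis unfolding gS ..
  qed
  moreover have "bounded ((\<lambda>y. T' (y - c)) ` box l u)"
    using bounded_linear_image[OF bounded_translation[OF bounded_box, of "-c" l u]] T'(1)
    by (simp add: image_image linear_conv_bounded_linear algebra_simps)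
  ultimately have "bounded S" by simp
  then have lS: "S \<in> lmeasurable" using opS by (simp add: lmeasurable_open)
  have "measure lebesgue (T ` S) = \<bar>det (matrix T)\<bar> * measure lebesgue S"
    by (rule measure_linear_image_finite[OF T lS])
  moreover have "measure lebesgue (box l u) = measure lebesgue (T ` S)"
    using measure_translation[of c "T ` S"] by (simp add: gS[symmetric] image_image add.commute)
  ultimately have m: "measure lebesgue (box l u) = \<bar>det (matrix T)\<bar> * measure lebesgue S" by simp
  have Sb: "S \<in> sets borel" using opS by simp
  have "emeasure (density (distr lborel borel ?g) (\<lambda>_. ennreal \<bar>det (matrix T)\<bar>)) (box l u)
     = ennreal \<bar>det (matrix T)\<bar> * emeasure lborel S"
    by (simp add: emeasure_density_const emeasure_distr S_def)
  also have "emeasure lborel S = ennreal (measure lebesgue S)"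
    using emeasure_eq_ennreal_measure[OF fmeasurableD2[OF lS]] Sb by simp
  also have "ennreal \<bar>det (matrix T)\<bar> * \<dots> = ennreal (measure lebesgue (box l u))"
    by (simp add: m ennreal_mult')
  also have "\<dots> = (\<Prod>b\<in>Basis. (u - l) \<bullet> b)"
    using lu by (simp add: inner_diff_left measure_lborel_box_eq)
  finally show "emeasure (density (distr lborel borel ?g) (\<lambda>_. ennreal \<bar>det (matrix T)\<bar>)) (box l u)
    = (\<Prod>b\<in>Basis. (u - l) \<bullet> b)" .
qed

lemma nn_integral_lborel_affine:
  fixes T :: "real^'m \<Rightarrow> real^'m"
  assumes T: "linear T" "inj T" and [measurable]: "f \<in> borel_measurable borel"
  shows "(\<integral>\<^sup>+x. f x \<partial>lborel) = ennreal \<bar>det (matrix T)\<bar> *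
      (\<integral>\<^sup>+u. f (T u + c) \<partial>lborel)"
proof -
  have [measurable]: "(\<lambda>u. T u + c) \<in> borel_measurable borel"
    by (intro borel_measurable_continuous_onI continuous_intros linear_continuous_on
        linear_conv_bounded_linear[THEN iffD1] T)
  show ?thesis
    by (subst lborel_affine_map[OF T, of c])
       (simp add: nn_integral_density nn_integral_distr nn_integral_cmult)
qed

lemma closest_point_subspace_eq:
  fixes T :: "'a::euclidean_space set"
  assumes "subspace T" "w \<in> T" "\<And>x. x \<in> T \<Longrightarrow> (v - w) \<bullet> x = 0"
  shows "closest_point T v = w"
proof (rule closest_point_unique[symmetric])
  show "\<forall>z\<in>T. dist v w \<le> dist v z"
  proof
    fix z assume "z \<in> T"
    then have "w - z \<in> T" using assms by (simp add: subspace_diff)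
    then have "(v - w) \<bullet> (w - z) = 0" using assms by simp
    then have "(norm (v - z))\<^sup>2 = (norm (v - w))\<^sup>2 + (norm (w - z))\<^sup>2"
      using norm_add_Pythagorean[of "v - w" "w - z"] by (simp add: orthogonal_def)
    then show "dist v w \<le> dist v z" by (simp add: dist_norm power2_le_imp_le)
  qed
qed (use assms in \<open>auto simp: subspace_imp_convex closed_subspace\<close>)

lemma smooth_on_const: "smooth_on (\<lambda>x. c) S"
proof -
  have "Ck_on k (\<lambda>x::'a. c::'b) S" for k and c :: 'b
    by (induction k arbitrary: c) (simp_all add: frechet_derivative_const)
  then show ?thesis by (simp add: smooth_on_def)
qed

lemma frechet_derivative_affine:
  fixes L :: "'a::real_normed_vector \<Rightarrow> 'b::real_normed_vector"
  assumes "bounded_linear L"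
  shows "frechet_derivative (\<lambda>u. p + L u) (at u) = L"
  by (rule frechet_derivative_at[symmetric])
     (auto intro!: derivative_eq_intros bounded_linear_imp_has_derivative assms)

lemma smooth_on_affine:
  fixes L :: "'a::real_normed_vector \<Rightarrow> 'b::real_normed_vector"
  assumes L: "bounded_linear L"
  shows "smooth_on (\<lambda>u. p + L u) S"
  unfolding smooth_on_def
proof
  fix k
  have "(\<lambda>u. p + L u) differentiable at u" for u
    by (intro derivative_intros bounded_linear_imp_differentiable L)
  moreover have "Ck_on j (\<lambda>x::'a. c) S" for j and c :: 'b using smooth_on_const[of c S] by (simp
      add: smooth_on_def)
  moreover have "continuous_on S (\<lambda>u. p + L u)"
    by (intro continuous_intros linear_continuous_on L)
  ultimately show "Ck_on k (\<lambda>u. p + L u) S"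
    by (cases k) (simp_all add: frechet_derivative_affine[OF L])
qed

section \<open>The second variation in coordinates\<close>

lemma bounded_if_compact_support:
  fixes f :: "'a::euclidean_space \<Rightarrow> 'b::real_normed_vector"
  assumes "continuous_on UNIV f" "compact K" "\<And>u. u \<notin> K \<Longrightarrow> f u = 0"
  obtains C where "\<And>u. norm (f u) \<le> C"
proof -
  have "bounded (f ` K)"
    using assms by (intro compact_imp_bounded compact_continuous_image) (auto intro: continuous_on_subset)
  then obtain C where "\<forall>u\<in>K. norm (f u) \<le> C" by (auto simp: bounded_iff)
  then have "norm (f u) \<le> max C 0" for u
    by (cases "u \<in> K") (auto simp: assms(3) le_max_iff_disj)
  then show ?thesis using that by blast
qed

lemma gaussn_integral:
  fixes f :: "'a::euclidean_space \<Rightarrow> real"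
  assumes [measurable]: "f \<in> borel_measurable borel"
  shows "(\<integral>u. f u \<partial>gaussn) = (1 / sqrt (2 * pi)) ^ DIM('a) * (\<integral>u. exp (- (norm
      u)\<^sup>2 / 2) * f u \<partial>lborel)"
proof -
  have "(\<integral>u. f u \<partial>gaussn) = (\<integral>u. gauss_density u * f u \<partial>lborel)"
    by (subst integral_density) auto
  also have "\<dots> = (\<integral>u. (1 / sqrt (2 * pi)) ^ DIM('a) * (exp (- (norm u)\<^sup>2 / 2) * f u)
      \<partial>lborel)"
    by (simp only: gauss_density_eq mult.assoc)
  finally show ?thesis by simp
qed

lemma integrable_exp_norm:
  "integrable lborel (\<lambda>u::'a::euclidean_space. exp (- (norm u)\<^sup>2 / 2))"
proof -
  interpret prob_space "gaussn :: 'a measure" by (rule prob_space_gaussn)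
  have "integrable (gaussn :: 'a measure) (\<lambda>u. 1 :: real)" by simp
  then have "integrable lborel (\<lambda>u::'a. gauss_density u * 1)"
    by (subst (asm) integrable_density) auto
  then show ?thesis by (simp add: gauss_density_eq)
qed

text \<open>The integral is the quadratic form of the second variation. By \<open>mean\<close> each
  component of \<open>n\<close> has Gaussian mean zero, so the Poincare inequality loses its mean
  term; summing over the components turns squares into norms. The bounds come from the compact
  support.\<close>

lemma gaussian_stability:
  fixes n :: "'a::euclidean_space \<Rightarrow> 'b::euclidean_space" and D :: "'a \<Rightarrow> 'a \<Rightarrow> 'b"
  assumes n: "\<And>b u. b \<in> Basis \<Longrightarrow> ((\<lambda>s. n (u + s *\<^sub>R b))
      has_vector_derivative D b u) (at 0)"
    and cont: "continuous_on UNIV n" "\<And>b. b \<in> Basis \<Longrightarrow> continuous_on UNIV (D b)"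
    and K: "compact K" "\<And>u. u \<notin> K \<Longrightarrow> n u = 0" "\<And>b u. b \<in> Basis
        \<Longrightarrow> u \<notin> K \<Longrightarrow> D b u = 0"
    and mean: "\<And>c. (\<integral>u. exp (- (norm u)\<^sup>2 / 2) * (n u \<bullet> c) \<partial>lborel) = 0"
  shows "0 \<le> (\<integral>u. exp (- (norm u)\<^sup>2 / 2) * ((\<Sum>b\<in>Basis. (norm (D b u))\<^sup>2)
      - (norm (n u))\<^sup>2) \<partial>lborel)"
proof -
  interpret prob_space "gaussn :: 'a measure" by (rule prob_space_gaussn)
  obtain B where B: "\<And>u. norm (n u) \<le> B" using bounded_if_compact_support[OF cont(1) K(1,2)] by blast
  have "\<exists>C. \<forall>u. norm (D b u) \<le> C" if "b \<in> Basis" for b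
    using bounded_if_compact_support[OF cont(2)[OF that] K(1) K(3)[OF that]] by metis
  then obtain C' where C': "\<And>b u. b \<in> Basis \<Longrightarrow> norm (D b u) \<le> C' b" by metis
  define C where "C = (\<Sum>b\<in>Basis. C' b)"
  have C'0: "b \<in> Basis \<Longrightarrow> 0 \<le> C' b" for b using C'[of b undefined] norm_ge_zero
      order_trans by blast
  have C: "norm (D b u) \<le> C" if "b \<in> Basis" for b u
    using C'[OF that, of u] member_le_sum[of b Basis C'] C'0 that unfolding C_def by fastforce
  have nm[measurable]: "n \<in> borel_measurable borel" by (rule borel_measurable_continuous_onI[OF cont(1)])
  have Dm[measurable]: "D b \<in> borel_measurable borel" if "b \<in> Basis" for b
    by (rule borel_measurable_continuous_onI[OF cont(2)[OF that]])
  have nb: "\<bar>n u \<bullet> c\<bar> \<le> B" if "c \<in> Basis" for u c using Basis_le_norm[OF that, of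
      "n u"] B[of u] by linarith
  have Db: "\<bar>D b u \<bullet> c\<bar> \<le> C" if "b \<in> Basis" "c \<in> Basis" for u b c
    using Basis_le_norm[OF that(2), of "D b u"] C[OF that(1), of u] by linarith
  have intn: "integrable gaussn (\<lambda>u. (n u \<bullet> c)\<^sup>2)" if "c \<in> Basis" for c
    by (rule integrable_abs_bounded[where B="B\<^sup>2"]) (use power2_le_power2[OF nb[OF that]] in auto)
  have intD: "integrable gaussn (\<lambda>u. (D b u \<bullet> c)\<^sup>2)" if "b \<in> Basis" "c \<in> Basis" for b c
    by (rule integrable_abs_bounded[where B="C\<^sup>2"]) (use power2_le_power2[OF Db[OF that]] that in auto)
  have comp: "(\<integral>u. (n u \<bullet> c)\<^sup>2 \<partial>gaussn) \<le> (\<Sum>b\<in>Basis.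
      \<integral>u. (D b u \<bullet> c)\<^sup>2 \<partial>gaussn)" if c: "c \<in> Basis" for c
  proof -
    have "(\<integral>u. (n u \<bullet> c)\<^sup>2 \<partial>gaussn) - (\<integral>u. n u \<bullet> c
        \<partial>gaussn)\<^sup>2 \<le> (\<Sum>b\<in>Basis. \<integral>u. (D b u \<bullet> c)\<^sup>2
        \<partial>gaussn)"
    proof (rule gaussian_poincare)
      show "((\<lambda>s. n (u + s *\<^sub>R b) \<bullet> c) has_real_derivative D b u \<bullet> c) (at 0)"
          if "b \<in> Basis" for b u
        unfolding has_real_derivative_iff_has_vector_derivative
        using bounded_linear.has_vector_derivative[OF bounded_linear_inner_left n[OF that]] .
      show "\<bar>n u \<bullet> c\<bar> \<le> B" for u by (rule nb[OF c])
      show "\<bar>D b u \<bullet> c\<bar> \<le> C" if "b \<in> Basis" for b u by (rule Db[OF that c])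
    qed (intro continuous_intros cont; assumption)+
    moreover have "(\<integral>u. n u \<bullet> c \<partial>gaussn) = 0"
      by (subst gaussn_integral) (measurable, simp only: mean mult_zero_right)
    ultimately show ?thesis by simp
  qed
  define Z where "Z u = (\<Sum>b\<in>Basis. (norm (D b u))\<^sup>2) - (norm (n u))\<^sup>2" for u
  have [measurable]: "Z \<in> borel_measurable borel" unfolding Z_def by measurable
  have sq: "(norm x)\<^sup>2 = (\<Sum>c\<in>Basis. (x \<bullet> c)\<^sup>2)" for x :: 'b
    unfolding power2_norm_eq_inner euclidean_inner[of x x] by (simp add: power2_eq_square)
  have "(\<integral>u. Z u \<partial>gaussn) = (\<Sum>b\<in>Basis. \<Sum>c\<in>Basis. \<integral>u. (D b u
      \<bullet> c)\<^sup>2 \<partial>gaussn) - (\<Sum>c\<in>Basis. \<integral>u. (n u \<bullet> c)\<^sup>2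
      \<partial>gaussn)"
    unfolding Z_def sq using intn intD
    by (subst Bochner_Integration.integral_diff) (auto simp: Bochner_Integration.integral_sum intro!:
        Bochner_Integration.integrable_sum)
  also have "\<dots> = (\<Sum>c\<in>Basis. (\<Sum>b\<in>Basis. \<integral>u. (D b u \<bullet> c)\<^sup>2
      \<partial>gaussn) - (\<integral>u. (n u \<bullet> c)\<^sup>2 \<partial>gaussn))"
    by (subst sum.swap) (simp add: sum_subtractf)
  also have "\<dots> \<ge> 0" by (intro sum_nonneg) (use comp in simp)
  finally have "0 \<le> (\<integral>u. Z u \<partial>gaussn)" .
  then have "0 \<le> (1 / sqrt (2 * pi)) ^ DIM('a) * (\<integral>u. exp (- (norm u)\<^sup>2 / 2) * Z u
      \<partial>lborel)"
    by (subst (asm) gaussn_integral) measurable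
  moreover have "0 < (1 / sqrt (2 * pi)) ^ DIM('a)" by simp
  ultimately show ?thesis by (simp add: zero_le_mult_iff Z_def)
qed

text \<open>The direction comes first so that a derivative is an operator on functions and can be
  iterated. On space times time, the direction \<open>(0, 1)\<close> is time and
  \<open>(v, 0)\<close> is space.\<close>

definition dirder :: "'a::real_normed_vector \<Rightarrow> ('a \<Rightarrow> 'b::real_normed_vector)
    \<Rightarrow> 'a \<Rightarrow> 'b" where
  "dirder w f z = frechet_derivative f (at z) w"

lemma smooth_on_dirder: "smooth_on f S \<Longrightarrow> smooth_on (dirder w f) S"
  using smooth_on_frechet[of f S w] by (simp add: dirder_def[abs_def])

lemma dirder_commute:
  fixes f :: "'a::real_normed_vector \<Rightarrow> 'b::banach"
  assumes "smooth_on f S" "open S" "z \<in> S"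
  shows "dirder w (dirder v f) z = dirder v (dirder w f) z"
  using smooth_on_frechet_symmetric[OF assms] by (simp add: dirder_def[abs_def])

lemma dirder_line:
  assumes "smooth_on f S" "z \<in> S"
  shows "((\<lambda>s. f (z + s *\<^sub>R v)) has_vector_derivative dirder v f z) (at 0)"
  using smooth_on_line_derivative[of f S z 0 v] assms by (simp add: dirder_def)

lemma dirder_eqI:
  assumes "smooth_on f S" "z \<in> S" "((\<lambda>s. f (z + s *\<^sub>R v)) has_vector_derivative d) (at 0)"
  shows "dirder v f z = d"
  using dirder_line[OF assms(1,2)] assms(3) by (metis vector_derivative_at)

lemma dirder_cong:
  assumes "smooth_on f S" "open S" "z \<in> S" "\<And>z. z \<in> S \<Longrightarrow> f z = g z"
  shows "dirder w f z = dirder w g z"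
  unfolding dirder_def
  using frechet_derivative_transform_within_open[OF smooth_on_differentiable[OF assms(1,3)] assms(2,3,4)] by simp

lemma C2_jet_smooth:
  fixes f :: "'a::real_normed_vector \<times> real \<Rightarrow> 'b::real_normed_vector"
  assumes f: "smooth_on f S"
  shows "C2_jet S f (dirder (0, 1) f) (dirder (0, 1) (dirder (0, 1) f))"
proof -
  have *: "((\<lambda>s. g (u, s)) has_vector_derivative dirder (0, 1) g (u, t)) (at t)"
    if "smooth_on g S" "(u, t) \<in> S" for g :: "'a \<times> real \<Rightarrow> 'b" and u t
    using smooth_on_line_derivative[OF that(1), of "(u, 0)" t "(0, 1)"] that(2) by (simp add: dirder_def)
  show ?thesis
    unfolding C2_jet_def
    using f by (auto intro!: * smooth_on_continuous smooth_on_dirder)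
qed

lemma C2_jet_sqrt:
  fixes f :: "'a::topological_space \<times> real \<Rightarrow> real"
  assumes f: "C2_jet S f f1 f2" and pos: "\<And>z. z \<in> S \<Longrightarrow> 0 < f z"
  shows "\<exists>d1 d2. C2_jet S (\<lambda>z. sqrt (f z)) d1 d2 \<and>
    (\<forall>z. f z = 1 \<and> f1 z = 0 \<longrightarrow> d1 z = 0 \<and> d2 z = f2 z / 2)"
proof -
  have "C2_jet S (\<lambda>z. sqrt (f z)) (\<lambda>z. inverse (sqrt (f z)) / 2 * f1 z)
    (\<lambda>z. - inverse (sqrt (f z)) / (4 * f z) * (f1 z)\<^sup>2 + inverse (sqrt (f z)) / 2 * f2 z)"
  proof (rule C2_jet_compose[OF f, of "{0<..}"])
    fix x :: real assume x: "x \<in> {0<..}"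
    then show "(sqrt has_real_derivative inverse (sqrt x) / 2) (at x)" using DERIV_real_sqrt by simp
    have "((\<lambda>x. inverse (sqrt x) / 2) has_real_derivative
       - (inverse (sqrt x) * (inverse (sqrt x) / 2) * inverse (sqrt x)) / 2) (at x)"
      using x by (auto intro!: derivative_eq_intros)
    moreover have "- (inverse (sqrt x) * (inverse (sqrt x) / 2) * inverse (sqrt x)) / 2 = - inverse (sqrt
        x) / (4 * x)"
      using x by (simp add: field_simps)
    ultimately show "((\<lambda>x. inverse (sqrt x) / 2) has_real_derivative - inverse (sqrt x) / (4 * x)) (at x)"
      by (simp only:)
  qed (use pos in \<open>auto intro!: continuous_intros\<close>)
  then show ?thesis
    by (intro exI conjI) (assumption, simp)
qed

lemma C2_jet_exp:
  fixes f :: "'a::topological_space \<times> real \<Rightarrow> real"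
  assumes f: "C2_jet S f f1 f2"
  shows "C2_jet S (\<lambda>z. exp (f z)) (\<lambda>z. exp (f z) * f1 z) (\<lambda>z. exp (f z) * (f1
      z)\<^sup>2 + exp (f z) * f2 z)"
  by (rule C2_jet_compose[OF f, of UNIV]) (auto intro!: derivative_eq_intros continuous_intros)

lemma inner_axis_orthonormal:
  "(axis i 1 :: real^'m) \<bullet> axis j 1 = (if i = j then 1 else 0)"
  by (simp add: inner_axis_axis)

text \<open>\<open>Y (u, t)\<close> is the position at time \<open>t\<close> of the point with
  isometric coordinate \<open>u\<close>, so no charts remain. The integrand is a product of the
  weight and the area density. Both are stationary at time 0, hence the mixed term of the product
  rule disappears and their second derivatives simply add.\<close>

lemma weighted_area_second_variation:
  fixes Y :: "(real^'m) \<times> real \<Rightarrow> real^'n" and E :: "real^'m \<Rightarrow> real^'n"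
  assumes e: "0 < e" and Y: "smooth_on Y (UNIV \<times> {-e<..<e})"
    and E: "linear E" "\<And>u v. E u \<bullet> E v = u \<bullet> v"
    and Y0: "\<And>u. Y (u, 0) = a + E u"
    and imm: "\<And>u t. t \<in> {-e<..<e} \<Longrightarrow> inj (\<lambda>v. dirder (v, 0) Y (u, t))"
    and normal: "\<And>u v. dirder (0, 1) Y (u, 0) \<bullet> E v = 0"
    and acc: "\<And>u. dirder (0, 1) (dirder (0, 1) Y) (u, 0) = 0"
    and K: "compact K" "\<And>u t. u \<notin> K \<Longrightarrow> t \<in> {-e<..<e} \<Longrightarrow> Y (u,
        t) = a + E u"
    and mean: "\<And>c. (\<integral>u. exp (- (norm u)\<^sup>2 / 2) * (dirder (0, 1) Y (u, 0) \<bullet> c)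
        \<partial>lborel) = 0"
  shows "second_derivative_nonneg_at_0 (\<lambda>t. enn2real (\<integral>\<^sup>+u. ennreal (exp (- (1/2) *
      (norm (Y (u, t) - a))\<^sup>2) *
      sqrt (det (\<chi> i j. dirder (axis i 1, 0) Y (u, t) \<bullet> dirder (axis j 1, 0) Y (u, t))))
          \<partial>lborel))"
proof -
  define J where "J = {-e<..<e}"
  define S where "S = (UNIV :: (real^'m) set) \<times> J"
  have J: "open J" "convex J" "0 \<in> J" using e by (auto simp: J_def)
  have S: "open S" and inS: "(u, t) \<in> S \<longleftrightarrow> t \<in> J" for u t
    using J by (auto simp: S_def open_Times)
  define Yt where "Yt = dirder (0, 1) Y"
  define Ytt where "Ytt = dirder (0, 1) Yt"
  define Yi where "Yi i = dirder (axis i 1, 0) Y" for i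
  have sY: "smooth_on Y S" using Y by (simp add: S_def J_def)
  have sYt: "smooth_on Yt S" unfolding Yt_def by (rule smooth_on_dirder[OF sY])
  have sYtt: "smooth_on Ytt S" unfolding Ytt_def by (rule smooth_on_dirder[OF sYt])
  have sYi: "smooth_on (Yi i) S" for i unfolding Yi_def by (rule smooth_on_dirder[OF sY])
  define n where "n u = Yt (u, 0)" for u
  define D where "D b u = dirder (b, 0) Yt (u, 0)" for b u
  have Yit: "dirder (0, 1) (Yi i) z = dirder (axis i 1, 0) Yt z" if "z \<in> S" for i z
    unfolding Yi_def Yt_def by (rule dirder_commute[OF sY S that])
  \<comment> \<open>The acceleration vanishes at time 0 for all \<open>u\<close>, hence so does its
    space derivative. Exchanging derivatives twice turns this into a statement about the coordinate
    fields.\<close>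
  have Yitt: "dirder (0, 1) (dirder (0, 1) (Yi i)) (u, 0) = 0" for i u
  proof -
    have z: "(u, 0) \<in> S" using J by (simp add: inS)
    have "dirder (0, 1) (dirder (0, 1) (Yi i)) (u, 0) = dirder (0, 1) (dirder (axis i 1, 0) Yt) (u, 0)"
      by (rule dirder_cong[OF smooth_on_dirder[OF sYi] S z Yit])
    also have "\<dots> = dirder (axis i 1, 0) Ytt (u, 0)"
      unfolding Ytt_def by (rule dirder_commute[OF sYt S z])
    also have "\<dots> = 0"
      by (rule dirder_eqI[OF sYtt z]) (simp add: Ytt_def Yt_def acc)
    finally show ?thesis .
  qed
  have z0: "(u, 0) \<in> S" for u using J by (simp add: inS)
  have Yi0: "Yi i (u, 0) = E (axis i 1)" for i u
    unfolding Yi_def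
  proof (rule dirder_eqI[OF sY z0])
    have "(\<lambda>s. Y ((u, 0) + s *\<^sub>R (axis i 1, 0))) = (\<lambda>s. a + E u + s *\<^sub>R E (axis i 1))"
      by (simp add: Y0 linear_add[OF E(1)] linear_scale[OF E(1)] fun_eq_iff)
    then show "((\<lambda>s. Y ((u, 0) + s *\<^sub>R (axis i 1, 0))) has_vector_derivative E (axis i 1)) (at 0)"
      by (auto intro!: derivative_eq_intros)
  qed
  have dn: "((\<lambda>s. n (u + s *\<^sub>R b)) has_vector_derivative D b u) (at 0)" for b u
    using dirder_line[OF sYt z0, of u "(b, 0)"] by (simp add: n_def D_def)
  \<comment> \<open>The tangent space is the same at all points, so differentiating the
    orthogonality of \<open>n\<close> to a fixed vector \<open>E v\<close> shows that the
    derivatives of \<open>n\<close> are normal as well. This makes the first time derivative of the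
    metric vanish.\<close>
  have Dn: "D b u \<bullet> E v = 0" for b u v
  proof -
    have "((\<lambda>s. n (u + s *\<^sub>R b) \<bullet> E v) has_vector_derivative D b u \<bullet> E v) (at 0)"
      by (rule bounded_linear.has_vector_derivative[OF bounded_linear_inner_left dn])
    then have "((\<lambda>s. 0 :: real) has_vector_derivative D b u \<bullet> E v) (at 0)"
      by (simp add: n_def Yt_def normal)
    then show ?thesis by (metis vector_derivative_at vector_derivative_const_at)
  qed
  have c0: "continuous_on UNIV (\<lambda>u. f (u, 0))" if "smooth_on f S" for f :: "(real^'m) \<times> real
      \<Rightarrow> real^'n"
    by (intro continuous_on_compose2[OF smooth_on_continuous[OF that]] continuous_intros) (use z0 in auto)
  have contn: "continuous_on UNIV n" unfolding n_def by (rule c0[OF sYt])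
  have contD: "continuous_on UNIV (D b)" for b unfolding D_def by (rule c0[OF smooth_on_dirder[OF sYt]])
  have openK: "open (- K)" using K(1) by (simp add: compact_imp_closed open_Compl)
  have nK: "n u = 0" if "u \<notin> K" for u
    unfolding n_def Yt_def
  proof (rule dirder_eqI[OF sY z0])
    show "((\<lambda>s. Y ((u, 0) + s *\<^sub>R (0, 1))) has_vector_derivative 0) (at 0)"
      by (rule has_vector_derivative_transform_within_open[of "\<lambda>s. a + E u" _ _ J])
         (use J K(2)[OF that] in \<open>auto simp: J_def intro!: derivative_eq_intros\<close>)
  qed
  have DK: "D b u = 0" if "u \<notin> K" for b u
  proof -
    have "((\<lambda>s. n (u + s *\<^sub>R b)) has_vector_derivative 0) (at 0)"
    proof (rule has_vector_derivative_transform_within_open[of "\<lambda>s. 0" _ _ "(\<lambda>s. u + s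
        *\<^sub>R b) -` (- K)"])
      show "open ((\<lambda>s. u + s *\<^sub>R b) -` (- K))"
        by (rule open_vimage[OF openK]) (intro continuous_intros)
    qed (use that nK in \<open>auto intro!: derivative_eq_intros\<close>)
    then show ?thesis using dn[of u b] by (metis vector_derivative_at)
  qed
  define g where "g z = (\<chi> i j. Yi i z \<bullet> Yi j z)" for z
  have gj: "C2_jet S (\<lambda>z. g z $ i $ j)
      (\<lambda>z. Yi i z \<bullet> dirder (0, 1) (Yi j) z + dirder (0, 1) (Yi i) z \<bullet> Yi j z)
      (\<lambda>z. Yi i z \<bullet> dirder (0, 1) (dirder (0, 1) (Yi j)) z + 2 * (dirder (0, 1) (Yi i) z
          \<bullet> dirder (0, 1) (Yi j) z)
         + dirder (0, 1) (dirder (0, 1) (Yi i)) z \<bullet> Yi j z)" for i j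
    unfolding g_def using C2_jet_inner[OF C2_jet_smooth[OF sYi[of i]] C2_jet_smooth[OF sYi[of j]]] by simp
  have g0: "g (u, 0) = mat 1" for u
    by (simp add: g_def Yi0 E(2) inner_axis_orthonormal mat_def)
  obtain d1 d2 where d: "C2_jet S (\<lambda>z. det (g z)) d1 d2"
    and dv: "\<And>u. d1 (u, 0) = 0 \<and> d2 (u, 0) = (\<Sum>k\<in>UNIV. 2 * (norm (D (axis k 1) u))\<^sup>2)"
  proof -
    obtain d1 d2 where d: "C2_jet S (\<lambda>z. det (g z)) d1 d2" and
      v: "\<forall>z. g z = mat 1 \<and> (\<forall>i j. Yi i z \<bullet> dirder (0, 1) (Yi j) z + dirder
          (0, 1) (Yi i) z \<bullet> Yi j z = 0) \<longrightarrow>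
        d1 z = 0 \<and> d2 z = (\<Sum>k\<in>UNIV. Yi k z \<bullet> dirder (0, 1) (dirder (0, 1) (Yi k)) z
          + 2 * (dirder (0, 1) (Yi k) z \<bullet> dirder (0, 1) (Yi k) z)
         + dirder (0, 1) (dirder (0, 1) (Yi k)) z \<bullet> Yi k z)"
      using C2_jet_det[OF gj] by blast
    have Yit0: "dirder (0, 1) (Yi i) (u, 0) = D (axis i 1) u" for i u
      using Yit[OF z0] by (simp add: D_def)
    have "d1 (u, 0) = 0 \<and> d2 (u, 0) = (\<Sum>k\<in>UNIV. 2 * (norm (D (axis k 1) u))\<^sup>2)" for u
    proof -
      have "E v \<bullet> D b u = 0" for v b using Dn[of b u v] by (simp add: inner_commute)
      then show ?thesis
        using v[rule_format, of "(u, 0)"] by (simp add: g0 Yit0 Yitt Yi0 Dn power2_norm_eq_inner)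
    qed
    then show ?thesis using that d by blast
  qed
  have detpos: "0 < det (g z)" if "z \<in> S" for z
  proof -
    obtain u t where z: "z = (u, t)" by (cases z)
    have "(Y has_derivative frechet_derivative Y (at z)) (at z)"
      using smooth_on_differentiable[OF sY that] by (simp add: frechet_derivative_works)
    then have "linear (frechet_derivative Y (at z))" by (rule has_derivative_linear)
    moreover have "linear (\<lambda>v::real^'m. (v, 0 :: real))" by (rule linearI) simp_all
    ultimately have "linear (frechet_derivative Y (at z) \<circ> (\<lambda>v. (v, 0)))"
      by (rule linear_compose[rotated])
    then have "linear (\<lambda>v. dirder (v, 0) Y z)" by (simp only: dirder_def o_def)
    from det_gram_pos[OF this] imm[of t u] that show ?thesis
      by (simp add: g_def Yi_def z inS J_def)
  qed
  \<comment> \<open>The 2 from differentiating a product of coordinate fields twice is cancelled by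
    the derivative 1/2 of the square root at 1.\<close>
  obtain s1 s2 where s: "C2_jet S (\<lambda>z. sqrt (det (g z))) s1 s2"
    and sv: "\<And>u. s1 (u, 0) = 0 \<and> s2 (u, 0) = (\<Sum>k\<in>UNIV. (norm (D (axis k 1) u))\<^sup>2)"
  proof -
    obtain s1 s2 where s: "C2_jet S (\<lambda>z. sqrt (det (g z))) s1 s2" and
      v: "\<forall>z. det (g z) = 1 \<and> d1 z = 0 \<longrightarrow> s1 z = 0 \<and> s2 z = d2 z / 2"
      using C2_jet_sqrt[OF d detpos] by blast
    have "s1 (u, 0) = 0 \<and> s2 (u, 0) = (\<Sum>k\<in>UNIV. (norm (D (axis k 1) u))\<^sup>2)" for u
      using v[rule_format, of "(u, 0)"] dv[of u] by (simp add: g0 sum_distrib_left[symmetric])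
    then show ?thesis using that s by blast
  qed
  define w where "w z = - (1/2) * (norm (Y z - a))\<^sup>2" for z
  obtain w1 w2 where w: "C2_jet S w w1 w2"
    and wv: "\<And>u. w1 (u, 0) = 0 \<and> w2 (u, 0) = - (norm (n u))\<^sup>2"
  proof -
    note q = C2_jet_diff_const[OF C2_jet_smooth[OF sY], of a, folded Yt_def, folded Ytt_def]
    note r = C2_jet_mult[OF C2_jet_const[of S "- (1/2)"] C2_jet_inner[OF q q]]
    have wj: "C2_jet S w (\<lambda>z. - (Yt z \<bullet> (Y z - a))) (\<lambda>z. - (Ytt z \<bullet> (Y z -
        a) + Yt z \<bullet> Yt z))"
      using r by (simp add: w_def[abs_def] power2_norm_eq_inner inner_commute algebra_simps)
    \<comment> \<open>At time 0 the vector \<open>Y - a\<close> is \<open>E u\<close>, which is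
      tangent, while the velocity is normal. With the acceleration zero too, only the squared speed
      survives; it is the source of the negative term.\<close>
    have "Yt (u, 0) \<bullet> (Y (u, 0) - a) = 0" for u by (simp add: Y0 Yt_def normal)
    moreover have "Ytt (u, 0) = 0" for u by (simp add: Ytt_def Yt_def acc)
    ultimately show ?thesis by (intro that[OF wj]) (simp add: n_def power2_norm_eq_inner)
  qed
  have w0: "w (u, 0) = - (norm u)\<^sup>2 / 2" for u
    by (simp add: w_def Y0 power2_norm_eq_inner E(2))
  define I where "I z = exp (w z) * sqrt (det (g z))" for z
  obtain I1 I2 where Ij: "C2_jet S I I1 I2"
    and Iv: "\<And>u. I2 (u, 0) = exp (- (norm u)\<^sup>2 / 2) * ((\<Sum>k\<in>UNIV. (norm (D (axis k 1)
        u))\<^sup>2) - (norm (n u))\<^sup>2)"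
  proof -
    note r = C2_jet_mult[OF C2_jet_exp[OF w] s, folded I_def]
    show ?thesis
      by (rule that[OF r]) (simp add: wv sv w0 g0 algebra_simps)
  qed
  define I0 where "I0 u = exp (- (norm u)\<^sup>2 / 2)" for u :: "real^'m"
  have I0: "I (u, 0) = I0 u" for u by (simp add: I_def I0_def w0 g0)
  \<comment> \<open>Outside \<open>K\<close> points do not move. Since the complement of
    \<open>K\<close> is open, the space derivatives there also agree with those of the inclusion, so
    the whole integrand is frozen.\<close>
  have IK: "I (u, t) = I0 u" if u: "u \<notin> K" and t: "t \<in> J" for u t
  proof -
    have z: "(u, t) \<in> S" using t by (simp add: inS)
    have "Yi i (u, t) = E (axis i 1)" for i
      unfolding Yi_def
    proof (rule dirder_eqI[OF sY z])
      show "((\<lambda>s. Y ((u, t) + s *\<^sub>R (axis i 1, 0))) has_vector_derivative E (axis i 1)) (at 0)"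
      proof (rule has_vector_derivative_transform_within_open[of "\<lambda>s. a + E u + s *\<^sub>R E (axis
          i 1)" _ _ "(\<lambda>s. u + s *\<^sub>R axis i 1) -` (- K)"])
        show "open ((\<lambda>s. u + s *\<^sub>R axis i 1) -` (- K))"
          by (rule open_vimage[OF openK]) (intro continuous_intros)
        fix s assume "s \<in> (\<lambda>s. u + s *\<^sub>R axis i 1) -` (- K)"
        then show "a + E u + s *\<^sub>R E (axis i 1) = Y ((u, t) + s *\<^sub>R (axis i 1, 0))"
          using K(2) t by (simp add: linear_add[OF E(1)] linear_scale[OF E(1)] J_def)
      qed (use u in \<open>auto intro!: derivative_eq_intros\<close>)
    qed
    then have "g (u, t) = mat 1" by (simp add: g_def E(2) inner_axis_orthonormal mat_def)
    moreover have "w (u, t) = - (norm u)\<^sup>2 / 2"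
      using K(2)[OF u] t by (simp add: w_def power2_norm_eq_inner E(2) J_def)
    ultimately show ?thesis by (simp add: I_def I0_def)
  qed
  obtain l r where lr: "K \<subseteq> cbox l r" using compact_imp_bounded[OF K(1)]
      bounded_subset_cbox_symmetric by metis
  let ?V = "\<lambda>t. enn2real (\<integral>\<^sup>+u. ennreal (I (u, t)) \<partial>lborel)"
  have intI0: "integrable lborel I0" unfolding I0_def by (rule integrable_exp_norm)
  have contI: "continuous_on UNIV (\<lambda>u. I (u, t))" if "t \<in> J" for t
  proof (rule continuous_on_compose2[of S I UNIV "\<lambda>u. (u, t)"])
    show "continuous_on S I" using Ij by (simp add: C2_jet_def)
    show "continuous_on UNIV (\<lambda>u::real^'m. (u, t))" by (intro continuous_intros)
  qed (use that in \<open>auto simp: inS\<close>)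
  \<comment> \<open>The Gaussian mass outside the box, common to all times because \<open>K\<close>
    lies in the box.\<close>
  define C0 where "C0 = (\<integral>u. I0 u \<partial>lborel) - integral (cbox l r) I0"
  have cI0: "continuous_on UNIV I0" using contI[of 0] J by (simp add: I0)
  have VI: "?V t = C0 + integral (cbox l r) (\<lambda>u. I (u, t))" if t: "t \<in> J" for t
  proof -
    have [measurable]: "(\<lambda>u. I (u, t)) \<in> borel_measurable borel"
      by (rule borel_measurable_continuous_onI[OF contI[OF t]])
    have cd: "continuous_on (cbox l r) (\<lambda>u. I (u, t) - I0 u)"
      by (intro continuous_intros continuous_on_subset[OF contI[OF t]] continuous_on_subset[OF cI0]) auto
    have si: "set_integrable lborel (cbox l r) (\<lambda>u. I (u, t) - I0 u)"
      unfolding set_integrable_def by (rule borel_integrable_compact[OF _ cd]) simp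
    \<comment> \<open>Integrability over the whole space is obtained from a fixed Gaussian plus a
      continuous difference that lives in the box.\<close>
    have eq: "I (u, t) = I0 u + indicator (cbox l r) u *\<^sub>R (I (u, t) - I0 u)" for u
      using IK[OF _ t, of u] lr by (auto simp: indicator_def)
    have "0 \<le> I (u, t)" for u
      using detpos[of "(u, t)"] t by (simp add: I_def inS)
    then have "?V t = (\<integral>u. I (u, t) \<partial>lborel)"
      by (intro integral_eq_nn_integral[symmetric]) auto
    also have "\<dots> = (\<integral>u. I0 u + indicator (cbox l r) u *\<^sub>R (I (u, t) - I0 u) \<partial>lborel)"
      by (rule Bochner_Integration.integral_cong[OF refl eq])
    also have "\<dots> = (\<integral>u. I0 u \<partial>lborel) + integral (cbox l r) (\<lambda>u. I (u, t) - I0 u)"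
      using intI0 si set_borel_integral_eq_integral(2)[OF si]
      by (simp add: set_integrable_def set_lebesgue_integral_def)
    also have "integral (cbox l r) (\<lambda>u. I (u, t) - I0 u) = integral (cbox l r) (\<lambda>u. I (u,
        t)) - integral (cbox l r) I0"
      by (intro Henstock_Kurzweil_Integration.integral_diff integrable_continuous continuous_on_subset[OF
          contI[OF t]] continuous_on_subset[OF cI0]) auto
    finally show ?thesis by (simp add: C0_def)
  qed
  note Ij' = Ij[unfolded S_def]
  have "second_derivative_nonneg_at_0 ?V"
    unfolding second_derivative_nonneg_at_0_def
  proof (intro exI conjI)
    show "\<forall>\<^sub>F t in nhds 0. (?V has_real_derivative integral (cbox l r) (\<lambda>u. I1 (u, t))) (at t)"
    proof (rule eventually_nhds[THEN iffD2], intro exI conjI ballI)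
      show "open J" "0 \<in> J" by (rule J)+
      fix t assume t: "t \<in> J"
      have "((\<lambda>t. C0 + integral (cbox l r) (\<lambda>u. I (u, t))) has_real_derivative 0 + integral
          (cbox l r) (\<lambda>u. I1 (u, t))) (at t)"
        by (intro DERIV_add DERIV_const C2_jet_integral(1)[OF Ij' J(1,2) t])
      then have "((\<lambda>t. C0 + integral (cbox l r) (\<lambda>u. I (u, t))) has_real_derivative
          integral (cbox l r) (\<lambda>u. I1 (u, t))) (at t)"
        by simp
      then show "(?V has_real_derivative integral (cbox l r) (\<lambda>u. I1 (u, t))) (at t)"
        by (rule DERIV_cong_ev[THEN iffD1, OF refl _ refl, rotated])
           (use VI J(1) t in \<open>auto simp: eventually_nhds intro!: exI[of _ J]\<close>)
    qed
    show "((\<lambda>t. integral (cbox l r) (\<lambda>u. I1 (u, t))) has_real_derivative integral (cbox l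
        r) (\<lambda>u. I2 (u, 0))) (at 0)"
      by (rule C2_jet_integral(2)[OF Ij' J])
    define Z where "Z u = exp (- (norm u)\<^sup>2 / 2) * ((\<Sum>b\<in>Basis. (norm (D b u))\<^sup>2) -
        (norm (n u))\<^sup>2)" for u
    have "(\<Sum>b\<in>Basis. f b) = (\<Sum>k\<in>UNIV. f (axis k 1))" for f :: "real^'m \<Rightarrow> real"
      by (subst sum.reindex[of "\<lambda>k. axis k 1" UNIV f, symmetric, unfolded o_def])
         (auto simp: Basis_vec_def inj_on_def axis_eq_axis intro!: sum.cong)
    then have I2Z: "I2 (u, 0) = Z u" for u by (simp add: Iv Z_def)
    have "0 \<le> (\<integral>u. Z u \<partial>lborel)"
      unfolding Z_def
    proof (rule gaussian_stability[OF dn contn contD K(1) nK DK])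
      show "(\<integral>u. exp (- (norm u)\<^sup>2 / 2) * (n u \<bullet> c) \<partial>lborel) = 0" for c
        using mean[of c] by (simp add: n_def Yt_def)
    qed
    \<comment> \<open>The Gaussian inequality concerns the whole space, the differentiation only the
      box. Both integrals agree because \<open>Z\<close> vanishes off \<open>K\<close>.\<close>
    also have "(\<integral>u. Z u \<partial>lborel) = (\<integral>u. indicator (cbox l r) u *\<^sub>R Z u
        \<partial>lborel)"
    proof (rule Bochner_Integration.integral_cong[OF refl])
      have Z0: "Z u = 0" if "u \<notin> cbox l r" for u
      proof -
        have "u \<notin> K" using that lr by blast
        then show ?thesis by (simp add: Z_def nK DK)
      qed
      show "Z u = indicator (cbox l r) u *\<^sub>R Z u" for u using Z0[of u] by (cases "u \<in> cbox l r") simp_all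
    qed
    also have "\<dots> = integral (cbox l r) Z"
    proof -
      have "continuous_on UNIV Z" unfolding Z_def
        by (intro continuous_intros contn contD) simp_all
      then have "continuous_on (cbox l r) Z" by (rule continuous_on_subset) simp
      then have "set_integrable lborel (cbox l r) Z"
        unfolding set_integrable_def by (rule borel_integrable_compact[OF compact_cbox])
      from set_borel_integral_eq_integral(2)[OF this] show ?thesis by (simp add: set_lebesgue_integral_def)
    qed
    finally show "0 \<le> integral (cbox l r) (\<lambda>u. I2 (u, 0))" by (simp add: I2Z)
  qed
  then show ?thesis by (simp add: I_def w_def g_def Yi_def)
qed

section \<open>Affine planes\<close>

text \<open>The Gram matrix changes by congruence with \<open>matrix T\<close>. The square root of
  the resulting factor is what compensates the Jacobian in a change of chart.\<close>

lemma det_gram_compose: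
  fixes L :: "real^'m \<Rightarrow> 'a::real_inner" and T :: "real^'m \<Rightarrow> real^'m"
  assumes L: "linear L"
  shows "det (\<chi> i j. L (T (axis i 1)) \<bullet> L (T (axis j 1))) =
    (det (matrix T))\<^sup>2 * det (\<chi> i j. L (axis i 1) \<bullet> L (axis j 1))"
proof -
  have LT: "L (T v) = (\<Sum>k\<in>UNIV. T v $ k *\<^sub>R L (axis k 1))" for v
  proof -
    have "L (T v) = L (\<Sum>k\<in>UNIV. T v $ k *\<^sub>R axis k 1)"
      using basis_expansion[of "T v"] by (simp add: scalar_mult_eq_scaleR)
    then show ?thesis by (simp add: linear_sum[OF L] linear_scale[OF L])
  qed
  have "(\<chi> i j. L (T (axis i 1)) \<bullet> L (T (axis j 1))) =
    transpose (matrix T) ** ((\<chi> i j. L (axis i 1) \<bullet> L (axis j 1)) ** matrix T)"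
    by (simp add: LT vec_eq_iff matrix_matrix_mult_def transpose_def matrix_def
        inner_sum_left inner_sum_right sum_distrib_left mult_ac)
       (intro allI, subst sum.swap, rule refl)
  then show ?thesis by (simp add: det_mul det_transpose power2_eq_square)
qed

lemma second_countable_euclidean:
  "second_countable (euclidean :: 'a::second_countable_topology topology)"
proof -
  obtain B :: "'a set set" where "countable B" "topological_basis B"
    using ex_countable_basis by blast
  then show ?thesis
    unfolding second_countable_def by (metis open_openin topological_basisE topological_basis_open)
qed

text \<open>\<open>a\<close> is the foot of the perpendicular from the origin, that is, the constant
  xi of the plane. Since \<open>a\<close> is orthogonal to the range of \<open>E\<close>, its image
  under \<open>adjoint E\<close> is 0, so the linear map \<open>adjoint E\<close> inverts the affine
  parametrisation without a shift.\<close>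

locale isometric_plane =
  fixes a :: "real^'n" and E :: "real^'m \<Rightarrow> real^'n" and P :: "(real^'n) set"
  assumes linear_E: "linear E" and inner_E: "\<And>u v. E u \<bullet> E v = u \<bullet> v"
    and orth: "\<And>v. a \<bullet> E v = 0" and P_eq: "P = range (\<lambda>u. a + E u)"
begin

definition chart0 :: "(real^'n, 'm) chart" where "chart0 = (P, adjoint E)"

lemma adjoint_param [simp]: "adjoint E (a + E u) = u"
proof -
  have "adjoint E (a + E u) \<bullet> v = u \<bullet> v" for v
    by (simp add: adjoint_works[OF linear_E] adjoint_clauses(2)[OF linear_E] inner_add_left orth inner_E)
  then show ?thesis by (metis vector_eq_rdot)
qed

lemma in_P [simp]: "a + E u \<in> P"
  by (auto simp: P_eq)

lemma P_cases: "q \<in> P \<Longrightarrow> (\<And>u. q = a + E u \<Longrightarrow> thesis) \<Longrightarrow> thesis"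
  by (auto simp: P_eq)

lemma bounded_linear_E: "bounded_linear E"
  using linear_E by (simp add: linear_conv_bounded_linear)

lemma inj_E: "inj E"
  using linear_inj_iff_eq_0[OF linear_E] inner_E by (metis inner_eq_zero_iff)

lemma cont_param: "continuous_on S (\<lambda>u. a + E u)"
  by (intro continuous_intros linear_continuous_on bounded_linear_E)

lemma chart0_in_atlas: "chart0 \<in> plane_atlas P"
proof -
  have "bij_betw (\<lambda>q. adjoint E q + 0) P UNIV"
    by (rule bij_betw_byWitness[where f'="\<lambda>u. a + E u"]) (auto elim: P_cases)
  then show ?thesis
    unfolding plane_atlas_def chart0_def using adjoint_linear[OF linear_E] by force
qed

text \<open>Every chart of the atlas differs from the isometric one by an affine bijection of the
  parameter space. Claims about all charts thereby reduce to \<open>chart0\<close> and a linear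
  substitution.\<close>

lemma chartE:
  fixes c :: "(real^'n, 'm) chart"
  assumes "c \<in> plane_atlas P"
  obtains T T' d where "linear T" "linear T'" "\<And>u. T' (T u) = u" "\<And>u. T (T' u) = u"
    "fst c = P" "\<And>u. snd c (a + E u) = T u + d"
    "\<And>h u. in_chart c h u = (h (a + E (T' (u - d))) :: 'b)"
proof -
  obtain L b where c: "c = (P, \<lambda>q. L q + b)" and L: "linear L" and bij: "bij_betw (\<lambda>q. L q
      + b) P UNIV"
    using assms by (auto simp: plane_atlas_def)
  define T where "T = (\<lambda>u. L (E u))"
  define d where "d = L a + b"
  have T: "linear T" unfolding T_def using linear_compose[OF linear_E L] by (simp add: o_def)
  have snd: "snd c (a + E u) = T u + d" for u
    by (simp add: c T_def d_def linear_add[OF L])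
  have "inj T"
  proof (rule injI)
    fix u v assume "T u = T v"
    then have "snd c (a + E u) = snd c (a + E v)" by (simp add: snd)
    moreover have "inj_on (snd c) P" using bij by (simp add: c bij_betw_def)
    ultimately have "a + E u = a + E v" using inj_onD[of "snd c" P "a + E u" "a + E v"] by simp
    then show "u = v" using inj_E by (auto dest: injD)
  qed
  then obtain T' where T': "linear T'" "T' \<circ> T = id"
    using linear_injective_left_inverse[OF T] by auto
  have "T \<circ> T' = id" using linear_inverse_left[OF T T'(1)] T'(2) by simp
  have inv: "inv_into P (snd c) u = a + E (T' (u - d))" for u
  proof (rule inv_into_f_eq)
    show "inj_on (snd c) P" using bij by (simp add: c bij_betw_def)
    show "snd c (a + E (T' (u - d))) = u" using \<open>T \<circ> T' = id\<close> by (simp add: snd fun_eq_iff)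
  qed simp
  show ?thesis
    by (rule that[OF T T'(1), of d])
       (use T'(2) \<open>T \<circ> T' = id\<close> snd inv in \<open>simp_all add: fun_eq_iff c in_chart_def\<close>)
qed

lemma in_chart0: "in_chart chart0 h u = h (a + E u)"
proof -
  have "inv_into P (adjoint E) u = a + E u"
    by (rule inv_into_f_eq) (auto intro!: inj_onI elim!: P_cases)
  then show ?thesis by (simp add: in_chart_def chart0_def)
qed

lemma frechet_in_chart:
  fixes y :: "real^'n \<Rightarrow> 'b::real_normed_vector"
  assumes T: "linear T'" and ic: "\<And>u. in_chart c y u = y (a + E (T' (u - d)))"
    and diff: "(\<lambda>u. y (a + E u)) differentiable (at (T' (u - d)))"
  shows "frechet_derivative (in_chart c y) (at u) = (\<lambda>v. frechet_derivative (\<lambda>u. y (a + E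
      u)) (at (T' (u - d))) (T' v))"
proof -
  have bl: "bounded_linear T'" using T by (simp add: linear_conv_bounded_linear)
  have "((\<lambda>u. T' (u - d)) has_derivative T') (at u)"
    by (rule bounded_linear.has_derivative[OF bl, of "\<lambda>u. u - d" "\<lambda>v. v"])
       (auto intro!: derivative_eq_intros)
  moreover have "((\<lambda>u. y (a + E u)) has_derivative frechet_derivative (\<lambda>u. y (a + E u)) (at
      (T' (u - d)))) (at (T' (u - d)))"
    using diff by (simp add: frechet_derivative_works)
  ultimately have "((\<lambda>u. y (a + E (T' (u - d)))) has_derivative
      (\<lambda>v. frechet_derivative (\<lambda>u. y (a + E u)) (at (T' (u - d))) (T' v))) (at u)"
    by (rule has_derivative_compose)
  moreover have "in_chart c y = (\<lambda>u. y (a + E (T' (u - d))))" using ic by (simp add: fun_eq_iff)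
  ultimately show ?thesis by (metis frechet_derivative_at)
qed

lemma gram_chart0: "gram chart0 y (a + E u) =
    (\<chi> i j. frechet_derivative (\<lambda>u. y (a + E u)) (at u) (axis i 1) \<bullet>
        frechet_derivative (\<lambda>u. y (a + E u)) (at u) (axis j 1))"
proof -
  have "in_chart chart0 y = (\<lambda>u. y (a + E u))" by (simp add: in_chart0 fun_eq_iff)
  then show ?thesis by (simp add: gram_def pder_def chart0_def)
qed

section \<open>The induced measure on the plane\<close>

abbreviation borel_P :: "(real^'n) measure" where
  "borel_P \<equiv> sigma P {U. openin (top_of_set P) U}"

lemma sets_borel_P: "sets borel_P = borel_sets_of (top_of_set P)"
  unfolding borel_sets_of_def by (subst sets_measure_of) (auto dest: openin_imp_subset)

lemma space_borel_P: "space borel_P = P"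
  by (rule space_measure_of) (auto dest: openin_imp_subset)

lemma param_measurable: "(\<lambda>u. a + E u) \<in> borel \<rightarrow>\<^sub>M borel_P"
proof (rule measurable_measure_of)
  show "{U. openin (top_of_set P) U} \<subseteq> Pow P" by (auto dest: openin_imp_subset)
  fix U assume "U \<in> {U. openin (top_of_set P) U}"
  then obtain V where V: "open V" "U = P \<inter> V" by (auto simp: openin_open)
  have "(\<lambda>u. a + E u) -` U = (\<lambda>u. a + E u) -` V" using V by auto
  then show "(\<lambda>u. a + E u) -` U \<inter> space borel \<in> sets borel"
    using open_vimage[OF V(1) cont_param] by simp
qed simp

text \<open>On \<open>P\<close> the function is its coordinate expression composed with the
  continuous map \<open>adjoint E\<close>, so it is continuous there and preimages of open sets are
  relatively open.\<close>

lemma measurable_borel_P: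
  fixes f :: "real^'n \<Rightarrow> 'b::topological_space"
  assumes "continuous_on UNIV (\<lambda>u. f (a + E u))"
  shows "f \<in> borel_measurable borel_P"
proof (rule borel_measurableI)
  fix V :: "'b set" assume V: "open V"
  have adj: "continuous_on P (adjoint E)"
    using adjoint_linear[OF linear_E] by (simp add: linear_continuous_on linear_conv_bounded_linear)
  have "continuous_on P (\<lambda>q. f (a + E (adjoint E q)))"
    using continuous_on_compose2[OF assms adj] by simp
  then have "continuous_on P f"
    by (rule continuous_on_eq) (auto elim: P_cases)
  then have "openin (top_of_set P) (P \<inter> f -` V)"
    using V by (simp add: continuous_openin_preimage_gen)
  then show "f -` V \<inter> space borel_P \<in> sets borel_P"
    unfolding space_borel_P sets_borel_P borel_sets_of_def by (auto simp: Int_commute intro!: sigma_sets.Basic)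
qed

text \<open>Resolves the definite description. The push-forward of the area density satisfies the
  defining formula in every chart by the affine change of variables; a measure satisfying it is
  unique because the domain of \<open>chart0\<close> is already all of \<open>P\<close>.\<close>

lemma volume_measure_eq:
  fixes y :: "real^'n \<Rightarrow> real^'k"
  assumes diff: "\<And>u. (\<lambda>u. y (a + E u)) differentiable (at u)"
    and cont: "continuous_on UNIV (\<lambda>u. det (gram chart0 y (a + E u)))"
  shows "volume_measure (top_of_set P) (plane_atlas P :: (real^'n, 'm) chart set) y =
    distr (density lborel (\<lambda>u. ennreal (sqrt (det (gram chart0 y (a + E u)))))) borel_P (\<lambda>u. a + E u)"
    (is "_ = ?\<mu>")
  unfolding volume_measure_def
proof (rule the_equality)
  let ?W = "\<lambda>u. ennreal (sqrt (det (gram chart0 y (a + E u))))"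
  have [measurable]: "(\<lambda>u. det (gram chart0 y (a + E u))) \<in> borel_measurable borel"
    by (rule borel_measurable_continuous_onI[OF cont])
  note [measurable] = param_measurable
  have em: "emeasure ?\<mu> B = (\<integral>\<^sup>+u. ?W u * indicator B (a + E u) \<partial>lborel)" if
      "B \<in> borel_sets_of (top_of_set P)" for B
  proof -
    have [measurable]: "B \<in> sets borel_P" using that by (simp add: sets_borel_P)
    have [measurable]: "(\<lambda>u. a + E u) -` B \<in> sets borel"
      using measurable_sets[OF param_measurable, of B] by simp
    have "emeasure ?\<mu> B = (\<integral>\<^sup>+u. ?W u * indicator ((\<lambda>u. a + E u) -` B) u
        \<partial>lborel)"
      by (subst emeasure_distr) (auto simp: emeasure_density)
    then show ?thesis by (simp add: indicator_def cong: if_cong)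
  qed
  have chart: "emeasure ?\<mu> B = (\<integral>\<^sup>+u\<in>snd c ` B. ennreal (sqrt (det (in_chart c
      (gram c y) u))) \<partial>lborel)"
    if c: "c \<in> plane_atlas P" and B: "B \<in> borel_sets_of (top_of_set P)" and BP: "B \<subseteq> P"
    for c :: "(real^'n, 'm) chart" and B
  proof -
    obtain T T' d where T: "linear T" "linear T'" "\<And>u. T' (T u) = u" "\<And>u. T (T' u) = u"
      and snd: "\<And>u. snd c (a + E u) = T u + d"
      and ic: "\<And>h u. in_chart c h u = (h (a + E (T' (u - d))) :: real^'k)"
      by (rule chartE[OF c]) blast
    \<comment> \<open>An application of \<open>chartE\<close> fixes the value type of
      \<open>h\<close>, so matrix-valued functions need a second one. Its transition map is matched
      with the first by comparing the two descriptions of \<open>snd c\<close>.\<close>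
    have icg: "in_chart c h u = h (a + E (T' (u - d)))" for h :: "_ \<Rightarrow> real^'m^'m" and u
    proof -
      obtain S S' e where S: "linear S" "linear S'" "\<And>u. S' (S u) = u"
        and snd': "\<And>u. snd c (a + E u) = S u + e"
        and ic': "\<And>h u. in_chart c h u = (h (a + E (S' (u - e))) :: real^'m^'m)"
        by (rule chartE[OF c]) blast
      have "S (T' (u - d)) + e = u" using snd[of "T' (u - d)"] snd'[of "T' (u - d)"] T(4) by simp
      then have "S' (u - e) = T' (u - d)" using S(3)[of "T' (u - d)"] by (metis add_diff_cancel_right')
      then show ?thesis by (simp add: ic')
    qed
    have injT: "inj T" using T(3) by (metis injI)
    \<comment> \<open>The substitution contributes \<bar>det T\<bar> and the square root of the Gram
      determinant contributes \<bar>det T'\<bar>; their product being 1 makes the volume independent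
      of the chart.\<close>
    have detT: "\<bar>det (matrix T)\<bar> * \<bar>det (matrix T')\<bar> = 1"
    proof -
      have "matrix T ** matrix T' = mat 1"
        using matrix_compose[OF T(2,1)] T(4) by (simp add: o_def matrix_id_mat_1[unfolded id_def])
      then show ?thesis by (metis abs_mult abs_one det_I det_mul)
    qed
    have dg: "det (in_chart c (gram c y) (T u + d)) = (det (matrix T'))\<^sup>2 * det (gram chart0 y (a + E u))" for u
    proof -
      have "frechet_derivative (in_chart c y) (at (snd c (a + E u))) = (\<lambda>v. frechet_derivative
          (\<lambda>u. y (a + E u)) (at u) (T' v))"
        using frechet_in_chart[OF T(2) ic diff, of "T u + d"] by (simp add: snd T(3))
      then have "gram c y (a + E u) = (\<chi> i j. frechet_derivative (\<lambda>u. y (a + E u)) (at u) (T'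
          (axis i 1)) \<bullet>
          frechet_derivative (\<lambda>u. y (a + E u)) (at u) (T' (axis j 1)))"
        by (simp add: gram_def pder_def)
      moreover have "linear (frechet_derivative (\<lambda>u. y (a + E u)) (at u))"
        using diff[of u] by (simp add: frechet_derivative_works has_derivative_linear)
      ultimately show ?thesis by (simp add: icg T(3) det_gram_compose gram_chart0)
    qed
    define f where "f x = ennreal (sqrt (det (in_chart c (gram c y) x))) * indicator (snd c ` B) x" for x
    have ind: "indicator (snd c ` B) (T u + d) = (indicator B (a + E u) :: ennreal)" for u
    proof -
      have "T u + d \<in> snd c ` B \<longleftrightarrow> a + E u \<in> B"
      proof
        assume "T u + d \<in> snd c ` B"
        then obtain v where v: "a + E v \<in> B" "T u + d = snd c (a + E v)" using BP by (force elim: P_cases)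
        then have "T u = T v" by (simp add: snd)
        then show "a + E u \<in> B" using v(1) injT by (auto dest: injD)
      next
        assume "a + E u \<in> B"
        then show "T u + d \<in> snd c ` B" using snd[of u] by (metis imageI)
      qed
      then show ?thesis by (simp add: indicator_def)
    qed
    have fT: "f (T u + d) = ennreal \<bar>det (matrix T')\<bar> * (?W u * indicator B (a + E u))" for u
      by (simp add: f_def ind dg real_sqrt_mult ennreal_mult' mult.assoc)
    have cT': "continuous_on UNIV (\<lambda>x. T' (x - d))"
      using T(2) by (intro continuous_on_compose2[OF linear_continuous_on[of T' UNIV]] continuous_intros)
         (simp_all add: linear_conv_bounded_linear)
    have fm: "f \<in> borel_measurable borel"
    proof -
      have "f x = ennreal \<bar>det (matrix T')\<bar> * (?W (T' (x - d)) * indicator B (a + E (T' (x - d))))" for x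
        using fT[of "T' (x - d)"] by (simp add: T(4))
      moreover have [measurable]: "(\<lambda>x. T' (x - d)) \<in> borel_measurable borel"
        by (rule borel_measurable_continuous_onI[OF cT'])
      moreover have [measurable]: "B \<in> sets borel_P" using B by (simp add: sets_borel_P)
      ultimately show ?thesis by (simp cong: measurable_cong)
    qed
    have "(\<integral>\<^sup>+u\<in>snd c ` B. ennreal (sqrt (det (in_chart c (gram c y) u)))
        \<partial>lborel) = (\<integral>\<^sup>+x. f x \<partial>lborel)"
      by (simp add: f_def)
    also have "\<dots> = ennreal \<bar>det (matrix T)\<bar> * (\<integral>\<^sup>+u. f (T u + d) \<partial>lborel)"
      by (rule nn_integral_lborel_affine[OF T(1) injT fm])
    also have "(\<integral>\<^sup>+u. f (T u + d) \<partial>lborel) = ennreal \<bar>det (matrix T')\<bar> *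
        emeasure ?\<mu> B"
    proof -
      have [measurable]: "B \<in> sets borel_P" using B by (simp add: sets_borel_P)
      have "(\<lambda>u. ?W u * indicator B (a + E u)) \<in> borel_measurable lborel" by measurable
      then show ?thesis unfolding fT em[OF B] by (rule nn_integral_cmult)
    qed
    also have "ennreal \<bar>det (matrix T)\<bar> * \<dots> = emeasure ?\<mu> B"
      by (simp add: mult.assoc[symmetric] ennreal_mult'[symmetric] detT)
    finally show ?thesis by simp
  qed
  show "space ?\<mu> = topspace (top_of_set P) \<and> sets ?\<mu> = borel_sets_of (top_of_set P) \<and>
        (\<forall>c\<in>(plane_atlas P :: (real^'n, 'm) chart set). \<forall>B\<in>borel_sets_of
            (top_of_set P). B \<subseteq> fst c \<longrightarrow>
           emeasure ?\<mu> B = (\<integral>\<^sup>+u\<in>snd c ` B. ennreal (sqrt (det (in_chart c (gram c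
               y) u))) \<partial>lborel))"
  proof (intro conjI ballI impI)
    fix c :: "(real^'n, 'm) chart" and B
    assume "c \<in> plane_atlas P" "B \<in> borel_sets_of (top_of_set P)" "B \<subseteq> fst c"
    moreover from this have "fst c = P" by (auto simp: plane_atlas_def)
    ultimately show "emeasure ?\<mu> B = (\<integral>\<^sup>+u\<in>snd c ` B. ennreal (sqrt (det (in_chart
        c (gram c y) u))) \<partial>lborel)"
      using chart by simp
  qed (simp_all only: space_distr sets_distr space_borel_P sets_borel_P topspace_euclidean_subtopology)
  fix \<nu> assume \<nu>: "space \<nu> = topspace (top_of_set P) \<and> sets \<nu> = borel_sets_of
      (top_of_set P) \<and>
        (\<forall>c\<in>(plane_atlas P :: (real^'n, 'm) chart set). \<forall>B\<in>borel_sets_of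
            (top_of_set P). B \<subseteq> fst c \<longrightarrow>
           emeasure \<nu> B = (\<integral>\<^sup>+u\<in>snd c ` B. ennreal (sqrt (det (in_chart c (gram c
               y) u))) \<partial>lborel))"
  show "\<nu> = ?\<mu>"
  proof (rule measure_eqI)
    show "sets \<nu> = sets ?\<mu>" using \<nu> by (simp add: sets_borel_P)
    fix B assume "B \<in> sets \<nu>"
    then have B: "B \<in> borel_sets_of (top_of_set P)" using \<nu> by simp
    then have BP: "B \<subseteq> P" using sets.sets_into_space[of B borel_P] by (simp add: sets_borel_P space_borel_P)
    \<comment> \<open>Every Borel set lies in the domain of \<open>chart0\<close>, so the formula in
      this single chart determines \<open>\<nu>\<close> completely.\<close>
    show "emeasure \<nu> B = emeasure ?\<mu> B"
      using \<nu> chart[OF chart0_in_atlas B BP] chart0_in_atlas B BP by (simp add: chart0_def)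
  qed
qed

end

lemma second_derivative_nonneg_at_0_cong:
  assumes f: "second_derivative_nonneg_at_0 f" and J: "open J" "0 \<in> J" and eq: "\<And>t. t \<in> J
      \<Longrightarrow> f t = g t"
  shows "second_derivative_nonneg_at_0 g"
proof -
  obtain v d where v: "\<forall>\<^sub>F t in nhds 0. (f has_real_derivative v t) (at t)"
    and d: "(v has_real_derivative d) (at 0)" "d \<ge> 0"
    using f by (auto simp: second_derivative_nonneg_at_0_def)
  have "\<forall>\<^sub>F t in nhds 0. t \<in> J" using J by (rule eventually_nhds_in_open)
  with v have "\<forall>\<^sub>F t in nhds 0. (g has_real_derivative v t) (at t)"
  proof eventually_elim
    case (elim t)
    then show ?case
      using has_field_derivative_transform_within_open[of f "v t" t J g] J eq by blast
  qed
  then show ?thesis using d unfolding second_derivative_nonneg_at_0_def by blast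
qed

lemma frechet_derivative_slice:
  fixes Y :: "'a::real_normed_vector \<times> real \<Rightarrow> 'b::real_normed_vector"
  assumes "Y differentiable (at (u, t))"
  shows "(\<lambda>u. Y (u, t)) differentiable (at u)"
    and "frechet_derivative (\<lambda>u. Y (u, t)) (at u) = (\<lambda>v. dirder (v, 0) Y (u, t))"
proof -
  have "((\<lambda>u. (u, t)) has_derivative (\<lambda>v. (v, 0))) (at u)"
    by (auto intro!: derivative_eq_intros)
  moreover have "(Y has_derivative frechet_derivative Y (at (u, t))) (at (u, t))"
    using assms by (simp add: frechet_derivative_works)
  ultimately have *: "((\<lambda>u. Y (u, t)) has_derivative (\<lambda>v. frechet_derivative Y (at (u, t))
      (v, 0))) (at u)"
    by (rule has_derivative_compose)
  then show "(\<lambda>u. Y (u, t)) differentiable (at u)" by (auto simp: differentiable_def)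
  show "frechet_derivative (\<lambda>u. Y (u, t)) (at u) = (\<lambda>v. dirder (v, 0) Y (u, t))"
    using frechet_derivative_at[OF *] by (simp add: dirder_def)
qed

context isometric_plane
begin

section \<open>The inclusion of the plane as a xi-submanifold\<close>

lemma chart_image:
  fixes c :: "(real^'n, 'm) chart"
  assumes "c \<in> plane_atlas P"
  shows "fst c = P" "snd c ` P = UNIV"
  using assms by (auto simp: plane_atlas_def bij_betw_def)

lemma in_chart_affine:
  fixes c :: "(real^'n, 'm) chart"
  assumes "c \<in> plane_atlas P"
  obtains p T where "linear T" "surj T" "in_chart c (\<lambda>q. q) = (\<lambda>u. p + E (T u))"
proof -
  obtain T T' d where T: "linear T" "linear T'" "\<And>u. T' (T u) = u"
    "\<And>h u. in_chart c h u = (h (a + E (T' (u - d))) :: real^'n)"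
    by (rule chartE[OF assms]) blast
  show ?thesis
  proof (rule that[OF T(2)])
    show "surj T'" using T(3) by (metis surjI)
    show "in_chart c (\<lambda>q. q) = (\<lambda>u. (a - E (T' d)) + E (T' u))"
      by (simp add: T(4) fun_eq_iff linear_diff[OF T(2)] linear_diff[OF linear_E])
  qed
qed

lemma smooth_map_inclusion: "smooth_map (plane_atlas P :: (real^'n, 'm) chart set) (\<lambda>q. q)"
  unfolding smooth_map_def case_prod_beta
proof
  fix c :: "(real^'n, 'm) chart" assume c: "c \<in> plane_atlas P"
  obtain p T where T: "linear T" and ic: "in_chart c (\<lambda>q. q) = (\<lambda>u. p + E (T u))"
    by (rule in_chart_affine[OF c])
  have "bounded_linear (\<lambda>u. E (T u))"
    using linear_compose[OF T linear_E] by (simp add: linear_conv_bounded_linear o_def)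
  from smooth_on_affine[OF this] show "smooth_on (in_chart (fst c, snd c) (\<lambda>q. q)) (snd c ` fst c)"
    by (simp add: ic)
qed

lemma frechet_inclusion:
  fixes c :: "(real^'n, 'm) chart"
  assumes "c \<in> plane_atlas P"
  obtains T where "linear T" "surj T" "\<And>u. frechet_derivative (in_chart c (\<lambda>q. q)) (at u) =
      (\<lambda>v. E (T v))"
proof -
  obtain p T where T: "linear T" "surj T" and ic: "in_chart c (\<lambda>q. q) = (\<lambda>u. p + E (T u))"
    by (rule in_chart_affine[OF assms])
  have "bounded_linear (\<lambda>u. E (T u))"
    using linear_compose[OF T(1) linear_E] by (simp add: linear_conv_bounded_linear o_def)
  from frechet_derivative_affine[OF this] show ?thesis using that[OF T] by (simp add: ic)
qed

lemma smooth_manifold_plane: "smooth_manifold (top_of_set P) (plane_atlas P :: (real^'n, 'm) chart set)"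
  unfolding smooth_manifold_def case_prod_beta
proof (intro conjI ballI)
  show "Hausdorff_space (top_of_set P)"
    by (simp add: Hausdorff_space_subtopology)
  show "second_countable (top_of_set P)"
    by (simp add: second_countable_subtopology second_countable_euclidean)
  show "(\<Union>c\<in>(plane_atlas P :: (real^'n, 'm) chart set). fst c) = topspace (top_of_set P)"
    using chart0_in_atlas chart_image(1) by (auto simp: chart0_def)
  fix c :: "(real^'n, 'm) chart" assume c: "c \<in> plane_atlas P"
  note im = chart_image[OF c]
  show "openin (top_of_set P) (fst c)" "open (snd c ` fst c)" by (simp_all add: im)
  obtain T T' d where T: "linear T" "linear T'" "\<And>u. T' (T u) = u" "\<And>u. T (T' u) = u"
    and snd: "\<And>u. snd c (a + E u) = T u + d"
    by (rule chartE[OF c]) blast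
  have cont: "continuous_on S f" if "linear f" for f :: "real^'m \<Rightarrow> real^'m" and S
    using that by (simp add: linear_continuous_on linear_conv_bounded_linear)
  have adj: "continuous_on P (adjoint E)"
    using adjoint_linear[OF linear_E] by (simp add: linear_continuous_on linear_conv_bounded_linear)
  have "homeomorphic_maps (top_of_set P) euclidean (snd c) (\<lambda>u. a + E (T' (u - d)))"
    unfolding homeomorphic_maps_def
  proof (intro conjI ballI)
    have "continuous_on P (\<lambda>q. T (adjoint E q) + d)"
      by (intro continuous_intros continuous_on_compose2[OF cont[OF T(1), of UNIV] adj]) simp
    then have "continuous_on P (snd c)"
      by (rule continuous_on_eq) (auto elim!: P_cases simp: snd)
    then show "continuous_map (top_of_set P) euclidean (snd c)" by simp
    have "continuous_on UNIV (\<lambda>u. a + E (T' (u - d)))"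
      by (intro continuous_on_compose2[OF cont_param[of UNIV]] continuous_on_compose2[OF cont[OF T(2), of UNIV]]
           continuous_intros) auto
    then show "continuous_map euclidean (top_of_set P) (\<lambda>u. a + E (T' (u - d)))"
      by (simp add: continuous_map_in_subtopology)
    show "a + E (T' (snd c q - d)) = q" if "q \<in> topspace (top_of_set P)" for q
      using that by (auto elim!: P_cases simp: snd T(3))
    show "snd c (a + E (T' (u - d))) = u" for u by (simp add: snd T(4))
  qed
  then show "homeomorphic_map (subtopology (top_of_set P) (fst c)) (top_of_set (snd c ` fst c)) (snd c)"
    by (simp add: im subtopology_subtopology homeomorphic_maps_imp_map)
next
  fix c c2 :: "(real^'n, 'm) chart" assume c: "c \<in> plane_atlas P" and c2: "c2 \<in> plane_atlas P"
  obtain p T where T: "linear T" "surj T" and ic: "in_chart c (\<lambda>q. q) = (\<lambda>u. p + E (T u))"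
    by (rule in_chart_affine[OF c])
  obtain L b where L: "linear L" "snd c2 = (\<lambda>q. L q + b)"
    using c2 by (auto simp: plane_atlas_def)
  have "in_chart c (snd c2) = (\<lambda>u. snd c2 (in_chart c (\<lambda>q. q) u))"
    by (simp add: in_chart_def fun_eq_iff)
  also have "\<dots> = (\<lambda>u. (L p + b) + L (E (T u)))"
    by (simp add: ic L linear_add[OF L(1)] fun_eq_iff)
  finally have eq: "in_chart c (snd c2) = (\<lambda>u. (L p + b) + L (E (T u)))" .
  have "bounded_linear (\<lambda>u. L (E (T u)))"
    using linear_compose[OF linear_compose[OF T(1) linear_E] L(1)] by (simp add: linear_conv_bounded_linear o_def)
  from smooth_on_affine[OF this]
  show "smooth_on (in_chart (fst c, snd c) (snd c2)) (snd c ` (fst c \<inter> fst c2))" by (simp add: eq)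
qed

lemma immersion_inclusion: "immersion (top_of_set P) (plane_atlas P :: (real^'n, 'm) chart set) (\<lambda>q. q)"
  unfolding immersion_def
proof (intro conjI ballI smooth_manifold_plane smooth_map_inclusion)
  fix c :: "(real^'n, 'm) chart" and q assume c: "c \<in> plane_atlas P"
  obtain T where T: "linear T" "surj T" "\<And>u. frechet_derivative (in_chart c (\<lambda>q. q)) (at u) =
      (\<lambda>v. E (T v))"
    by (rule frechet_inclusion[OF c]) blast
  have "inj T" using T by (simp add: linear_surjective_imp_injective)
  then show "inj (frechet_derivative (in_chart c (\<lambda>q. q)) (at (snd c q)))"
    using inj_E by (simp add: T(3) inj_def)
qed

lemma tangent_space_inclusion:
  fixes c :: "(real^'n, 'm) chart"
  assumes "c \<in> plane_atlas P"
  shows "tangent_space c (\<lambda>q. q) q = range E"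
proof -
  obtain T where T: "linear T" "surj T" "\<And>u. frechet_derivative (in_chart c (\<lambda>q. q)) (at u) =
      (\<lambda>v. E (T v))"
    by (rule frechet_inclusion[OF assms]) blast
  have "range (\<lambda>v. E (T v)) = E ` range T" by (simp add: image_image)
  then show ?thesis using T by (simp add: tangent_space_def)
qed

lemma normal_part_inclusion:
  fixes c :: "(real^'n, 'm) chart"
  assumes "c \<in> plane_atlas P" and "\<And>v. w \<bullet> E v = 0"
  shows "normal_part c (\<lambda>q. q) q (w + E u) = w"
proof -
  have "closest_point (range E) (w + E u) = E u"
    by (rule closest_point_subspace_eq) (auto simp: linear_subspace_image[OF linear_E] assms(2))
  then show ?thesis by (simp add: normal_part_def tangent_space_inclusion[OF assms(1)])
qed

lemma normal_part_0:
  fixes c :: "(real^'n, 'm) chart"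
  assumes "c \<in> plane_atlas P"
  shows "normal_part c (\<lambda>q. q) q 0 = 0"
  using normal_part_inclusion[OF assms, of 0 q 0] by (simp add: linear_0[OF linear_E])

lemma pder_const: "pder c i (\<lambda>q. w) q = 0"
  by (simp add: pder_def in_chart_def o_def)

lemma parallel_normal_const:
  assumes "\<And>v. w \<bullet> E v = 0"
  shows "parallel_normal (plane_atlas P :: (real^'n, 'm) chart set) (\<lambda>q. q) (\<lambda>q. w)"
  unfolding parallel_normal_def normal_along_def
proof (intro conjI ballI allI)
  have "in_chart c (\<lambda>q. w) = (\<lambda>u. w)" for c :: "(real^'n, 'm) chart" by (simp add: in_chart_def o_def)
  then show "smooth_map (plane_atlas P :: (real^'n, 'm) chart set) (\<lambda>q. w)"
    by (auto simp: smooth_map_def smooth_on_const)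
qed (use assms in \<open>auto simp: tangent_space_inclusion normal_connection_def pder_const normal_part_0\<close>)

text \<open>In affine charts the coordinate fields are constant, so the second fundamental form
  vanishes. The position \<open>a + E u\<close> splits into the normal vector \<open>a\<close> and
  the tangent vector \<open>E u\<close>.\<close>

lemma xi_submanifold_plane:
  "xi_submanifold (top_of_set P) (plane_atlas P :: (real^'n, 'm) chart set) (\<lambda>q. q) (\<lambda>q. a)"
  unfolding xi_submanifold_def
proof (intro conjI ballI immersion_inclusion parallel_normal_const orth)
  fix c :: "(real^'n, 'm) chart" and q assume c: "c \<in> plane_atlas P" and q: "q \<in> fst c"
  obtain T where T: "linear T" "surj T" "\<And>u. frechet_derivative (in_chart c (\<lambda>q. q)) (at u) =
      (\<lambda>v. E (T v))"
    by (rule frechet_inclusion[OF c]) blast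
  have "pder c j (\<lambda>q. q) = (\<lambda>q. E (T (axis j 1)))" for j by (simp add: pder_def T(3) fun_eq_iff)
  then have "mean_curvature c (\<lambda>q. q) q = 0"
    by (simp add: mean_curvature_def second_fundamental_form_def pder_const normal_part_0[OF c])
  moreover have "normal_part c (\<lambda>q. q) q q = a"
  proof -
    obtain u where "q = a + E u" using q chart_image(1)[OF c] P_cases by metis
    then show ?thesis using normal_part_inclusion[OF c orth] by simp
  qed
  ultimately show "mean_curvature c (\<lambda>q. q) q + normal_part c (\<lambda>q. q) q q = a" by simp
qed

section \<open>Weighted volume and stability in isometric coordinates\<close>

lemma weighted_volume_eq:
  fixes y :: "real^'n \<Rightarrow> real^'n"
  assumes diff: "\<And>u. (\<lambda>u. y (a + E u)) differentiable (at u)"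
    and cont: "continuous_on UNIV (\<lambda>u. det (gram chart0 y (a + E u)))"
  shows "weighted_volume (top_of_set P) (plane_atlas P :: (real^'n, 'm) chart set) (\<lambda>q. a) y =
    (\<integral>\<^sup>+u. ennreal (exp (- (1/2) * (norm (y (a + E u) - a))\<^sup>2) * sqrt (det (gram
        chart0 y (a + E u)))) \<partial>lborel)"
proof -
  have [measurable]: "(\<lambda>u. det (gram chart0 y (a + E u))) \<in> borel_measurable borel"
    by (rule borel_measurable_continuous_onI[OF cont])
  have cy: "continuous_on UNIV (\<lambda>u. y (a + E u))"
    using diff by (simp add: continuous_at_imp_continuous_on differentiable_imp_continuous_within)
  then have [measurable]: "(\<lambda>u. y (a + E u)) \<in> borel_measurable borel"
    by (rule borel_measurable_continuous_onI)
  have "continuous_on UNIV (\<lambda>u. ennreal (exp (- (1/2) * (norm (y (a + E u) - a))\<^sup>2)))"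
    by (intro continuous_intros cy continuous_on_ennreal)
  then have m: "(\<lambda>q. ennreal (exp (- (1/2) * (norm (y q - a))\<^sup>2))) \<in> borel_measurable borel_P"
    by (rule measurable_borel_P)
  have ennreal_exp_mult: "ennreal (exp x * s) = ennreal s * ennreal (exp x)" for x s :: real
    by (subst ennreal_mult') (simp_all add: mult.commute)
  show ?thesis
    unfolding weighted_volume_def volume_measure_eq[OF assms]
    by (subst nn_integral_distr)
       (use param_measurable m in \<open>simp_all add: nn_integral_density ennreal_exp_mult\<close>)
qed

lemma gram_inclusion: "gram chart0 (\<lambda>q. q) (a + E u) = mat 1"
  by (simp add: gram_chart0 frechet_derivative_affine[OF bounded_linear_E] inner_E inner_axis_orthonormal mat_def)

lemma inclusion_differentiable: "(\<lambda>u. a + E u) differentiable (at u)"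
  by (intro derivative_intros bounded_linear_imp_differentiable bounded_linear_E)

lemma norm_E: "norm (E u) = norm u"
  by (simp add: norm_eq_sqrt_inner inner_E)

lemma weighted_volume_finite:
  "weighted_volume (top_of_set P) (plane_atlas P :: (real^'n, 'm) chart set) (\<lambda>q. a) (\<lambda>q.
      q) < \<infinity>"
proof -
  have "weighted_volume (top_of_set P) (plane_atlas P :: (real^'n, 'm) chart set) (\<lambda>q. a) (\<lambda>q. q) =
    integral\<^sup>N lborel (\<lambda>u::real^'m. ennreal (exp (- (norm u)\<^sup>2 / 2)))"
    by (subst weighted_volume_eq) (simp_all add: inclusion_differentiable gram_inclusion norm_E)
  also have "\<dots> < \<infinity>"
    using integrable_exp_norm[where 'a="real^'m"] by (simp add: integrable_iff_bounded)
  finally show ?thesis .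
qed

lemma integral_plane:
  fixes f :: "real^'n \<Rightarrow> real"
  assumes "continuous_on UNIV (\<lambda>u. f (a + E u))"
  shows "(\<integral>q. f q \<partial>volume_measure (top_of_set P) (plane_atlas P :: (real^'n, 'm) chart
      set) (\<lambda>q. q)) =
    (\<integral>u. f (a + E u) \<partial>lborel)"
proof -
  have "volume_measure (top_of_set P) (plane_atlas P :: (real^'n, 'm) chart set) (\<lambda>q. q) =
     distr (density lborel (\<lambda>u. 1)) borel_P (\<lambda>u. a + E u)"
    by (subst volume_measure_eq) (simp_all add: inclusion_differentiable gram_inclusion)
  moreover have "(\<lambda>u. a + E u) \<in> density lborel (\<lambda>u. 1) \<rightarrow>\<^sub>M borel_P"
      using param_measurable by simp
  ultimately show ?thesis
    using measurable_borel_P[OF assms] by (simp add: integral_distr density_1)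
qed

lemma W_stable_plane: "W_stable (top_of_set P) (plane_atlas P :: (real^'n, 'm) chart set) (\<lambda>q. q)
    (\<lambda>q. a)"
  unfolding W_stable_def
proof (intro conjI allI impI xi_submanifold_plane weighted_volume_finite)
  let ?A = "plane_atlas P :: (real^'n, 'm) chart set"
  fix e F
  assume "variation (top_of_set P) ?A (\<lambda>q. q) e F \<and> compact_variation (top_of_set P) e F \<and>
    VP_variation (top_of_set P) ?A (\<lambda>q. q) (\<lambda>q. a) F"
  then have var: "variation (top_of_set P) ?A (\<lambda>q. q) e F" and cpt: "compact_variation (top_of_set P) e F"
    and VP: "VP_variation (top_of_set P) ?A (\<lambda>q. q) (\<lambda>q. a) F" by auto
  define J where "J = {-e<..<e}"
  define Y where "Y z = F (a + E (fst z)) (snd z)" for z :: "(real^'m) \<times> real"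
  have e: "0 < e" using var by (simp add: variation_def)
  have J: "open J" "convex J" "0 \<in> J" using e by (auto simp: J_def)
  have Ysm: "smooth_on Y (UNIV \<times> J)"
  proof -
    have "smooth_on (\<lambda>(u, t). in_chart chart0 (\<lambda>q. F q t) u) ((snd chart0 ` fst chart0) \<times> J)"
      using var chart0_in_atlas by (auto simp: variation_def J_def)
    moreover have "(\<lambda>(u, t). in_chart chart0 (\<lambda>q. F q t) u) = Y"
      by (auto simp: in_chart0 Y_def fun_eq_iff)
    moreover have "snd chart0 ` fst chart0 = UNIV"
      using chart_image[OF chart0_in_atlas] by simp
    ultimately show ?thesis by simp
  qed
  have dY: "Y differentiable (at (u, t))" if "t \<in> J" for u t
    using smooth_on_differentiable[OF Ysm] that by auto
  have slice: "(\<lambda>q. F q t) (a + E u) = Y (u, t)" for u t by (simp add: Y_def)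
  have vel: "((\<lambda>t. Y (u, t)) has_vector_derivative dirder (0, 1) Y (u, t)) (at t)" if "t \<in> J" for u t
    using C2_jet_smooth[OF Ysm] that by (auto simp: C2_jet_def)
  have velocity: "velocity F t (a + E u) = dirder (0, 1) Y (u, t)" if "t \<in> J" for u t
  proof -
    have "F (a + E u) = (\<lambda>t. Y (u, t))" by (simp add: Y_def fun_eq_iff)
    then show ?thesis using vector_derivative_at[OF vel[OF that]] by (simp add: velocity_def)
  qed
  have Y0: "Y (u, 0) = a + E u" for u using var by (simp add: variation_def Y_def)
  have imm: "inj (\<lambda>v. dirder (v, 0) Y (u, t))" if "t \<in> J" for u t
  proof -
    have "immersion (top_of_set P) ?A (\<lambda>q. F q t)" using var that by (auto simp: variation_def J_def)
    moreover have "a + E u \<in> fst chart0" by (simp add: chart0_def)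
    ultimately have "inj (frechet_derivative (in_chart chart0 (\<lambda>q. F q t)) (at (snd chart0 (a + E u))))"
      using chart0_in_atlas unfolding immersion_def by blast
    moreover have "in_chart chart0 (\<lambda>q. F q t) = (\<lambda>u. Y (u, t))" by (simp add: in_chart0
        Y_def fun_eq_iff)
    moreover have "snd chart0 (a + E u) = u" by (simp add: chart0_def)
    ultimately show ?thesis using frechet_derivative_slice(2)[OF dY[OF that]] by simp
  qed
  have field: "variation_field F (a + E u) = dirder (0, 1) Y (u, 0)" for u
    using velocity[OF J(3)] by (simp add: variation_field_def)
  have SN: "SN_variation (top_of_set P) ?A (\<lambda>q. q) F" using VP by (simp add: VP_variation_def)
  have normal: "dirder (0, 1) Y (u, 0) \<bullet> E v = 0" for u v
  proof -
    have "variation_field F (a + E u) \<bullet> E v = 0"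
      using SN chart0_in_atlas tangent_space_inclusion[OF chart0_in_atlas]
      unfolding SN_variation_def normal_along_def by (auto simp: chart0_def)
    then show ?thesis by (simp add: field)
  qed
  have acc: "dirder (0, 1) (dirder (0, 1) Y) (u, 0) = 0" for u
  proof -
    have "((\<lambda>t. dirder (0, 1) Y (u, t)) has_vector_derivative dirder (0, 1) (dirder (0, 1) Y) (u, 0)) (at 0)"
      using C2_jet_smooth[OF Ysm] J by (auto simp: C2_jet_def)
    then have "((\<lambda>t. velocity F t (a + E u)) has_vector_derivative dirder (0, 1) (dirder (0, 1) Y)
        (u, 0)) (at 0)"
      by (rule has_vector_derivative_transform_within_open[OF _ J(1,3)]) (simp add: velocity)
    then have "vector_derivative (\<lambda>t. velocity F t (a + E u)) (at 0) = dirder (0, 1) (dirder (0, 1) Y) (u, 0)"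
      by (rule vector_derivative_at)
    then show ?thesis using SN by (simp add: SN_variation_def)
  qed
  obtain B where B: "openin (top_of_set P) B" "compactin (top_of_set P) (top_of_set P closure_of B)"
    and supp: "\<And>t. t \<in> J \<Longrightarrow> top_of_set P closure_of {q \<in> topspace (top_of_set
        P). velocity F t q \<noteq> 0} \<subseteq> B"
    using cpt by (auto simp: compact_variation_def J_def)
  \<comment> \<open>The support condition places the moving points in \<open>B\<close>; its closure
    is compact, and \<open>K\<close> is that closure in isometric coordinates. It serves all times
    at once.\<close>
  define K where "K = adjoint E ` (top_of_set P closure_of B)"
  have "compact (top_of_set P closure_of B)" using B(2) by (simp add: compactin_subtopology)
  then have K: "compact K"
    unfolding K_def using adjoint_linear[OF linear_E]
    by (intro compact_continuous_image linear_continuous_on) (simp_all add: linear_conv_bounded_linear)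
  have vK: "dirder (0, 1) Y (u, t) = 0" if u: "u \<notin> K" and t: "t \<in> J" for u t
  proof (rule ccontr)
    assume "dirder (0, 1) Y (u, t) \<noteq> 0"
    then have "a + E u \<in> {q \<in> topspace (top_of_set P). velocity F t q \<noteq> 0}" by (simp add:
        velocity[OF t])
    then have "a + E u \<in> top_of_set P closure_of {q \<in> topspace (top_of_set P). velocity F t q \<noteq> 0}"
      by (rule subsetD[OF closure_of_subset, rotated]) auto
    then have "a + E u \<in> B" using supp[OF t] by blast
    then have "a + E u \<in> top_of_set P closure_of B"
      by (rule subsetD[OF closure_of_subset, rotated]) (use B(1) openin_subset in blast)
    then have "adjoint E (a + E u) \<in> K" unfolding K_def by (rule imageI)
    then show False using u by simp
  qed
  \<comment> \<open>Compactness of a variation controls the velocity at every time, not just at 0.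
    On the interval \<open>J\<close> a point with zero velocity throughout keeps its initial
    position, which is its position in the plane.\<close>
  have YK: "Y (u, t) = a + E u" if u: "u \<notin> K" and t: "t \<in> J" for u t
  proof -
    have "((\<lambda>t. Y (u, t)) has_vector_derivative 0) (at t within J)" if "t \<in> J" for t
      using vel[OF that, of u] vK[OF u that] by (simp add: has_vector_derivative_at_within)
    then obtain c where "\<And>t. t \<in> J \<Longrightarrow> Y (u, t) = c"
      using has_vector_derivative_zero_constant[OF J(2), of "\<lambda>t. Y (u, t)"] by blast
    then show ?thesis using t J(3) Y0[of u] by simp
  qed
  define n where "n u = dirder (0, 1) Y (u, 0)" for u
  have contn: "continuous_on UNIV n"
    unfolding n_def using J(3)
    by (intro continuous_on_compose2[OF smooth_on_continuous[OF smooth_on_dirder[OF Ysm]]] continuous_intros) auto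
  \<comment> \<open>The Gaussian mean of \<open>n\<close> up to normalisation, taken as a vector in
    the ambient space. A single test field then settles all components, since testing with
    \<open>m\<close> itself yields \<open>m \<bullet> m\<close>.\<close>
  define m where "m = (\<integral>u. exp (- (norm u)\<^sup>2 / 2) *\<^sub>R n u \<partial>lborel)"
  have int: "integrable lborel (\<lambda>u. exp (- (norm u)\<^sup>2 / 2) *\<^sub>R n u)"
  proof -
    have "integrable lborel (\<lambda>u. indicator K u *\<^sub>R (exp (- (norm u)\<^sup>2 / 2) *\<^sub>R n u))"
      by (intro borel_integrable_compact[OF K] continuous_intros continuous_on_subset[OF contn]) simp_all
    moreover have "indicator K u *\<^sub>R (exp (- (norm u)\<^sup>2 / 2) *\<^sub>R n u) = exp (- (norm
        u)\<^sup>2 / 2) *\<^sub>R n u" for u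
      using vK[of u 0] J(3) by (cases "u \<in> K") (simp_all add: n_def)
    ultimately show ?thesis by (simp only:)
  qed
  have mc: "(\<integral>u. exp (- (norm u)\<^sup>2 / 2) * (n u \<bullet> c) \<partial>lborel) = m \<bullet> c" for c
    unfolding m_def using integral_inner_left[of c lborel "\<lambda>u. exp (- (norm u)\<^sup>2 / 2)
        *\<^sub>R n u"] int by simp
  have "m \<bullet> E v = 0" for v
    unfolding mc[symmetric] by (simp add: n_def normal)
  from parallel_normal_const[OF this]
  have "(\<integral>q. (variation_field F q \<bullet> m) * exp (- (1/2) * (norm (q - a))\<^sup>2)
      \<partial>volume_measure (top_of_set P) ?A (\<lambda>q. q)) = 0"
    using VP by (simp add: VP_variation_def)
  moreover have "continuous_on UNIV (\<lambda>u. (variation_field F (a + E u) \<bullet> m) * exp (- (1/2) *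
      (norm (a + E u - a))\<^sup>2))"
    unfolding field n_def[symmetric] by (intro continuous_intros contn cont_param)
  ultimately have "(\<integral>u. (n u \<bullet> m) * exp (- (1/2) * (norm (a + E u - a))\<^sup>2)
      \<partial>lborel) = 0"
    by (subst (asm) integral_plane) (simp_all add: field n_def)
  then have "m \<bullet> m = 0" unfolding mc[symmetric] by (simp add: norm_E mult.commute)
  then have mean: "(\<integral>u. exp (- (norm u)\<^sup>2 / 2) * (dirder (0, 1) Y (u, 0) \<bullet> c)
      \<partial>lborel) = 0" for c
    using mc[of c] by (simp add: n_def)
  have stable: "second_derivative_nonneg_at_0 (\<lambda>t. enn2real (\<integral>\<^sup>+u. ennreal (exp (-
      (1/2) * (norm (Y (u, t) - a))\<^sup>2) *
      sqrt (det (\<chi> i j. dirder (axis i 1, 0) Y (u, t) \<bullet> dirder (axis j 1, 0) Y (u, t))))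
          \<partial>lborel))"
    by (rule weighted_area_second_variation[OF e _ linear_E inner_E Y0 _ normal acc K _ mean])
       (use Ysm imm YK in \<open>auto simp: J_def\<close>)
  show "second_derivative_nonneg_at_0 (\<lambda>t. enn2real (weighted_volume (top_of_set P) ?A (\<lambda>q.
      a) (\<lambda>q. F q t)))"
  proof (rule second_derivative_nonneg_at_0_cong[OF stable J(1,3)])
    fix t assume t: "t \<in> J"
    have fr: "frechet_derivative (\<lambda>u. F (a + E u) t) (at u) = (\<lambda>v. dirder (v, 0) Y (u, t))"
      and df: "(\<lambda>u. F (a + E u) t) differentiable (at u)" for u
      using frechet_derivative_slice[OF dY[OF t]] by (simp_all add: Y_def)
    have gr: "gram chart0 (\<lambda>q. F q t) (a + E u) = (\<chi> i j. dirder (axis i 1, 0) Y (u, t)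
        \<bullet> dirder (axis j 1, 0) Y (u, t))" for u
      by (simp add: gram_chart0 fr)
    have "continuous_on UNIV (\<lambda>u. dirder w Y (u, t))" for w
      using t by (intro continuous_on_compose2[OF smooth_on_continuous[OF smooth_on_dirder[OF Ysm]]]
          continuous_intros) auto
    then have "continuous_on UNIV (\<lambda>u. det (gram chart0 (\<lambda>q. F q t) (a + E u)))"
      unfolding gr det_def by (auto intro!: continuous_intros)
    from weighted_volume_eq[OF df this]
    show "enn2real (\<integral>\<^sup>+u. ennreal (exp (- (1/2) * (norm (Y (u, t) - a))\<^sup>2) *
      sqrt (det (\<chi> i j. dirder (axis i 1, 0) Y (u, t) \<bullet> dirder (axis j 1, 0) Y (u, t))))
          \<partial>lborel) =
      enn2real (weighted_volume (top_of_set P) ?A (\<lambda>q. a) (\<lambda>q. F q t))"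
      by (simp add: gr Y_def)
  qed
qed

end

theorem theorem6p1:
  fixes P :: "(real^'n) set" and m p :: nat
  assumes "m \<ge> 1" and "p \<ge> 0"
    and "CARD('m::finite) = m" and "CARD('n::finite) = m + p"
    and "affine P" and "aff_dim P = int m"
  shows "W_stable (top_of_set P) (plane_atlas P :: (real^'n, 'm) chart set)
           (\<lambda>q. q) (\<lambda>q. closest_point P 0)"
proof -
  define a where "a = closest_point P 0"
  have ne: "P \<noteq> {}" using assms(6) by auto
  have cl: "closed P" "convex P" using assms(5) by (auto simp: affine_closed affine_imp_convex)
  have aP: "a \<in> P" unfolding a_def by (rule closest_point_in_set[OF cl(1) ne])
  define T where "T = (\<lambda>x. - a + x) ` P"
  have T: "subspace T" unfolding T_def using affine_diffs_subspace[OF assms(5) aP] .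
  have "int (dim T) = aff_dim P"
    unfolding T_def using aff_dim_dim_affine_diffs[OF assms(5) aP] by (simp add: algebra_simps)
  then have "dim (UNIV :: (real^'m) set) = dim T" using assms by simp
  \<comment> \<open>\<open>T\<close> is the direction space of the plane. It has the same dimension
    as the parameter space, so a linear isometry onto it exists.\<close>
  then obtain E :: "real^'m \<Rightarrow> real^'n" where E: "linear E" "range E = T" "\<And>u. norm (E u) = norm u"
    using isometries_subspaces[OF subspace_UNIV T] by (metis UNIV_I)
  have orth: "a \<bullet> E v = 0" for v
  proof -
    \<comment> \<open>The variational inequality for the point of \<open>P\<close> nearest to the
      origin. Since \<open>P\<close> contains \<open>a + E v\<close> for both signs of
      \<open>v\<close>, it becomes an equality.\<close>
    have "- (a \<bullet> E v) \<le> 0" for v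
    proof -
      have "E v \<in> T" using E(2) by auto
      then have "a + E v \<in> P" by (auto simp: T_def)
      from closest_point_dot[OF cl(2,1) this, of 0] show ?thesis by (simp add: a_def)
    qed
    from this[of v] this[of "-v"] show ?thesis by (simp add: linear_neg[OF E(1)])
  qed
  \<comment> \<open>Polarisation: a linear map that preserves norms preserves inner
    products.\<close>
  have inner: "E u \<bullet> E v = u \<bullet> v" for u v
    using E(3)[of "u + v"] E(3)[of u] E(3)[of v]
    by (simp add: linear_add[OF E(1)] norm_eq_sqrt_inner inner_add inner_commute)
  have P: "P = range (\<lambda>u. a + E u)"
  proof -
    have "range (\<lambda>u. a + E u) = (\<lambda>x. a + x) ` T" unfolding E(2)[symmetric] by (simp add: image_image)
    then show ?thesis by (simp add: T_def image_image)
  qed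
  interpret isometric_plane a E P
    by (rule isometric_plane.intro[OF E(1) inner orth P])
  show ?thesis using W_stable_plane by (simp add: a_def)
qed

end
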